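(* Let $U:\mathcal{E}\to\mathcal{B}$ be a bifibration satisfying the Beck-Chevalley condition, where $\mathcal{B}$ has binary products and pullbacks, and suppose $U$ has a truth functor $K$ and that the equality functor $Eq=\Sigma_\delta K:\mathcal{B}\to Rel(\mathcal{E})$ of $U$ has a left adjoint. Let $I$ be an object of $\mathcal{B}$ and let $F:\mathcal{B}/I\to\mathcal{B}/I$ be a functor whose final coalgebra has carrier $\nu F$. Then there exists an $Eq_{U/I}$-preserving lifting of $F$ with respect to $Rel(U/I)$ which defines a sound coinduction rule for $\nu F$.
   Context: Fibrations, opfibrations (dual notion, with opreindexing $\Sigma_f\dashv f^*$), bifibrations, fibres $\mathcal{E}_X$ are as usual. $U$ satisfies Beck-Chevalley if for every pullback square $ft=gs$ in $\mathcal{B}$ the canonical map $\Sigma_s t^*\to g^*\Sigma_f$ is an isomorphism. A truth functor $K:\mathcal{B}\to\mathcal{E}$ sends $X$ to a terminal object of $\mathcal{E}_X$, these terminal objects being preserved by reindexing. For a bifibration $V:\mathcal{D}\to\mathcal{C}$ with truth functor $K_V$, where $\mathcal{C}$ has binary products: the relations fibration $Rel(V):Rel(\mathcal{D})\to\mathcal{C}$ is the pullback of $V$ along $X\mapsto X\times X$ (fibre above $X$ is $\mathcal{D}_{X\times X}$), and the equality functor $Eq_V:\mathcal{C}\to Rel(\mathcal{D})$ sends $X$ to $\Sigma_{\delta_X}K_VX$, where $\delta_X:X\to X\times X$ is the diagonal. Write $Eq=Eq_U$. The functor $U/I:\mathcal{E}/KI\to\mathcal{B}/I$ sends $f:P\to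 KI$ to $Uf:UP\to I$; it is a bifibration with truth functor $K_{U/I}(f:X\to I)=Kf$. Products in $\mathcal{B}/I$ are given by pullbacks: the product of $f:X\to I$ with itself is $f^2:X\times_I X\to I$, and $Rel(U/I)$, $Eq_{U/I}=\Sigma_{\delta/I}K_{U/I}$ are the relations fibration and equality functor of $U/I$ with respect to these products, $(\delta/I)_f:X\to X\times_I X$ being the diagonal. An $Eq_{U/I}$-preserving lifting of $F$ is a functor $\check F$ on $Rel(\mathcal{E}/KI)$ with $Rel(U/I)\check F=F\,Rel(U/I)$ and $Eq_{U/I}F\cong\check F Eq_{U/I}$; it defines a sound coinduction rule for $\nu F$ if the functor from $F$-coalgebras to $\check F$-coalgebras sending $\alpha:X\to FX$ to $Eq_{U/I}X\xrightarrow{Eq_{U/I}\alpha}Eq_{U/I}FX\cong\check F Eq_{U/I}X$ preserves terminal objects. *)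

theory Defs
  imports Main
begin

section \<open>Categories and functors\<close>

record ('o, 'm) cat =
  Obj :: "'o set"
  Arr :: "'m set"
  Dom :: "'m \<Rightarrow> 'o"
  Cod :: "'m \<Rightarrow> 'o"
  Ide :: "'o \<Rightarrow> 'm"
  Cmp :: "'m \<Rightarrow> 'm \<Rightarrow> 'm" (infixr "\<cdot>\<index>" 70)

definition Hom :: "('o, 'm) cat \<Rightarrow> 'o \<Rightarrow> 'o \<Rightarrow> 'm set" where
  "Hom C x y = {f \<in> Arr C. Dom C f = x \<and> Cod C f = y}"

locale category =
  fixes C :: "('o, 'm) cat" (structure)
  assumes Dom_Obj: "f \<in> Arr C \<Longrightarrow> Dom C f \<in> Obj C"
    and Cod_Obj: "f \<in> Arr C \<Longrightarrow> Cod C f \<in> Obj C"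
    and Ide_Hom: "x \<in> Obj C \<Longrightarrow> Ide C x \<in> Hom C x x"
    and Cmp_Hom: "f \<in> Hom C x y \<Longrightarrow> g \<in> Hom C y z \<Longrightarrow> g \<cdot> f \<in> Hom C x z"
    and Cmp_Ide: "f \<in> Hom C x y \<Longrightarrow> f \<cdot> Ide C x = f"
    and Ide_Cmp: "f \<in> Hom C x y \<Longrightarrow> Ide C y \<cdot> f = f"
    and Cmp_assoc: "f \<in> Hom C w x \<Longrightarrow> g \<in> Hom C x y \<Longrightarrow> h \<in> Hom C y z \<Longrightarrow>
      h \<cdot> (g \<cdot> f) = (h \<cdot> g) \<cdot> f"

record ('o1, 'm1, 'o2, 'm2) func =
  omap :: "'o1 \<Rightarrow> 'o2"
  amap :: "'m1 \<Rightarrow> 'm2"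

locale cat_functor = src: category C + tgt: category D
  for C :: "('o1, 'm1) cat" and D :: "('o2, 'm2) cat" and F :: "('o1, 'm1, 'o2, 'm2) func" +
  assumes omap_Obj: "x \<in> Obj C \<Longrightarrow> omap F x \<in> Obj D"
    and amap_Hom: "f \<in> Hom C x y \<Longrightarrow> amap F f \<in> Hom D (omap F x) (omap F y)"
    and amap_Ide: "x \<in> Obj C \<Longrightarrow> amap F (Ide C x) = Ide D (omap F x)"
    and amap_Cmp: "f \<in> Hom C x y \<Longrightarrow> g \<in> Hom C y z \<Longrightarrow>
      amap F (g \<cdot>\<^bsub>C\<^esub> f) = amap F g \<cdot>\<^bsub>D\<^esub> amap F f"

definition id_func :: "('o, 'm, 'o, 'm) func" where
  "id_func = \<lparr>omap = (\<lambda>x. x), amap = (\<lambda>f. f)\<rparr>"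

definition comp_func ::
  "('o2, 'm2, 'o3, 'm3) func \<Rightarrow> ('o1, 'm1, 'o2, 'm2) func \<Rightarrow> ('o1, 'm1, 'o3, 'm3) func"
  (infixr "\<circ>\<^sub>F" 70) where
  "G \<circ>\<^sub>F F = \<lparr>omap = (\<lambda>x. omap G (omap F x)), amap = (\<lambda>f. amap G (amap F f))\<rparr>"

text \<open>Equality of functors out of \<open>C\<close>; values outside the carriers of \<open>C\<close> are irrelevant.\<close>

definition func_eq ::
  "('o1, 'm1) cat \<Rightarrow> ('o1, 'm1, 'o2, 'm2) func \<Rightarrow> ('o1, 'm1, 'o2, 'm2) func \<Rightarrow> bool" where
  "func_eq C F G \<longleftrightarrow>
     (\<forall>x\<in>Obj C. omap F x = omap G x) \<and> (\<forall>f\<in>Arr C. amap F f = amap G f)"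

definition iso :: "('o, 'm) cat \<Rightarrow> 'm \<Rightarrow> bool" where
  "iso C f \<longleftrightarrow> f \<in> Arr C \<and>
     (\<exists>g\<in>Hom C (Cod C f) (Dom C f).
        g \<cdot>\<^bsub>C\<^esub> f = Ide C (Dom C f) \<and> f \<cdot>\<^bsub>C\<^esub> g = Ide C (Cod C f))"

definition terminal :: "('o, 'm) cat \<Rightarrow> 'o \<Rightarrow> bool" where
  "terminal C t \<longleftrightarrow> t \<in> Obj C \<and> (\<forall>x\<in>Obj C. \<exists>!f. f \<in> Hom C x t)"

definition preserves_terminal ::
  "('o1, 'm1) cat \<Rightarrow> ('o2, 'm2) cat \<Rightarrow> ('o1, 'm1, 'o2, 'm2) func \<Rightarrow> bool" where
  "preserves_terminal C D F \<longleftrightarrow> (\<forall>t. terminal C t \<longrightarrow> terminal D (omap F t))"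

definition nat_trans ::
  "('o1, 'm1) cat \<Rightarrow> ('o2, 'm2) cat \<Rightarrow> ('o1, 'm1, 'o2, 'm2) func \<Rightarrow>
   ('o1, 'm1, 'o2, 'm2) func \<Rightarrow> ('o1 \<Rightarrow> 'm2) \<Rightarrow> bool" where
  "nat_trans C D F G \<tau> \<longleftrightarrow>
     (\<forall>x\<in>Obj C. \<tau> x \<in> Hom D (omap F x) (omap G x)) \<and>
     (\<forall>f\<in>Arr C. amap G f \<cdot>\<^bsub>D\<^esub> \<tau> (Dom C f) = \<tau> (Cod C f) \<cdot>\<^bsub>D\<^esub> amap F f)"

definition nat_iso ::
  "('o1, 'm1) cat \<Rightarrow> ('o2, 'm2) cat \<Rightarrow> ('o1, 'm1, 'o2, 'm2) func \<Rightarrow>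
   ('o1, 'm1, 'o2, 'm2) func \<Rightarrow> ('o1 \<Rightarrow> 'm2) \<Rightarrow> bool" where
  "nat_iso C D F G \<tau> \<longleftrightarrow> nat_trans C D F G \<tau> \<and> (\<forall>x\<in>Obj C. iso D (\<tau> x))"

definition has_left_adjoint ::
  "('o1, 'm1) cat \<Rightarrow> ('o2, 'm2) cat \<Rightarrow> ('o1, 'm1, 'o2, 'm2) func \<Rightarrow> bool" where
  "has_left_adjoint C D G \<longleftrightarrow>
     (\<exists>L \<eta> \<epsilon>. cat_functor D C L \<and>
        nat_trans D D id_func (G \<circ>\<^sub>F L) \<eta> \<and>
        nat_trans C C (L \<circ>\<^sub>F G) id_func \<epsilon> \<and>
        (\<forall>d\<in>Obj D. \<epsilon> (omap L d) \<cdot>\<^bsub>C\<^esub> amap L (\<eta> d) = Ide C (omap L d)) \<and>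
        (\<forall>c\<in>Obj C. amap G (\<epsilon> c) \<cdot>\<^bsub>D\<^esub> \<eta> (omap G c) = Ide D (omap G c)))"


section \<open>Binary products and pullbacks\<close>

text \<open>A choice of spans indexed by pairs: by two objects for binary products, by two arrows with
  common codomain for pullbacks.\<close>

record ('i, 'm) spans =
  Leg1 :: "'i \<Rightarrow> 'i \<Rightarrow> 'm"
  Leg2 :: "'i \<Rightarrow> 'i \<Rightarrow> 'm"

definition product_span :: "('o, 'm) cat \<Rightarrow> 'o \<Rightarrow> 'o \<Rightarrow> 'm \<Rightarrow> 'm \<Rightarrow> bool" where
  "product_span C x y p q \<longleftrightarrow>
     p \<in> Arr C \<and> q \<in> Arr C \<and> Dom C p = Dom C q \<and> Cod C p = x \<and> Cod C q = y \<and>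
     (\<forall>w u v. u \<in> Hom C w x \<longrightarrow> v \<in> Hom C w y \<longrightarrow>
        (\<exists>!h. h \<in> Hom C w (Dom C p) \<and> p \<cdot>\<^bsub>C\<^esub> h = u \<and> q \<cdot>\<^bsub>C\<^esub> h = v))"

definition binary_products :: "('o, 'm) cat \<Rightarrow> ('o, 'm) spans \<Rightarrow> bool" where
  "binary_products C pr \<longleftrightarrow>
     (\<forall>x\<in>Obj C. \<forall>y\<in>Obj C. product_span C x y (Leg1 pr x y) (Leg2 pr x y))"

text \<open>The square \<open>f \<cdot> t = g \<cdot> s\<close>.\<close>

definition pullback_square :: "('o, 'm) cat \<Rightarrow> 'm \<Rightarrow> 'm \<Rightarrow> 'm \<Rightarrow> 'm \<Rightarrow> bool" where
  "pullback_square C f t g s \<longleftrightarrow>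
     f \<in> Arr C \<and> t \<in> Arr C \<and> g \<in> Arr C \<and> s \<in> Arr C \<and>
     Cod C f = Cod C g \<and> Cod C t = Dom C f \<and> Cod C s = Dom C g \<and> Dom C t = Dom C s \<and>
     f \<cdot>\<^bsub>C\<^esub> t = g \<cdot>\<^bsub>C\<^esub> s \<and>
     (\<forall>w u v. u \<in> Hom C w (Dom C f) \<longrightarrow> v \<in> Hom C w (Dom C g) \<longrightarrow>
        f \<cdot>\<^bsub>C\<^esub> u = g \<cdot>\<^bsub>C\<^esub> v \<longrightarrow>
        (\<exists>!h. h \<in> Hom C w (Dom C t) \<and> t \<cdot>\<^bsub>C\<^esub> h = u \<and> s \<cdot>\<^bsub>C\<^esub> h = v))"

definition pullbacks :: "('o, 'm) cat \<Rightarrow> ('m, 'm) spans \<Rightarrow> bool" where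
  "pullbacks C pb \<longleftrightarrow>
     (\<forall>f\<in>Arr C. \<forall>g\<in>Arr C. Cod C f = Cod C g \<longrightarrow>
        pullback_square C f (Leg1 pb f g) g (Leg2 pb f g))"

definition prod_obj :: "('o, 'm) cat \<Rightarrow> ('o, 'm) spans \<Rightarrow> 'o \<Rightarrow> 'o \<Rightarrow> 'o" where
  "prod_obj C pr x y = Dom C (Leg1 pr x y)"

definition pairing :: "('o, 'm) cat \<Rightarrow> ('o, 'm) spans \<Rightarrow> 'm \<Rightarrow> 'm \<Rightarrow> 'm" where
  "pairing C pr u v =
     (THE h. h \<in> Hom C (Dom C u) (prod_obj C pr (Cod C u) (Cod C v)) \<and>
        Leg1 pr (Cod C u) (Cod C v) \<cdot>\<^bsub>C\<^esub> h = u \<and>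
        Leg2 pr (Cod C u) (Cod C v) \<cdot>\<^bsub>C\<^esub> h = v)"

definition diagonal :: "('o, 'm) cat \<Rightarrow> ('o, 'm) spans \<Rightarrow> 'o \<Rightarrow> 'm" where
  "diagonal C pr x = pairing C pr (Ide C x) (Ide C x)"

text \<open>The functor \<open>X \<mapsto> X \<times> X\<close>.\<close>

definition square_func :: "('o, 'm) cat \<Rightarrow> ('o, 'm) spans \<Rightarrow> ('o, 'm, 'o, 'm) func" where
  "square_func C pr =
     \<lparr>omap = (\<lambda>x. prod_obj C pr x x),
      amap = (\<lambda>f. pairing C pr (f \<cdot>\<^bsub>C\<^esub> Leg1 pr (Dom C f) (Dom C f))
                             (f \<cdot>\<^bsub>C\<^esub> Leg2 pr (Dom C f) (Dom C f)))\<rparr>"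


section \<open>Fibrations\<close>

definition fibre ::
  "('eo, 'em) cat \<Rightarrow> ('bo, 'bm) cat \<Rightarrow> ('eo, 'em, 'bo, 'bm) func \<Rightarrow> 'bo \<Rightarrow> ('eo, 'em) cat" where
  "fibre E B U x =
     \<lparr>Obj = {P \<in> Obj E. omap U P = x},
      Arr = {h \<in> Arr E. omap U (Dom E h) = x \<and> omap U (Cod E h) = x \<and> amap U h = Ide B x},
      Dom = Dom E, Cod = Cod E, Ide = Ide E, Cmp = Cmp E\<rparr>"

definition cartesian ::
  "('eo, 'em) cat \<Rightarrow> ('bo, 'bm) cat \<Rightarrow> ('eo, 'em, 'bo, 'bm) func \<Rightarrow> 'em \<Rightarrow> bool" where
  "cartesian E B U h \<longleftrightarrow> h \<in> Arr E \<and>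
     (\<forall>R k g. k \<in> Hom E R (Cod E h) \<longrightarrow> g \<in> Hom B (omap U R) (omap U (Dom E h)) \<longrightarrow>
        amap U h \<cdot>\<^bsub>B\<^esub> g = amap U k \<longrightarrow>
        (\<exists>!l. l \<in> Hom E R (Dom E h) \<and> amap U l = g \<and> h \<cdot>\<^bsub>E\<^esub> l = k))"

definition opcartesian ::
  "('eo, 'em) cat \<Rightarrow> ('bo, 'bm) cat \<Rightarrow> ('eo, 'em, 'bo, 'bm) func \<Rightarrow> 'em \<Rightarrow> bool" where
  "opcartesian E B U h \<longleftrightarrow> h \<in> Arr E \<and>
     (\<forall>R k g. k \<in> Hom E (Dom E h) R \<longrightarrow> g \<in> Hom B (omap U (Cod E h)) (omap U R) \<longrightarrow>
        g \<cdot>\<^bsub>B\<^esub> amap U h = amap U k \<longrightarrow>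
        (\<exists>!l. l \<in> Hom E (Cod E h) R \<and> amap U l = g \<and> l \<cdot>\<^bsub>E\<^esub> h = k))"

definition fibration ::
  "('eo, 'em) cat \<Rightarrow> ('bo, 'bm) cat \<Rightarrow> ('eo, 'em, 'bo, 'bm) func \<Rightarrow> bool" where
  "fibration E B U \<longleftrightarrow> cat_functor E B U \<and>
     (\<forall>f\<in>Arr B. \<forall>Q\<in>Obj E. omap U Q = Cod B f \<longrightarrow>
        (\<exists>h. cartesian E B U h \<and> Cod E h = Q \<and> amap U h = f))"

definition opfibration ::
  "('eo, 'em) cat \<Rightarrow> ('bo, 'bm) cat \<Rightarrow> ('eo, 'em, 'bo, 'bm) func \<Rightarrow> bool" where
  "opfibration E B U \<longleftrightarrow> cat_functor E B U \<and>
     (\<forall>f\<in>Arr B. \<forall>P\<in>Obj E. omap U P = Dom B f \<longrightarrow>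
        (\<exists>h. opcartesian E B U h \<and> Dom E h = P \<and> amap U h = f))"

definition bifibration ::
  "('eo, 'em) cat \<Rightarrow> ('bo, 'bm) cat \<Rightarrow> ('eo, 'em, 'bo, 'bm) func \<Rightarrow> bool" where
  "bifibration E B U \<longleftrightarrow> fibration E B U \<and> opfibration E B U"

text \<open>A cleavage and an opcleavage are fixed by choice; the domain of the cartesian lifting is the
  reindexing \<open>f\<^sup>* Q\<close>, the codomain of the opcartesian lifting is the opreindexing \<open>\<Sigma>\<^sub>f P\<close>.\<close>

definition cart_lift ::
  "('eo, 'em) cat \<Rightarrow> ('bo, 'bm) cat \<Rightarrow> ('eo, 'em, 'bo, 'bm) func \<Rightarrow> 'bm \<Rightarrow> 'eo \<Rightarrow> 'em" where
  "cart_lift E B U f Q = (SOME h. cartesian E B U h \<and> Cod E h = Q \<and> amap U h = f)"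

definition opcart_lift ::
  "('eo, 'em) cat \<Rightarrow> ('bo, 'bm) cat \<Rightarrow> ('eo, 'em, 'bo, 'bm) func \<Rightarrow> 'bm \<Rightarrow> 'eo \<Rightarrow> 'em" where
  "opcart_lift E B U f P = (SOME h. opcartesian E B U h \<and> Dom E h = P \<and> amap U h = f)"

definition reindex ::
  "('eo, 'em) cat \<Rightarrow> ('bo, 'bm) cat \<Rightarrow> ('eo, 'em, 'bo, 'bm) func \<Rightarrow> 'bm \<Rightarrow> 'eo \<Rightarrow> 'eo" where
  "reindex E B U f Q = Dom E (cart_lift E B U f Q)"

definition opreindex ::
  "('eo, 'em) cat \<Rightarrow> ('bo, 'bm) cat \<Rightarrow> ('eo, 'em, 'bo, 'bm) func \<Rightarrow> 'bm \<Rightarrow> 'eo \<Rightarrow> 'eo" where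
  "opreindex E B U f P = Cod E (opcart_lift E B U f P)"

text \<open>Component at \<open>P\<close> of the canonical map \<open>\<Sigma>\<^sub>s t\<^sup>* \<rightarrow> g\<^sup>* \<Sigma>\<^sub>f\<close> of a square \<open>f \<cdot> t = g \<cdot> s\<close>: the vertical
  arrow through which \<open>t\<^sup>* P \<rightarrow> P \<rightarrow> \<Sigma>\<^sub>f P\<close>, lying over \<open>f \<cdot> t = g \<cdot> s\<close>, factors as
  \<open>t\<^sup>* P \<rightarrow> \<Sigma>\<^sub>s t\<^sup>* P \<rightarrow> g\<^sup>* \<Sigma>\<^sub>f P \<rightarrow> \<Sigma>\<^sub>f P\<close>.\<close>

definition bc_map ::
  "('eo, 'em) cat \<Rightarrow> ('bo, 'bm) cat \<Rightarrow> ('eo, 'em, 'bo, 'bm) func \<Rightarrow>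
   'bm \<Rightarrow> 'bm \<Rightarrow> 'bm \<Rightarrow> 'bm \<Rightarrow> 'eo \<Rightarrow> 'em" where
  "bc_map E B U f t g s P =
     (THE m. m \<in> Hom (fibre E B U (Dom B g))
                  (opreindex E B U s (reindex E B U t P))
                  (reindex E B U g (opreindex E B U f P)) \<and>
        cart_lift E B U g (opreindex E B U f P) \<cdot>\<^bsub>E\<^esub>
          (m \<cdot>\<^bsub>E\<^esub> opcart_lift E B U s (reindex E B U t P)) =
        opcart_lift E B U f P \<cdot>\<^bsub>E\<^esub> cart_lift E B U t P)"

definition beck_chevalley ::
  "('eo, 'em) cat \<Rightarrow> ('bo, 'bm) cat \<Rightarrow> ('eo, 'em, 'bo, 'bm) func \<Rightarrow> bool" where
  "beck_chevalley E B U \<longleftrightarrow>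
     (\<forall>f t g s. pullback_square B f t g s \<longrightarrow>
        (\<forall>P\<in>Obj (fibre E B U (Dom B f)).
           iso (fibre E B U (Dom B g)) (bc_map E B U f t g s P)))"

definition truth_functor ::
  "('eo, 'em) cat \<Rightarrow> ('bo, 'bm) cat \<Rightarrow> ('eo, 'em, 'bo, 'bm) func \<Rightarrow>
   ('bo, 'bm, 'eo, 'em) func \<Rightarrow> bool" where
  "truth_functor E B U K \<longleftrightarrow>
     cat_functor B E K \<and> func_eq B (U \<circ>\<^sub>F K) id_func \<and>
     (\<forall>x\<in>Obj B. terminal (fibre E B U x) (omap K x)) \<and>
     (\<forall>f\<in>Arr B. terminal (fibre E B U (Dom B f)) (reindex E B U f (omap K (Cod B f))))"


section \<open>Relations and equality\<close>

definition pullback_cat ::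
  "('do, 'dm) cat \<Rightarrow> ('ao, 'am) cat \<Rightarrow> ('do, 'dm, 'co, 'cm) func \<Rightarrow> ('ao, 'am, 'co, 'cm) func \<Rightarrow>
   ('ao \<times> 'do, 'am \<times> 'dm) cat" where
  "pullback_cat D A V G =
     \<lparr>Obj = {(x, P). x \<in> Obj A \<and> P \<in> Obj D \<and> omap V P = omap G x},
      Arr = {(f, h). f \<in> Arr A \<and> h \<in> Arr D \<and> amap V h = amap G f},
      Dom = (\<lambda>(f, h). (Dom A f, Dom D h)),
      Cod = (\<lambda>(f, h). (Cod A f, Cod D h)),
      Ide = (\<lambda>(x, P). (Ide A x, Ide D P)),
      Cmp = (\<lambda>(g, k) (f, h). (g \<cdot>\<^bsub>A\<^esub> f, k \<cdot>\<^bsub>D\<^esub> h))\<rparr>"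

definition Rel_cat ::
  "('do, 'dm) cat \<Rightarrow> ('co, 'cm) cat \<Rightarrow> ('do, 'dm, 'co, 'cm) func \<Rightarrow> ('co, 'cm) spans \<Rightarrow>
   ('co \<times> 'do, 'cm \<times> 'dm) cat" where
  "Rel_cat D C V pr = pullback_cat D C V (square_func C pr)"

text \<open>The relations fibration: the projection of the pullback to the base.\<close>

definition Rel_func :: "('co \<times> 'do, 'cm \<times> 'dm, 'co, 'cm) func" where
  "Rel_func = \<lparr>omap = fst, amap = fst\<rparr>"

text \<open>The action on \<open>f : X \<rightarrow> Y\<close> is the arrow over \<open>f \<times> f\<close> induced by opcartesianness of
  \<open>K X \<rightarrow> \<Sigma>\<^sub>\<delta> K X\<close>.\<close>

definition Eq_func ::
  "('do, 'dm) cat \<Rightarrow> ('co, 'cm) cat \<Rightarrow> ('do, 'dm, 'co, 'cm) func \<Rightarrow> ('co, 'cm) spans \<Rightarrow>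
   ('co, 'cm, 'do, 'dm) func \<Rightarrow> ('co, 'cm, 'co \<times> 'do, 'cm \<times> 'dm) func" where
  "Eq_func D C V pr K =
     \<lparr>omap = (\<lambda>x. (x, opreindex D C V (diagonal C pr x) (omap K x))),
      amap = (\<lambda>f. (f, THE h.
         h \<in> Hom D (opreindex D C V (diagonal C pr (Dom C f)) (omap K (Dom C f)))
                   (opreindex D C V (diagonal C pr (Cod C f)) (omap K (Cod C f))) \<and>
         amap V h = amap (square_func C pr) f \<and>
         h \<cdot>\<^bsub>D\<^esub> opcart_lift D C V (diagonal C pr (Dom C f)) (omap K (Dom C f)) =
         opcart_lift D C V (diagonal C pr (Cod C f)) (omap K (Cod C f)) \<cdot>\<^bsub>D\<^esub> amap K f))\<rparr>"


section \<open>Slices\<close>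

text \<open>An arrow of the slice is a triple \<open>(f, h, g)\<close> with \<open>g \<cdot> h = f\<close>.\<close>

definition slice :: "('o, 'm) cat \<Rightarrow> 'o \<Rightarrow> ('m, 'm \<times> 'm \<times> 'm) cat" where
  "slice C i =
     \<lparr>Obj = {f \<in> Arr C. Cod C f = i},
      Arr = {(f, h, g). f \<in> Arr C \<and> Cod C f = i \<and> g \<in> Arr C \<and> Cod C g = i \<and>
               h \<in> Hom C (Dom C f) (Dom C g) \<and> g \<cdot>\<^bsub>C\<^esub> h = f},
      Dom = (\<lambda>(f, h, g). f),
      Cod = (\<lambda>(f, h, g). g),
      Ide = (\<lambda>f. (f, Ide C (Dom C f), f)),
      Cmp = (\<lambda>(f', h', g') (f, h, g). (f, h' \<cdot>\<^bsub>C\<^esub> h, g'))\<rparr>"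

text \<open>The functor between slices induced by a functor; \<open>U/I\<close> and \<open>K\<^sub>U\<^sub>/\<^sub>I\<close> are
  \<open>slice_func U\<close> and \<open>slice_func K\<close>.\<close>

definition slice_func ::
  "('o1, 'm1, 'o2, 'm2) func \<Rightarrow> ('m1, 'm1 \<times> 'm1 \<times> 'm1, 'm2, 'm2 \<times> 'm2 \<times> 'm2) func" where
  "slice_func F =
     \<lparr>omap = amap F, amap = (\<lambda>(f, h, g). (amap F f, amap F h, amap F g))\<rparr>"

definition slice_products ::
  "('o, 'm) cat \<Rightarrow> ('m, 'm) spans \<Rightarrow> ('m, 'm \<times> 'm \<times> 'm) spans" where
  "slice_products C pb =
     \<lparr>Leg1 = (\<lambda>f g. (f \<cdot>\<^bsub>C\<^esub> Leg1 pb f g, Leg1 pb f g, f)),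
      Leg2 = (\<lambda>f g. (f \<cdot>\<^bsub>C\<^esub> Leg1 pb f g, Leg2 pb f g, g))\<rparr>"


section \<open>Coalgebras and coinduction\<close>

definition coalg :: "('o, 'm) cat \<Rightarrow> ('o, 'm, 'o, 'm) func \<Rightarrow>
  ('o \<times> 'm, ('o \<times> 'm) \<times> 'm \<times> ('o \<times> 'm)) cat" where
  "coalg C F =
     \<lparr>Obj = {(x, \<alpha>). x \<in> Obj C \<and> \<alpha> \<in> Hom C x (omap F x)},
      Arr = {((x, \<alpha>), h, (y, \<beta>)).
               x \<in> Obj C \<and> \<alpha> \<in> Hom C x (omap F x) \<and> y \<in> Obj C \<and> \<beta> \<in> Hom C y (omap F y) \<and>
               h \<in> Hom C x y \<and> \<beta> \<cdot>\<^bsub>C\<^esub> h = amap F h \<cdot>\<^bsub>C\<^esub> \<alpha>},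
      Dom = (\<lambda>(a, h, b). a),
      Cod = (\<lambda>(a, h, b). b),
      Ide = (\<lambda>(x, \<alpha>). ((x, \<alpha>), Ide C x, (x, \<alpha>))),
      Cmp = (\<lambda>(a', h', b') (a, h, b). (a, h' \<cdot>\<^bsub>C\<^esub> h, b'))\<rparr>"

text \<open>The functor between coalgebra categories induced by \<open>H\<close> and \<open>\<phi> : H F \<rightarrow> G H\<close>, with \<open>D\<close> the
  target category of \<open>H\<close>.\<close>

definition coalg_func ::
  "('o2, 'm2) cat \<Rightarrow> ('o1, 'm1, 'o2, 'm2) func \<Rightarrow> ('o1 \<Rightarrow> 'm2) \<Rightarrow>
   ('o1 \<times> 'm1, ('o1 \<times> 'm1) \<times> 'm1 \<times> ('o1 \<times> 'm1),
    'o2 \<times> 'm2, ('o2 \<times> 'm2) \<times> 'm2 \<times> ('o2 \<times> 'm2)) func" where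
  "coalg_func D H \<phi> =
     (let ob = (\<lambda>(x, \<alpha>). (omap H x, \<phi> x \<cdot>\<^bsub>D\<^esub> amap H \<alpha>))
      in \<lparr>omap = ob, amap = (\<lambda>(a, h, b). (ob a, amap H h, ob b))\<rparr>)"

text \<open>\<open>F'\<close> with the isomorphism \<open>\<phi>\<close> is an \<open>Eq\<close>-preserving lifting of \<open>F\<close>, for the equality functor
  of \<open>V : D \<rightarrow> C\<close>.\<close>

definition eq_preserving_lifting ::
  "('do, 'dm) cat \<Rightarrow> ('co, 'cm) cat \<Rightarrow> ('do, 'dm, 'co, 'cm) func \<Rightarrow> ('co, 'cm) spans \<Rightarrow>
   ('co, 'cm, 'do, 'dm) func \<Rightarrow> ('co, 'cm, 'co, 'cm) func \<Rightarrow>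
   ('co \<times> 'do, 'cm \<times> 'dm, 'co \<times> 'do, 'cm \<times> 'dm) func \<Rightarrow> ('co \<Rightarrow> 'cm \<times> 'dm) \<Rightarrow> bool" where
  "eq_preserving_lifting D C V pr K F F' \<phi> \<longleftrightarrow>
     cat_functor (Rel_cat D C V pr) (Rel_cat D C V pr) F' \<and>
     func_eq (Rel_cat D C V pr) (Rel_func \<circ>\<^sub>F F') (F \<circ>\<^sub>F Rel_func) \<and>
     nat_iso C (Rel_cat D C V pr) (Eq_func D C V pr K \<circ>\<^sub>F F) (F' \<circ>\<^sub>F Eq_func D C V pr K) \<phi>"

definition sound_coinduction ::
  "('do, 'dm) cat \<Rightarrow> ('co, 'cm) cat \<Rightarrow> ('do, 'dm, 'co, 'cm) func \<Rightarrow> ('co, 'cm) spans \<Rightarrow>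
   ('co, 'cm, 'do, 'dm) func \<Rightarrow> ('co, 'cm, 'co, 'cm) func \<Rightarrow>
   ('co \<times> 'do, 'cm \<times> 'dm, 'co \<times> 'do, 'cm \<times> 'dm) func \<Rightarrow> ('co \<Rightarrow> 'cm \<times> 'dm) \<Rightarrow> bool" where
  "sound_coinduction D C V pr K F F' \<phi> \<longleftrightarrow>
     preserves_terminal (coalg C F) (coalg (Rel_cat D C V pr) F')
       (coalg_func (Rel_cat D C V pr) (Eq_func D C V pr K) \<phi>)"

end

theory Submission
  imports Defs
begin

text \<open>
  Suppose an equality functor \<open>Eq\<close> is a section of a fibration of relations, is fully faithful, and
  admits universal arrows \<open>\<eta> : P \<rightarrow> Eq (Q P)\<close>. Put \<open>F' P = (F \<rho>)\<^sup>* Eq (F (Q P))\<close> with \<open>\<rho>\<close> the base arrow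
  of \<open>\<eta>\<close>. Since \<open>Q Eq \<cong> 1\<close>, this lifting preserves equality, and transposing an \<open>F'\<close>-coalgebra
  \<open>P \<rightarrow> F' P\<close> gives an \<open>F\<close>-coalgebra \<open>Q P \<rightarrow> F (Q P)\<close> such that coalgebra morphisms out of the two
  correspond; hence \<open>Eq\<close> carries final coalgebras to final coalgebras.

  In the slice over \<open>I\<close>, let \<open>i : X \<times>\<^sub>I X \<rightarrow> X \<times> X\<close> be the inclusion for \<open>f : X \<rightarrow> I\<close>. Beck-Chevalley
  for the pullback of \<open>\<delta>\<close> along \<open>i\<close> shows that the slice equality of \<open>f\<close> is \<open>i\<^sup>* (Eq X)\<close>, and for the
  pullback of \<open>\<delta>\<close> along itself that \<open>\<delta>\<^sup>* (Eq X)\<close> is the truth object; the latter gives full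
  faithfulness. The universal arrow of a relation \<open>P\<close> over \<open>X \<times>\<^sub>I X\<close> has codomain the quotient of
  \<open>\<Sigma>\<^sub>i P\<close>, which maps to \<open>I\<close> by transposing \<open>P \<rightarrow> K I \<rightarrow> Eq I\<close>.
\<close>

section \<open>Cartesian and opcartesian arrows\<close>

text \<open>The left adjoint of \<open>Eq\<close> lives over \<open>B\<close> and knows nothing of
  \<open>I\<close>, so what is carried into the slice is not the adjunction but its universal
  arrows: one per relation, with the quotient functor rebuilt from them by choice. The obstacle is
  that the quotient must become an object over \<open>I\<close>, and that an arrow out of it,
  produced by the adjunction over \<open>B\<close>, must turn out to commute with the maps to
  \<open>I\<close>. This commutation rests on \<open>T.refl I\<close> being cartesian as well as
  opcartesian: above a base arrow that factors through the diagonal there is then at most one arrow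
  into the equality object, so commuting over \<open>I\<close> reduces to the uniqueness of a
  transpose. The same fact, at other objects, gives fullness: an arrow between equality objects is
  determined by its restriction along reflexivity, which lies over the diagonal. A relation in the
  slice is formally an arrow into \<open>K I\<close>; since \<open>K I\<close> receives exactly one
  arrow above each base arrow, it amounts to an object of \<open>E\<close> over a kernel pair.
  Beck-Chevalley speaks of \<open>U\<close>, whereas reflexivity in the slice is opcartesian for
  \<open>U/I\<close>, and this property has to be brought down to \<open>E\<close>.\<close>

lemma in_Hom: "f \<in> Hom C x y \<longleftrightarrow> f \<in> Arr C \<and> Dom C f = x \<and> Cod C f = y"
  by (simp add: Hom_def)

context category
begin

lemma Ide_Arr [simp]: "x \<in> Obj C \<Longrightarrow> Ide C x \<in> Arr C"
  and Dom_Ide [simp]: "x \<in> Obj C \<Longrightarrow> Dom C (Ide C x) = x"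
  and Cod_Ide [simp]: "x \<in> Obj C \<Longrightarrow> Cod C (Ide C x) = x"
  using Ide_Hom by (auto simp: in_Hom)

lemma Cmp_Arr [simp]: "f \<in> Arr C \<Longrightarrow> g \<in> Arr C \<Longrightarrow> Cod C f = Dom C g \<Longrightarrow> g \<cdot> f \<in> Arr C"
  and Dom_Cmp [simp]: "f \<in> Arr C \<Longrightarrow> g \<in> Arr C \<Longrightarrow> Cod C f = Dom C g \<Longrightarrow> Dom C (g \<cdot> f) = Dom C f"
  and Cod_Cmp [simp]: "f \<in> Arr C \<Longrightarrow> g \<in> Arr C \<Longrightarrow> Cod C f = Dom C g \<Longrightarrow> Cod C (g \<cdot> f) = Cod C g"
  using Cmp_Hom[of f "Dom C f" "Dom C g" g "Cod C g"] by (auto simp: in_Hom)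

lemma Cmp_Ide_Dom [simp]: "f \<in> Arr C \<Longrightarrow> Dom C f = x \<Longrightarrow> f \<cdot> Ide C x = f"
  and Ide_Cod_Cmp [simp]: "f \<in> Arr C \<Longrightarrow> Cod C f = x \<Longrightarrow> Ide C x \<cdot> f = f"
  using Cmp_Ide[of f "Dom C f" "Cod C f"] Ide_Cmp[of f "Dom C f" "Cod C f"] by (auto simp: in_Hom)

lemma Cmp_Cmp [simp]: "f \<in> Arr C \<Longrightarrow> g \<in> Arr C \<Longrightarrow> h \<in> Arr C \<Longrightarrow> Cod C f = Dom C g \<Longrightarrow>
    Cod C g = Dom C h \<Longrightarrow> (h \<cdot> g) \<cdot> f = h \<cdot> (g \<cdot> f)"
  using Cmp_assoc[of f "Dom C f" "Dom C g" g "Dom C h" h "Cod C h"] by (auto simp: in_Hom)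

declare Dom_Obj [simp] Cod_Obj [simp]

text \<open>\<open>Cmp_Cmp\<close> nests composites to the right, so \<open>g \<cdot> f\<close> is
  no longer a subterm once something precedes \<open>f\<close>. This form makes a known equation for
  \<open>g \<cdot> f\<close> applicable there.\<close>

lemma Cmp_eq_extend:
  assumes "g \<cdot> f = k" "f \<in> Arr C" "g \<in> Arr C" "Cod C f = Dom C g" "u \<in> Arr C" "Cod C u = Dom C f"
  shows "g \<cdot> (f \<cdot> u) = k \<cdot> u"
  using assms(2-) Cmp_Cmp[of u f g] by (simp add: assms(1)[symmetric])

end

context cat_functor
begin

lemma amap_Arr [simp]: "f \<in> Arr C \<Longrightarrow> amap F f \<in> Arr D"
  and Dom_amap [simp]: "f \<in> Arr C \<Longrightarrow> Dom D (amap F f) = omap F (Dom C f)"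
  and Cod_amap [simp]: "f \<in> Arr C \<Longrightarrow> Cod D (amap F f) = omap F (Cod C f)"
  using amap_Hom[of f "Dom C f" "Cod C f"] by (auto simp: in_Hom)

lemma amap_comp [simp]: "f \<in> Arr C \<Longrightarrow> g \<in> Arr C \<Longrightarrow> Cod C f = Dom C g \<Longrightarrow>
    amap F (g \<cdot>\<^bsub>C\<^esub> f) = amap F g \<cdot>\<^bsub>D\<^esub> amap F f"
  using amap_Cmp[of f "Dom C f" "Dom C g" g "Cod C g"] by (auto simp: in_Hom)

declare omap_Obj [simp] amap_Ide [simp]

text \<open>The universal property is split into existence, here, and uniqueness, in
  \<open>cartesian_cancel\<close>, with \<open>Dom\<close> and \<open>Cod\<close> equations in place
  of \<open>Hom\<close>, so that the simplifier can discharge the side conditions. The opcartesian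
  versions are split likewise.\<close>

lemma cartesian_factor:
  assumes "cartesian C D F h" "k \<in> Arr C" "Cod C k = Cod C h" "g \<in> Arr D"
    "Dom D g = omap F (Dom C k)" "Cod D g = omap F (Dom C h)" "amap F h \<cdot>\<^bsub>D\<^esub> g = amap F k"
  shows "\<exists>l. l \<in> Arr C \<and> Dom C l = Dom C k \<and> Cod C l = Dom C h \<and> amap F l = g \<and>
    h \<cdot>\<^bsub>C\<^esub> l = k"
proof -
  have "\<exists>!l. l \<in> Hom C (Dom C k) (Dom C h) \<and> amap F l = g \<and> h \<cdot>\<^bsub>C\<^esub> l = k"
    using assms unfolding cartesian_def by (simp add: in_Hom)
  then show ?thesis by (auto simp: in_Hom)
qed

lemma cartesian_cancel:
  assumes "cartesian C D F h" "l \<in> Arr C" "l' \<in> Arr C" "Dom C l = Dom C l'"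
    "Cod C l = Dom C h" "Cod C l' = Dom C h" "amap F l = amap F l'" "h \<cdot>\<^bsub>C\<^esub> l = h \<cdot>\<^bsub>C\<^esub> l'"
  shows "l = l'"
proof -
  have h: "h \<in> Arr C" using assms(1) by (simp add: cartesian_def)
  have "h \<cdot>\<^bsub>C\<^esub> l \<in> Hom C (Dom C l) (Cod C h)" "amap F l \<in> Hom D (omap F (Dom C l)) (omap F (Dom C h))"
    "amap F h \<cdot>\<^bsub>D\<^esub> amap F l = amap F (h \<cdot>\<^bsub>C\<^esub> l)"
    using assms h by (auto simp: in_Hom)
  then have "\<exists>!m. m \<in> Hom C (Dom C l) (Dom C h) \<and> amap F m = amap F l \<and> h \<cdot>\<^bsub>C\<^esub> m = h \<cdot>\<^bsub>C\<^esub> l"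
    using assms(1) unfolding cartesian_def by blast
  moreover have "l \<in> Hom C (Dom C l) (Dom C h)" "l' \<in> Hom C (Dom C l) (Dom C h)"
    using assms by (auto simp: in_Hom)
  ultimately show ?thesis using assms(7,8) by metis
qed

lemma opcartesian_factor:
  assumes "opcartesian C D F h" "k \<in> Arr C" "Dom C k = Dom C h" "g \<in> Arr D"
    "Dom D g = omap F (Cod C h)" "Cod D g = omap F (Cod C k)" "g \<cdot>\<^bsub>D\<^esub> amap F h = amap F k"
  shows "\<exists>l. l \<in> Arr C \<and> Dom C l = Cod C h \<and> Cod C l = Cod C k \<and> amap F l = g \<and>
    l \<cdot>\<^bsub>C\<^esub> h = k"
proof -
  have "\<exists>!l. l \<in> Hom C (Cod C h) (Cod C k) \<and> amap F l = g \<and> l \<cdot>\<^bsub>C\<^esub> h = k"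
    using assms unfolding opcartesian_def by (simp add: in_Hom)
  then show ?thesis by (auto simp: in_Hom)
qed

lemma opcartesian_cancel:
  assumes "opcartesian C D F h" "l \<in> Arr C" "l' \<in> Arr C" "Cod C l = Cod C l'"
    "Dom C l = Cod C h" "Dom C l' = Cod C h" "amap F l = amap F l'" "l \<cdot>\<^bsub>C\<^esub> h = l' \<cdot>\<^bsub>C\<^esub> h"
  shows "l = l'"
proof -
  have h: "h \<in> Arr C" using assms(1) by (simp add: opcartesian_def)
  have "l \<cdot>\<^bsub>C\<^esub> h \<in> Hom C (Dom C h) (Cod C l)" "amap F l \<in> Hom D (omap F (Cod C h)) (omap F (Cod C l))"
    "amap F l \<cdot>\<^bsub>D\<^esub> amap F h = amap F (l \<cdot>\<^bsub>C\<^esub> h)"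
    using assms h by (auto simp: in_Hom)
  then have "\<exists>!m. m \<in> Hom C (Cod C h) (Cod C l) \<and> amap F m = amap F l \<and> m \<cdot>\<^bsub>C\<^esub> h = l \<cdot>\<^bsub>C\<^esub> h"
    using assms(1) unfolding opcartesian_def by blast
  moreover have "l \<in> Hom C (Cod C h) (Cod C l)" "l' \<in> Hom C (Cod C h) (Cod C l)"
    using assms by (auto simp: in_Hom)
  ultimately show ?thesis using assms(7,8) by metis
qed

lemma cartesianI:
  assumes "h \<in> Arr C"
    and "\<And>k g. k \<in> Arr C \<Longrightarrow> Cod C k = Cod C h \<Longrightarrow> g \<in> Arr D \<Longrightarrow>
      Dom D g = omap F (Dom C k) \<Longrightarrow> Cod D g = omap F (Dom C h) \<Longrightarrow> amap F h \<cdot>\<^bsub>D\<^esub> g = amap F k \<Longrightarrow>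
      \<exists>l. l \<in> Arr C \<and> Dom C l = Dom C k \<and> Cod C l = Dom C h \<and> amap F l = g \<and> h \<cdot>\<^bsub>C\<^esub> l = k"
    and "\<And>l l'. l \<in> Arr C \<Longrightarrow> l' \<in> Arr C \<Longrightarrow> Dom C l = Dom C l' \<Longrightarrow> Cod C l = Dom C h \<Longrightarrow>
      Cod C l' = Dom C h \<Longrightarrow> amap F l = amap F l' \<Longrightarrow> h \<cdot>\<^bsub>C\<^esub> l = h \<cdot>\<^bsub>C\<^esub> l' \<Longrightarrow> l = l'"
  shows "cartesian C D F h"
  unfolding cartesian_def
proof (intro conjI allI impI ex_ex1I)
  fix R k g
  assume "k \<in> Hom C R (Cod C h)" "g \<in> Hom D (omap F R) (omap F (Dom C h))" "amap F h \<cdot>\<^bsub>D\<^esub> g = amap F k"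
  then show "\<exists>l. l \<in> Hom C R (Dom C h) \<and> amap F l = g \<and> h \<cdot>\<^bsub>C\<^esub> l = k"
    using assms(2)[of k g] by (auto simp: in_Hom)
qed (use assms(1,3) in \<open>auto simp: in_Hom\<close>)

lemma opcartesianI:
  assumes "h \<in> Arr C"
    and "\<And>k g. k \<in> Arr C \<Longrightarrow> Dom C k = Dom C h \<Longrightarrow> g \<in> Arr D \<Longrightarrow>
      Dom D g = omap F (Cod C h) \<Longrightarrow> Cod D g = omap F (Cod C k) \<Longrightarrow> g \<cdot>\<^bsub>D\<^esub> amap F h = amap F k \<Longrightarrow>
      \<exists>l. l \<in> Arr C \<and> Dom C l = Cod C h \<and> Cod C l = Cod C k \<and> amap F l = g \<and> l \<cdot>\<^bsub>C\<^esub> h = k"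
    and "\<And>l l'. l \<in> Arr C \<Longrightarrow> l' \<in> Arr C \<Longrightarrow> Cod C l = Cod C l' \<Longrightarrow> Dom C l = Cod C h \<Longrightarrow>
      Dom C l' = Cod C h \<Longrightarrow> amap F l = amap F l' \<Longrightarrow> l \<cdot>\<^bsub>C\<^esub> h = l' \<cdot>\<^bsub>C\<^esub> h \<Longrightarrow> l = l'"
  shows "opcartesian C D F h"
  unfolding opcartesian_def
proof (intro conjI allI impI ex_ex1I)
  fix R k g
  assume "k \<in> Hom C (Dom C h) R" "g \<in> Hom D (omap F (Cod C h)) (omap F R)" "g \<cdot>\<^bsub>D\<^esub> amap F h = amap F k"
  then show "\<exists>l. l \<in> Hom C (Cod C h) R \<and> amap F l = g \<and> l \<cdot>\<^bsub>C\<^esub> h = k"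
    using assms(2)[of k g] by (auto simp: in_Hom)
qed (use assms(1,3) in \<open>auto simp: in_Hom\<close>)

lemma cartesian_Ide: "x \<in> Obj C \<Longrightarrow> cartesian C D F (Ide C x)"
  by (rule cartesianI) auto

lemma opcartesian_Ide: "x \<in> Obj C \<Longrightarrow> opcartesian C D F (Ide C x)"
  by (rule opcartesianI) auto

end

section \<open>Isomorphisms and composites of cartesian and opcartesian arrows\<close>

context cat_functor
begin

text \<open>The factorisation of \<open>k\<close> is \<open>k\<close> after the inverse
  \<open>n\<close>; its base is \<open>g\<close> because \<open>amap F n\<close> inverts
  \<open>amap F m\<close>. The isomorphism may lie over any base arrow.\<close>

lemma opcartesian_iso:
  assumes m: "m \<in> Arr C" and n: "n \<in> Arr C" "Dom C n = Cod C m" "Cod C n = Dom C m"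
    and inv: "n \<cdot>\<^bsub>C\<^esub> m = Ide C (Dom C m)" "m \<cdot>\<^bsub>C\<^esub> n = Ide C (Cod C m)"
  shows "opcartesian C D F m"
proof (rule opcartesianI[OF m])
  fix k g
  assume k: "k \<in> Arr C" "Dom C k = Dom C m" "g \<in> Arr D" "Dom D g = omap F (Cod C m)"
    "Cod D g = omap F (Cod C k)" "g \<cdot>\<^bsub>D\<^esub> amap F m = amap F k"
  have "amap F m \<cdot>\<^bsub>D\<^esub> amap F n = Ide D (omap F (Cod C m))"
    using arg_cong[OF inv(2), of "amap F"] m n by simp
  then have "amap F (k \<cdot>\<^bsub>C\<^esub> n) = g" using k(1-5) m n by (simp flip: k(6))
  then show "\<exists>l. l \<in> Arr C \<and> Dom C l = Cod C m \<and> Cod C l = Cod C k \<and> amap F l = g \<and> l \<cdot>\<^bsub>C\<^esub> m = k"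
    using k m n inv by (intro exI[of _ "k \<cdot>\<^bsub>C\<^esub> n"]) simp
next
  fix l l'
  assume l: "l \<in> Arr C" "l' \<in> Arr C" "Dom C l = Cod C m" "Dom C l' = Cod C m" "l \<cdot>\<^bsub>C\<^esub> m = l' \<cdot>\<^bsub>C\<^esub> m"
  then have "(l \<cdot>\<^bsub>C\<^esub> m) \<cdot>\<^bsub>C\<^esub> n = (l' \<cdot>\<^bsub>C\<^esub> m) \<cdot>\<^bsub>C\<^esub> n" by simp
  then show "l = l'" using l(1-4) m n inv by simp
qed

lemma cartesian_iso:
  assumes m: "m \<in> Arr C" and n: "n \<in> Arr C" "Dom C n = Cod C m" "Cod C n = Dom C m"
    and inv: "n \<cdot>\<^bsub>C\<^esub> m = Ide C (Dom C m)" "m \<cdot>\<^bsub>C\<^esub> n = Ide C (Cod C m)"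
  shows "cartesian C D F m"
proof (rule cartesianI[OF m])
  fix k g
  assume k: "k \<in> Arr C" "Cod C k = Cod C m" "g \<in> Arr D" "Dom D g = omap F (Dom C k)"
    "Cod D g = omap F (Dom C m)" "amap F m \<cdot>\<^bsub>D\<^esub> g = amap F k"
  have "amap F n \<cdot>\<^bsub>D\<^esub> amap F m = Ide D (omap F (Dom C m))"
    using arg_cong[OF inv(1), of "amap F"] m n by simp
  from tgt.Cmp_eq_extend[OF this, of g] have "amap F (n \<cdot>\<^bsub>C\<^esub> k) = g"
    using k(1-5) m n by (simp flip: k(6))
  then show "\<exists>l. l \<in> Arr C \<and> Dom C l = Dom C k \<and> Cod C l = Dom C m \<and> amap F l = g \<and> m \<cdot>\<^bsub>C\<^esub> l = k"
    using k m n src.Cmp_eq_extend[OF inv(2), of k] by (intro exI[of _ "n \<cdot>\<^bsub>C\<^esub> k"]) simp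
next
  fix l l'
  assume l: "l \<in> Arr C" "l' \<in> Arr C" "Cod C l = Dom C m" "Cod C l' = Dom C m" "m \<cdot>\<^bsub>C\<^esub> l = m \<cdot>\<^bsub>C\<^esub> l'"
  then have "n \<cdot>\<^bsub>C\<^esub> (m \<cdot>\<^bsub>C\<^esub> l) = n \<cdot>\<^bsub>C\<^esub> (m \<cdot>\<^bsub>C\<^esub> l')" by simp
  then show "l = l'"
    using src.Cmp_eq_extend[OF inv(1), of l] src.Cmp_eq_extend[OF inv(1), of l'] l(1-4) m n by simp
qed

lemma opcartesian_Cmp:
  assumes h: "opcartesian C D F h" and m: "opcartesian C D F m" and mh: "Dom C m = Cod C h"
  shows "opcartesian C D F (m \<cdot>\<^bsub>C\<^esub> h)"
proof -
  have A: "h \<in> Arr C" "m \<in> Arr C" using h m by (simp_all add: opcartesian_def)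
  show ?thesis
  proof (rule opcartesianI)
    show "m \<cdot>\<^bsub>C\<^esub> h \<in> Arr C" using A mh by simp
  next
    fix k g
    assume k: "k \<in> Arr C" "Dom C k = Dom C (m \<cdot>\<^bsub>C\<^esub> h)" "g \<in> Arr D" "Dom D g = omap F (Cod C (m \<cdot>\<^bsub>C\<^esub> h))"
      "Cod D g = omap F (Cod C k)" "g \<cdot>\<^bsub>D\<^esub> amap F (m \<cdot>\<^bsub>C\<^esub> h) = amap F k"
    obtain l where l: "l \<in> Arr C" "Dom C l = Cod C h" "Cod C l = Cod C k" "amap F l = g \<cdot>\<^bsub>D\<^esub> amap F m" "l \<cdot>\<^bsub>C\<^esub> h = k"
      using opcartesian_factor[OF h, of k "g \<cdot>\<^bsub>D\<^esub> amap F m"] k A mh by auto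
    obtain l' where "l' \<in> Arr C" "Dom C l' = Cod C m" "Cod C l' = Cod C k" "amap F l' = g" "l' \<cdot>\<^bsub>C\<^esub> m = l"
      using opcartesian_factor[OF m, of l g] k A mh l by auto
    then show "\<exists>l. l \<in> Arr C \<and> Dom C l = Cod C (m \<cdot>\<^bsub>C\<^esub> h) \<and> Cod C l = Cod C k \<and> amap F l = g \<and>
        l \<cdot>\<^bsub>C\<^esub> (m \<cdot>\<^bsub>C\<^esub> h) = k"
      using l A mh src.Cmp_Cmp[of h m l'] by (intro exI[of _ l']) simp
  next
    fix l l'
    assume l: "l \<in> Arr C" "l' \<in> Arr C" "Cod C l = Cod C l'" "Dom C l = Cod C (m \<cdot>\<^bsub>C\<^esub> h)"
      "Dom C l' = Cod C (m \<cdot>\<^bsub>C\<^esub> h)" "amap F l = amap F l'" "l \<cdot>\<^bsub>C\<^esub> (m \<cdot>\<^bsub>C\<^esub> h) = l' \<cdot>\<^bsub>C\<^esub> (m \<cdot>\<^bsub>C\<^esub> h)"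
    have "l \<cdot>\<^bsub>C\<^esub> m = l' \<cdot>\<^bsub>C\<^esub> m" by (rule opcartesian_cancel[OF h]) (use l A mh in auto)
    then show "l = l'" by (rule opcartesian_cancel[OF m, rotated -1]) (use l A mh in auto)
  qed
qed

lemma cartesian_Cmp:
  assumes h: "cartesian C D F h" and m: "cartesian C D F m" and mh: "Dom C m = Cod C h"
  shows "cartesian C D F (m \<cdot>\<^bsub>C\<^esub> h)"
proof -
  have A: "h \<in> Arr C" "m \<in> Arr C" using h m by (simp_all add: cartesian_def)
  show ?thesis
  proof (rule cartesianI)
    show "m \<cdot>\<^bsub>C\<^esub> h \<in> Arr C" using A mh by simp
  next
    fix k g
    assume k: "k \<in> Arr C" "Cod C k = Cod C (m \<cdot>\<^bsub>C\<^esub> h)" "g \<in> Arr D" "Dom D g = omap F (Dom C k)"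
      "Cod D g = omap F (Dom C (m \<cdot>\<^bsub>C\<^esub> h))" "amap F (m \<cdot>\<^bsub>C\<^esub> h) \<cdot>\<^bsub>D\<^esub> g = amap F k"
    obtain l where l: "l \<in> Arr C" "Dom C l = Dom C k" "Cod C l = Dom C m" "amap F l = amap F h \<cdot>\<^bsub>D\<^esub> g" "m \<cdot>\<^bsub>C\<^esub> l = k"
      using cartesian_factor[OF m, of k "amap F h \<cdot>\<^bsub>D\<^esub> g"] k A mh by auto
    obtain l' where "l' \<in> Arr C" "Dom C l' = Dom C k" "Cod C l' = Dom C h" "amap F l' = g" "h \<cdot>\<^bsub>C\<^esub> l' = l"
      using cartesian_factor[OF h, of l g] k A mh l by auto
    then show "\<exists>l. l \<in> Arr C \<and> Dom C l = Dom C k \<and> Cod C l = Dom C (m \<cdot>\<^bsub>C\<^esub> h) \<and> amap F l = g \<and>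
        (m \<cdot>\<^bsub>C\<^esub> h) \<cdot>\<^bsub>C\<^esub> l = k"
      using l A mh by (intro exI[of _ l']) simp
  next
    fix l l'
    assume l: "l \<in> Arr C" "l' \<in> Arr C" "Dom C l = Dom C l'" "Cod C l = Dom C (m \<cdot>\<^bsub>C\<^esub> h)"
      "Cod C l' = Dom C (m \<cdot>\<^bsub>C\<^esub> h)" "amap F l = amap F l'" "(m \<cdot>\<^bsub>C\<^esub> h) \<cdot>\<^bsub>C\<^esub> l = (m \<cdot>\<^bsub>C\<^esub> h) \<cdot>\<^bsub>C\<^esub> l'"
    have "h \<cdot>\<^bsub>C\<^esub> l = h \<cdot>\<^bsub>C\<^esub> l'" by (rule cartesian_cancel[OF m]) (use l A mh in auto)
    then show "l = l'" by (rule cartesian_cancel[OF h, rotated -1]) (use l A mh in auto)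
  qed
qed

end

text \<open>Two liftings of one arrow factor through each other over the identity, and cancellation
  makes the factorisations mutually inverse. Both directions are returned because the isomorphism
  lemmas ask for an explicit inverse.\<close>

lemma (in cat_functor) opcartesian_comparison:
  assumes h: "opcartesian C D F h" and h': "opcartesian C D F h'"
    and e: "Dom C h = Dom C h'" "amap F h = amap F h'"
  shows "\<exists>m n. m \<in> Arr C \<and> Dom C m = Cod C h \<and> Cod C m = Cod C h' \<and> n \<in> Arr C \<and> Dom C n = Cod C h' \<and>
    Cod C n = Cod C h \<and> m \<cdot>\<^bsub>C\<^esub> h = h' \<and> n \<cdot>\<^bsub>C\<^esub> m = Ide C (Cod C h) \<and> m \<cdot>\<^bsub>C\<^esub> n = Ide C (Cod C h') \<and>
    amap F m = Ide D (omap F (Cod C h)) \<and> amap F n = Ide D (omap F (Cod C h))"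
proof -
  have A: "h \<in> Arr C" "h' \<in> Arr C" using h h' by (simp_all add: opcartesian_def)
  then have o: "omap F (Cod C h') = omap F (Cod C h)" using e by (metis Cod_amap)
  obtain m where m: "m \<in> Arr C" "Dom C m = Cod C h" "Cod C m = Cod C h'"
    "amap F m = Ide D (omap F (Cod C h))" "m \<cdot>\<^bsub>C\<^esub> h = h'"
    using opcartesian_factor[OF h, of h' "Ide D (omap F (Cod C h))"] A e o by auto
  obtain n where n: "n \<in> Arr C" "Dom C n = Cod C h'" "Cod C n = Cod C h"
    "amap F n = Ide D (omap F (Cod C h))" "n \<cdot>\<^bsub>C\<^esub> h' = h"
    using opcartesian_factor[OF h', of h "Ide D (omap F (Cod C h))"] A e o by auto
  have "n \<cdot>\<^bsub>C\<^esub> m = Ide C (Cod C h)" by (rule opcartesian_cancel[OF h]) (use m n A o in auto)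
  moreover have "m \<cdot>\<^bsub>C\<^esub> n = Ide C (Cod C h')" by (rule opcartesian_cancel[OF h']) (use m n A o in auto)
  ultimately show ?thesis using m n by blast
qed

lemma (in cat_functor) cartesian_comparison:
  assumes h: "cartesian C D F h" and h': "cartesian C D F h'"
    and e: "Cod C h = Cod C h'" "amap F h = amap F h'"
  shows "\<exists>m n. m \<in> Arr C \<and> Dom C m = Dom C h' \<and> Cod C m = Dom C h \<and> n \<in> Arr C \<and> Dom C n = Dom C h \<and>
    Cod C n = Dom C h' \<and> h \<cdot>\<^bsub>C\<^esub> m = h' \<and> n \<cdot>\<^bsub>C\<^esub> m = Ide C (Dom C h') \<and> m \<cdot>\<^bsub>C\<^esub> n = Ide C (Dom C h) \<and>
    amap F m = Ide D (omap F (Dom C h)) \<and> amap F n = Ide D (omap F (Dom C h))"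
proof -
  have A: "h \<in> Arr C" "h' \<in> Arr C" using h h' by (simp_all add: cartesian_def)
  then have o: "omap F (Dom C h') = omap F (Dom C h)" using e by (metis Dom_amap)
  obtain m where m: "m \<in> Arr C" "Dom C m = Dom C h'" "Cod C m = Dom C h"
    "amap F m = Ide D (omap F (Dom C h))" "h \<cdot>\<^bsub>C\<^esub> m = h'"
    using cartesian_factor[OF h, of h' "Ide D (omap F (Dom C h))"] A e o by auto
  obtain n where n: "n \<in> Arr C" "Dom C n = Dom C h" "Cod C n = Dom C h'"
    "amap F n = Ide D (omap F (Dom C h))" "h' \<cdot>\<^bsub>C\<^esub> n = h"
    using cartesian_factor[OF h', of h "Ide D (omap F (Dom C h))"] A e o by auto
  have "h' \<cdot>\<^bsub>C\<^esub> (n \<cdot>\<^bsub>C\<^esub> m) = h'" using src.Cmp_eq_extend[OF n(5), of m] m n A by simp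
  then have "n \<cdot>\<^bsub>C\<^esub> m = Ide C (Dom C h')"
    using m(1-4) n(1-4) A o by (intro cartesian_cancel[OF h', of "n \<cdot>\<^bsub>C\<^esub> m" "Ide C (Dom C h')"]) simp_all
  moreover have "h \<cdot>\<^bsub>C\<^esub> (m \<cdot>\<^bsub>C\<^esub> n) = h" using src.Cmp_eq_extend[OF m(5), of n] m n A by simp
  then have "m \<cdot>\<^bsub>C\<^esub> n = Ide C (Dom C h)"
    using m(1-4) n(1-4) A o by (intro cartesian_cancel[OF h, of "m \<cdot>\<^bsub>C\<^esub> n" "Ide C (Dom C h)"]) simp_all
  ultimately show ?thesis using m n by blast
qed

section \<open>The chosen liftings\<close>

lemma cart_lift:
  assumes "fibration E B U" "f \<in> Arr B" "Q \<in> Obj E" "omap U Q = Cod B f"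
  shows "cartesian E B U (cart_lift E B U f Q)" "cart_lift E B U f Q \<in> Arr E"
    "Cod E (cart_lift E B U f Q) = Q" "amap U (cart_lift E B U f Q) = f"
    "omap U (Dom E (cart_lift E B U f Q)) = Dom B f"
proof -
  interpret U: cat_functor E B U using assms(1) by (simp add: fibration_def)
  have "\<exists>h. cartesian E B U h \<and> Cod E h = Q \<and> amap U h = f"
    using assms unfolding fibration_def by blast
  from someI_ex[OF this] have *: "cartesian E B U (cart_lift E B U f Q)"
    "Cod E (cart_lift E B U f Q) = Q" "amap U (cart_lift E B U f Q) = f" unfolding cart_lift_def by auto
  then have A: "cart_lift E B U f Q \<in> Arr E" by (simp add: cartesian_def)
  show "cartesian E B U (cart_lift E B U f Q)" "cart_lift E B U f Q \<in> Arr E"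
    "Cod E (cart_lift E B U f Q) = Q" "amap U (cart_lift E B U f Q) = f" using * A by auto
  show "omap U (Dom E (cart_lift E B U f Q)) = Dom B f" using U.Dom_amap[OF A] * by simp
qed

lemma opcart_lift:
  assumes "opfibration E B U" "f \<in> Arr B" "P \<in> Obj E" "omap U P = Dom B f"
  shows "opcartesian E B U (opcart_lift E B U f P)" "opcart_lift E B U f P \<in> Arr E"
    "Dom E (opcart_lift E B U f P) = P" "amap U (opcart_lift E B U f P) = f"
    "omap U (Cod E (opcart_lift E B U f P)) = Cod B f"
proof -
  interpret U: cat_functor E B U using assms(1) by (simp add: opfibration_def)
  have "\<exists>h. opcartesian E B U h \<and> Dom E h = P \<and> amap U h = f"
    using assms unfolding opfibration_def by blast
  from someI_ex[OF this] have *: "opcartesian E B U (opcart_lift E B U f P)"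
    "Dom E (opcart_lift E B U f P) = P" "amap U (opcart_lift E B U f P) = f" unfolding opcart_lift_def by auto
  then have A: "opcart_lift E B U f P \<in> Arr E" by (simp add: opcartesian_def)
  show "opcartesian E B U (opcart_lift E B U f P)" "opcart_lift E B U f P \<in> Arr E"
    "Dom E (opcart_lift E B U f P) = P" "amap U (opcart_lift E B U f P) = f" using * A by auto
  show "omap U (Cod E (opcart_lift E B U f P)) = Cod B f" using U.Cod_amap[OF A] * by simp
qed

section \<open>Coinduction from universal arrows\<close>

lemma in_Hom_coalg:
  "m \<in> Hom (coalg C F) (x, \<alpha>) (y, \<beta>) \<longleftrightarrow>
    (x, \<alpha>) \<in> Obj (coalg C F) \<and> (y, \<beta>) \<in> Obj (coalg C F) \<and>
    (\<exists>h. m = ((x, \<alpha>), h, (y, \<beta>)) \<and> h \<in> Arr C \<and> Dom C h = x \<and> Cod C h = y \<and>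
      \<beta> \<cdot>\<^bsub>C\<^esub> h = amap F h \<cdot>\<^bsub>C\<^esub> \<alpha>)"
  by (cases m) (auto simp: coalg_def in_Hom)

text \<open>A section is faithful, and a preimage of \<open>h\<close> under it can only be
  \<open>amap p h\<close>; hence the assumption \<open>full\<close> is all that full faithfulness
  adds. The universal arrows are assumed object by object: the action of \<open>Q\<close> on arrows
  is constructed inside the proof.\<close>

lemma coinduction_lifting_of_universal_arrows:
  fixes R :: "('ro, 'rm) cat" and C :: "('o, 'm) cat"
  assumes fib: "fibration R C p"
    and E: "cat_functor C R Eq"
    and sec: "func_eq C (p \<circ>\<^sub>F Eq) id_func"
    and full: "\<And>x y h. x \<in> Obj C \<Longrightarrow> y \<in> Obj C \<Longrightarrow> h \<in> Hom R (omap Eq x) (omap Eq y) \<Longrightarrow>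
      amap Eq (amap p h) = h"
    and univ: "\<And>P. P \<in> Obj R \<Longrightarrow> \<exists>q \<eta>. q \<in> Obj C \<and> \<eta> \<in> Hom R P (omap Eq q) \<and>
      (\<forall>x\<in>Obj C. \<forall>h\<in>Hom R P (omap Eq x). \<exists>!k. k \<in> Hom C q x \<and> amap Eq k \<cdot>\<^bsub>R\<^esub> \<eta> = h)"
    and F: "cat_functor C C F"
  shows "\<exists>F' \<phi>. cat_functor R R F' \<and> func_eq R (p \<circ>\<^sub>F F') (F \<circ>\<^sub>F p) \<and>
    nat_iso C R (Eq \<circ>\<^sub>F F) (F' \<circ>\<^sub>F Eq) \<phi> \<and>
    preserves_terminal (coalg C F) (coalg R F') (coalg_func R Eq \<phi>)"
proof -
  interpret p: cat_functor R C p using fib by (simp add: fibration_def)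
  interpret E: cat_functor C R Eq by (rule E)
  interpret F: cat_functor C C F by (rule F)
  have pE [simp]: "\<And>x. x \<in> Obj C \<Longrightarrow> omap p (omap Eq x) = x"
    "\<And>f. f \<in> Arr C \<Longrightarrow> amap p (amap Eq f) = f"
    using sec by (auto simp: func_eq_def comp_func_def id_func_def)
  txt \<open>Choosing identities at objects \<open>Eq x\<close> makes \<open>F' Eq = Eq F\<close> hold on the nose.\<close>
  define good where "good P = (\<lambda>(q, \<eta>, c). q \<in> Obj C \<and> \<eta> \<in> Hom R P (omap Eq q) \<and>
      (\<forall>x\<in>Obj C. \<forall>h\<in>Hom R P (omap Eq x). \<exists>!k. k \<in> Hom C q x \<and> amap Eq k \<cdot>\<^bsub>R\<^esub> \<eta> = h) \<and>
      cartesian R C p c \<and> Cod R c = omap Eq (omap F q) \<and> amap p c = amap F (amap p \<eta>) \<and>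
      (\<forall>x\<in>Obj C. P = omap Eq x \<longrightarrow> q = x \<and> \<eta> = Ide R P \<and> c = Ide R (omap Eq (omap F x))))" for P
  have "\<exists>d. good P d" if P: "P \<in> Obj R" for P
  proof (cases "\<exists>x\<in>Obj C. P = omap Eq x")
    case True
    then obtain x where x: "x \<in> Obj C" "P = omap Eq x" by blast
    \<comment> \<open>The identity is a universal arrow at \<open>Eq x\<close>: a transpose exists
      by fullness and is unique because \<open>Eq\<close> is a section.\<close>
    have ex1: "\<exists>!k. k \<in> Hom C x y \<and> amap Eq k \<cdot>\<^bsub>R\<^esub> Ide R P = h"
      if y: "y \<in> Obj C" and h: "h \<in> Hom R P (omap Eq y)" for y h
    proof (rule ex1I[of _ "amap p h"])
      show "amap p h \<in> Hom C x y \<and> amap Eq (amap p h) \<cdot>\<^bsub>R\<^esub> Ide R P = h"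
        using h x y full[of x y h] by (auto simp: in_Hom)
      show "k = amap p h" if "k \<in> Hom C x y \<and> amap Eq k \<cdot>\<^bsub>R\<^esub> Ide R P = h" for k
        using that x by (auto simp: in_Hom)
    qed
    \<comment> \<open>\<open>Eq\<close> is injective on objects, so the last clause of
      \<open>good\<close> constrains the choice for a single \<open>x\<close> only.\<close>
    have "y = x" if "y \<in> Obj C" "omap Eq x = omap Eq y" for y
      using pE(1)[OF that(1)] pE(1)[OF x(1)] that(2) by metis
    then have "good P (x, Ide R P, Ide R (omap Eq (omap F x)))"
      using x ex1 by (auto simp: good_def in_Hom intro!: p.cartesian_Ide)
    then show ?thesis by blast
  next
    case False
    obtain q \<eta> where q: "q \<in> Obj C" "\<eta> \<in> Hom R P (omap Eq q)"
      "\<forall>x\<in>Obj C. \<forall>h\<in>Hom R P (omap Eq x). \<exists>!k. k \<in> Hom C q x \<and> amap Eq k \<cdot>\<^bsub>R\<^esub> \<eta> = h"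
      using univ[OF P] by blast
    have "\<exists>c. cartesian R C p c \<and> Cod R c = omap Eq (omap F q) \<and> amap p c = amap F (amap p \<eta>)"
    proof -
      have "amap F (amap p \<eta>) \<in> Arr C" "omap Eq (omap F q) \<in> Obj R"
        "omap p (omap Eq (omap F q)) = Cod C (amap F (amap p \<eta>))"
        using q by (auto simp: in_Hom)
      then show ?thesis using fib unfolding fibration_def by blast
    qed
    then obtain c where "cartesian R C p c" "Cod R c = omap Eq (omap F q)"
      "amap p c = amap F (amap p \<eta>)" by blast
    then have "good P (q, \<eta>, c)" using q False by (auto simp: good_def)
    then show ?thesis by blast
  qed
  then obtain d where d: "\<And>P. P \<in> Obj R \<Longrightarrow> good P (d P)" by metis
  define Q where "Q P = fst (d P)" for P
  define \<eta> where "\<eta> P = fst (snd (d P))" for P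
  define c where "c P = snd (snd (d P))" for P
  have good: "good P (Q P, \<eta> P, c P)" if "P \<in> Obj R" for P
    using d[OF that] by (simp add: Q_def \<eta>_def c_def)
  have Q [simp]: "P \<in> Obj R \<Longrightarrow> Q P \<in> Obj C" for P
    using good[of P] by (simp add: good_def)
  have \<eta> [simp]: "P \<in> Obj R \<Longrightarrow> \<eta> P \<in> Arr R" "P \<in> Obj R \<Longrightarrow> Dom R (\<eta> P) = P"
    "P \<in> Obj R \<Longrightarrow> Cod R (\<eta> P) = omap Eq (Q P)" for P
    using good[of P] by (auto simp: good_def in_Hom)
  have cart: "P \<in> Obj R \<Longrightarrow> cartesian R C p (c P)" for P
    using good[of P] by (simp add: good_def)
  have c [simp]: "P \<in> Obj R \<Longrightarrow> c P \<in> Arr R" "P \<in> Obj R \<Longrightarrow> Cod R (c P) = omap Eq (omap F (Q P))"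
    "P \<in> Obj R \<Longrightarrow> amap p (c P) = amap F (amap p (\<eta> P))" for P
    using good[of P] by (auto simp: good_def cartesian_def)
  have at_Eq [simp]: "x \<in> Obj C \<Longrightarrow> Q (omap Eq x) = x" "x \<in> Obj C \<Longrightarrow> \<eta> (omap Eq x) = Ide R (omap Eq x)"
    "x \<in> Obj C \<Longrightarrow> c (omap Eq x) = Ide R (omap Eq (omap F x))" for x
    using good[of "omap Eq x"] by (auto simp: good_def)
  have transpose: "\<exists>k. k \<in> Arr C \<and> Dom C k = Q P \<and> Cod C k = x \<and> amap Eq k \<cdot>\<^bsub>R\<^esub> \<eta> P = h"
    if "P \<in> Obj R" "x \<in> Obj C" "h \<in> Arr R" "Dom R h = P" "Cod R h = omap Eq x" for P x h
  proof -
    have "h \<in> Hom R P (omap Eq x)" using that by (auto simp: in_Hom)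
    then have "\<exists>k. k \<in> Hom C (Q P) x \<and> amap Eq k \<cdot>\<^bsub>R\<^esub> \<eta> P = h"
      using good[of P] that(1,2) unfolding good_def by blast
    then show ?thesis by (auto simp: in_Hom)
  qed
  have transpose_unique: "k = k'"
    if "P \<in> Obj R" "k \<in> Arr C" "k' \<in> Arr C" "Dom C k = Q P" "Dom C k' = Q P" "Cod C k = Cod C k'"
      "amap Eq k \<cdot>\<^bsub>R\<^esub> \<eta> P = amap Eq k' \<cdot>\<^bsub>R\<^esub> \<eta> P" for P k k'
  proof -
    have "amap Eq k \<cdot>\<^bsub>R\<^esub> \<eta> P \<in> Hom R P (omap Eq (Cod C k))" "Cod C k \<in> Obj C" using that by (auto simp: in_Hom)
    then have "\<exists>!m. m \<in> Hom C (Q P) (Cod C k) \<and> amap Eq m \<cdot>\<^bsub>R\<^esub> \<eta> P = amap Eq k \<cdot>\<^bsub>R\<^esub> \<eta> P"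
      using good[of P] that(1) unfolding good_def by blast
    moreover have "k \<in> Hom C (Q P) (Cod C k)" "k' \<in> Hom C (Q P) (Cod C k)" using that by (auto simp: in_Hom)
    ultimately show ?thesis using that(7) by metis
  qed
  \<comment> \<open>The action of \<open>Q\<close> on arrows: the transpose of
    \<open>\<eta> (Cod R u)\<close> after \<open>u\<close>. Preservation of identities and
    composites is uniqueness of transposes.\<close>
  define Qa where "Qa u = (SOME k. k \<in> Arr C \<and> Dom C k = Q (Dom R u) \<and> Cod C k = Q (Cod R u) \<and>
    amap Eq k \<cdot>\<^bsub>R\<^esub> \<eta> (Dom R u) = \<eta> (Cod R u) \<cdot>\<^bsub>R\<^esub> u)" for u
  have Qa: "Qa u \<in> Arr C \<and> Dom C (Qa u) = Q (Dom R u) \<and> Cod C (Qa u) = Q (Cod R u) \<and>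
    amap Eq (Qa u) \<cdot>\<^bsub>R\<^esub> \<eta> (Dom R u) = \<eta> (Cod R u) \<cdot>\<^bsub>R\<^esub> u" if "u \<in> Arr R" for u
    unfolding Qa_def by (rule someI_ex, rule transpose) (use that in auto)
  then have Qa_simps [simp]: "u \<in> Arr R \<Longrightarrow> Qa u \<in> Arr C" "u \<in> Arr R \<Longrightarrow> Dom C (Qa u) = Q (Dom R u)"
    "u \<in> Arr R \<Longrightarrow> Cod C (Qa u) = Q (Cod R u)" for u by auto
  have Qa_nat: "u \<in> Arr R \<Longrightarrow> amap Eq (Qa u) \<cdot>\<^bsub>R\<^esub> \<eta> (Dom R u) = \<eta> (Cod R u) \<cdot>\<^bsub>R\<^esub> u" for u
    using Qa by auto
  have Qa_base: "Qa u \<cdot>\<^bsub>C\<^esub> amap p (\<eta> (Dom R u)) = amap p (\<eta> (Cod R u)) \<cdot>\<^bsub>C\<^esub> amap p u"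
    if "u \<in> Arr R" for u
    using arg_cong[OF Qa_nat[OF that], of "amap p"] that by simp
  have Qa_Ide: "Qa (Ide R P) = Ide C (Q P)" if "P \<in> Obj R" for P
    by (rule transpose_unique[OF that]) (use that Qa_nat[of "Ide R P"] in auto)
  have Qa_Cmp: "Qa (v \<cdot>\<^bsub>R\<^esub> u) = Qa v \<cdot>\<^bsub>C\<^esub> Qa u"
    if uv: "u \<in> Arr R" "v \<in> Arr R" "Cod R u = Dom R v" for u v
  proof (rule transpose_unique[of "Dom R u"])
    have "amap Eq (Qa v) \<cdot>\<^bsub>R\<^esub> (amap Eq (Qa u) \<cdot>\<^bsub>R\<^esub> \<eta> (Dom R u)) = amap Eq (Qa v) \<cdot>\<^bsub>R\<^esub> (\<eta> (Dom R v) \<cdot>\<^bsub>R\<^esub> u)"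
      using uv by (simp add: Qa_nat)
    also have "\<dots> = \<eta> (Cod R v) \<cdot>\<^bsub>R\<^esub> (v \<cdot>\<^bsub>R\<^esub> u)"
      using uv p.src.Cmp_eq_extend[OF Qa_nat[OF uv(2)], of u] by simp
    finally show "amap Eq (Qa (v \<cdot>\<^bsub>R\<^esub> u)) \<cdot>\<^bsub>R\<^esub> \<eta> (Dom R u) = amap Eq (Qa v \<cdot>\<^bsub>C\<^esub> Qa u) \<cdot>\<^bsub>R\<^esub> \<eta> (Dom R u)"
      using uv Qa_nat[of "v \<cdot>\<^bsub>R\<^esub> u"] by simp
  qed (use uv in auto)
  have Qa_Eq: "Qa (amap Eq f) = f" if "f \<in> Arr C" for f
    by (rule transpose_unique[of "omap Eq (Dom C f)"]) (use that Qa_nat[of "amap Eq f"] in auto)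

  \<comment> \<open>The action of \<open>F'\<close> on arrows: \<open>Eq (F (Q u))\<close> after
    \<open>c (Dom R u)\<close> factors through the cartesian \<open>c (Cod R u)\<close>, and the
    factor is required to lie over \<open>F (p u)\<close>. The base condition for this is
    \<open>F\<close> applied to \<open>Qa_base\<close>.\<close>
  define Fa where "Fa u = (SOME l. l \<in> Arr R \<and> Dom R l = Dom R (c (Dom R u)) \<and>
    Cod R l = Dom R (c (Cod R u)) \<and> amap p l = amap F (amap p u) \<and>
    c (Cod R u) \<cdot>\<^bsub>R\<^esub> l = amap Eq (amap F (Qa u)) \<cdot>\<^bsub>R\<^esub> c (Dom R u))" for u
  \<comment> \<open>\<open>c P\<close> lies over \<open>F\<close> of the base of
    \<open>\<eta> P\<close>, and that base arrow starts at \<open>p P\<close>; this is why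
    \<open>F'\<close> lifts \<open>F\<close> strictly.\<close>
  have p_Dom_c [simp]: "omap p (Dom R (c P)) = omap F (omap p P)" if "P \<in> Obj R" for P
  proof -
    have "Dom C (amap p (c P)) = omap F (omap p P)" using that by (simp add: c(3) del: p.Dom_amap) (simp add: that)
    then show ?thesis using that by (simp del: c(3))
  qed
  have Fa: "Fa u \<in> Arr R \<and> Dom R (Fa u) = Dom R (c (Dom R u)) \<and>
    Cod R (Fa u) = Dom R (c (Cod R u)) \<and> amap p (Fa u) = amap F (amap p u) \<and>
    c (Cod R u) \<cdot>\<^bsub>R\<^esub> Fa u = amap Eq (amap F (Qa u)) \<cdot>\<^bsub>R\<^esub> c (Dom R u)" if u: "u \<in> Arr R" for u
    unfolding Fa_def
  proof (rule someI_ex)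
    have "amap F (amap p (\<eta> (Cod R u))) \<cdot>\<^bsub>C\<^esub> amap F (amap p u)
        = amap F (Qa u) \<cdot>\<^bsub>C\<^esub> amap F (amap p (\<eta> (Dom R u)))"
      using arg_cong[OF Qa_base[OF u], of "amap F"] u by simp
    then show "\<exists>l. l \<in> Arr R \<and> Dom R l = Dom R (c (Dom R u)) \<and>
        Cod R l = Dom R (c (Cod R u)) \<and> amap p l = amap F (amap p u) \<and>
        c (Cod R u) \<cdot>\<^bsub>R\<^esub> l = amap Eq (amap F (Qa u)) \<cdot>\<^bsub>R\<^esub> c (Dom R u)"
      using u p.cartesian_factor[OF cart[of "Cod R u"],
          of "amap Eq (amap F (Qa u)) \<cdot>\<^bsub>R\<^esub> c (Dom R u)" "amap F (amap p u)"]
      by simp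
  qed
  then have Fa_simps [simp]: "u \<in> Arr R \<Longrightarrow> Fa u \<in> Arr R" "u \<in> Arr R \<Longrightarrow> Dom R (Fa u) = Dom R (c (Dom R u))"
    "u \<in> Arr R \<Longrightarrow> Cod R (Fa u) = Dom R (c (Cod R u))" "u \<in> Arr R \<Longrightarrow> amap p (Fa u) = amap F (amap p u)"
    for u by auto
  have c_Fa: "u \<in> Arr R \<Longrightarrow> c (Cod R u) \<cdot>\<^bsub>R\<^esub> Fa u = amap Eq (amap F (Qa u)) \<cdot>\<^bsub>R\<^esub> c (Dom R u)" for u
    using Fa by auto
  have Fa_Ide: "Fa (Ide R P) = Ide R (Dom R (c P))" if "P \<in> Obj R" for P
    by (rule p.cartesian_cancel[OF cart[OF that]]) (use that c_Fa[of "Ide R P"] in \<open>auto simp: Qa_Ide\<close>)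
  have Fa_Cmp: "Fa (v \<cdot>\<^bsub>R\<^esub> u) = Fa v \<cdot>\<^bsub>R\<^esub> Fa u"
    if uv: "u \<in> Arr R" "v \<in> Arr R" "Cod R u = Dom R v" for u v
  proof (rule p.cartesian_cancel[OF cart[of "Cod R v"]])
    have "c (Cod R v) \<cdot>\<^bsub>R\<^esub> (Fa v \<cdot>\<^bsub>R\<^esub> Fa u) = amap Eq (amap F (Qa v)) \<cdot>\<^bsub>R\<^esub> (c (Cod R u) \<cdot>\<^bsub>R\<^esub> Fa u)"
      using uv p.src.Cmp_eq_extend[OF c_Fa[OF uv(2)], of "Fa u"] by simp
    also have "\<dots> = amap Eq (amap F (Qa v \<cdot>\<^bsub>C\<^esub> Qa u)) \<cdot>\<^bsub>R\<^esub> c (Dom R u)"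
      using uv c_Fa[of u] by simp
    finally show "c (Cod R v) \<cdot>\<^bsub>R\<^esub> Fa (v \<cdot>\<^bsub>R\<^esub> u) = c (Cod R v) \<cdot>\<^bsub>R\<^esub> (Fa v \<cdot>\<^bsub>R\<^esub> Fa u)"
      using c_Fa[of "v \<cdot>\<^bsub>R\<^esub> u"] uv by (simp add: Qa_Cmp)
  qed (use uv in auto)
  define F' where "F' = \<lparr>omap = (\<lambda>P. Dom R (c P)), amap = Fa\<rparr>"
  have F': "cat_functor R R F'"
    by unfold_locales (auto simp: F'_def in_Hom Fa_Ide Fa_Cmp)
  define \<phi> where "\<phi> x = Ide R (omap Eq (omap F x))" for x
  \<comment> \<open>At an equality object the chosen cartesian arrow is an identity, so the equation
    that characterises \<open>Fa u\<close> becomes a formula for it.\<close>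
  have Fa_into_Eq: "Fa u = amap Eq (amap F (Qa u)) \<cdot>\<^bsub>R\<^esub> c (Dom R u)"
    if "u \<in> Arr R" "x \<in> Obj C" "Cod R u = omap Eq x" for u x
    using c_Fa[OF that(1)] that by simp
  have Fa_Eq: "Fa (amap Eq f) = amap Eq (amap F f)" if "f \<in> Arr C" for f
    using Fa_into_Eq[of "amap Eq f" "Cod C f"] that by (simp add: Qa_Eq)
  have lift: "func_eq R (p \<circ>\<^sub>F F') (F \<circ>\<^sub>F p)"
    by (auto simp: func_eq_def comp_func_def F'_def)
  have nat: "nat_iso C R (Eq \<circ>\<^sub>F F) (F' \<circ>\<^sub>F Eq) \<phi>"
    by (auto simp: nat_iso_def nat_trans_def comp_func_def F'_def \<phi>_def in_Hom iso_def Fa_Eq)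
  have sound: "terminal (coalg R F') (omap (coalg_func R Eq \<phi>) t)"
    if t: "terminal (coalg C F) t" for t
  proof -
    obtain x \<alpha> where t_def: "t = (x, \<alpha>)" by fastforce
    have x: "x \<in> Obj C" "\<alpha> \<in> Arr C" "Dom C \<alpha> = x" "Cod C \<alpha> = omap F x"
      using t unfolding t_def by (auto simp: terminal_def coalg_def in_Hom)
    let ?e = "(omap Eq x, amap Eq \<alpha>)"
    have e: "omap (coalg_func R Eq \<phi>) t = ?e"
      using x by (simp add: coalg_func_def t_def \<phi>_def Let_def)
    have "\<exists>!h. h \<in> Hom (coalg R F') a ?e" if "a \<in> Obj (coalg R F')" for a
    proof -
      obtain P \<beta> where a: "a = (P, \<beta>)" by fastforce
      have P: "P \<in> Obj R" "\<beta> \<in> Arr R" "Dom R \<beta> = P" "Cod R \<beta> = Dom R (c P)"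
        using that unfolding a by (auto simp: coalg_def in_Hom F'_def)
      \<comment> \<open>\<open>c P\<close> after \<open>\<beta>\<close> ends at
        \<open>Eq (F (Q P))\<close>, hence has a transpose; this is the \<open>F\<close>-coalgebra
        structure on the quotient \<open>Q P\<close>.\<close>
      obtain \<gamma> where \<gamma>: "\<gamma> \<in> Arr C" "Dom C \<gamma> = Q P" "Cod C \<gamma> = omap F (Q P)"
        "amap Eq \<gamma> \<cdot>\<^bsub>R\<^esub> \<eta> P = c P \<cdot>\<^bsub>R\<^esub> \<beta>"
        using transpose[of P "omap F (Q P)" "c P \<cdot>\<^bsub>R\<^esub> \<beta>"] P by auto
      txt \<open>Transposition identifies coalgebra morphisms from \<open>\<beta>\<close> with those from \<open>\<gamma>\<close>.\<close>
      have iff: "amap Eq \<alpha> \<cdot>\<^bsub>R\<^esub> (amap Eq k \<cdot>\<^bsub>R\<^esub> \<eta> P) = Fa (amap Eq k \<cdot>\<^bsub>R\<^esub> \<eta> P) \<cdot>\<^bsub>R\<^esub> \<beta>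
          \<longleftrightarrow> \<alpha> \<cdot>\<^bsub>C\<^esub> k = amap F k \<cdot>\<^bsub>C\<^esub> \<gamma>"
        if k: "k \<in> Arr C" "Dom C k = Q P" "Cod C k = x" for k
      proof -
        let ?h = "amap Eq k \<cdot>\<^bsub>R\<^esub> \<eta> P"
        \<comment> \<open>\<open>?h\<close> ends at \<open>Eq x\<close>, where \<open>\<eta>\<close>
          is an identity, so \<open>Qa ?h\<close> is simply the transpose of
          \<open>?h\<close>.\<close>
        have "Qa ?h = k"
          by (rule transpose_unique[OF P(1)]) (use k P x Qa_nat[of ?h] in auto)
        then have "Fa ?h = amap Eq (amap F k) \<cdot>\<^bsub>R\<^esub> c P"
          using Fa_into_Eq[of ?h x] k P x by simp
        then have "Fa ?h \<cdot>\<^bsub>R\<^esub> \<beta> = amap Eq (amap F k \<cdot>\<^bsub>C\<^esub> \<gamma>) \<cdot>\<^bsub>R\<^esub> \<eta> P"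
          using k P x \<gamma> by simp
        moreover have "amap Eq \<alpha> \<cdot>\<^bsub>R\<^esub> ?h = amap Eq (\<alpha> \<cdot>\<^bsub>C\<^esub> k) \<cdot>\<^bsub>R\<^esub> \<eta> P"
          using k P x by simp
        moreover have "\<alpha> \<cdot>\<^bsub>C\<^esub> k = amap F k \<cdot>\<^bsub>C\<^esub> \<gamma>"
          if "amap Eq (\<alpha> \<cdot>\<^bsub>C\<^esub> k) \<cdot>\<^bsub>R\<^esub> \<eta> P = amap Eq (amap F k \<cdot>\<^bsub>C\<^esub> \<gamma>) \<cdot>\<^bsub>R\<^esub> \<eta> P"
          by (rule transpose_unique[OF P(1) _ _ _ _ _ that]) (use k x \<gamma> in auto)
        ultimately show ?thesis by metis
      qed
      have "(Q P, \<gamma>) \<in> Obj (coalg C F)" using \<gamma> P by (auto simp: coalg_def in_Hom)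
      then obtain m where m: "m \<in> Hom (coalg C F) (Q P, \<gamma>) (x, \<alpha>)"
        and m_unique: "\<And>m'. m' \<in> Hom (coalg C F) (Q P, \<gamma>) (x, \<alpha>) \<Longrightarrow> m' = m"
        using t unfolding t_def terminal_def by blast
      from m obtain k where m_def: "m = ((Q P, \<gamma>), k, (x, \<alpha>))"
        and k: "k \<in> Arr C" "Dom C k = Q P" "Cod C k = x" "\<alpha> \<cdot>\<^bsub>C\<^esub> k = amap F k \<cdot>\<^bsub>C\<^esub> \<gamma>"
        unfolding in_Hom_coalg by blast
      have k_unique: "k' = k" if "k' \<in> Arr C" "Dom C k' = Q P" "Cod C k' = x"
          "\<alpha> \<cdot>\<^bsub>C\<^esub> k' = amap F k' \<cdot>\<^bsub>C\<^esub> \<gamma>" for k'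
        using m_unique[of "((Q P, \<gamma>), k', (x, \<alpha>))"] that x \<gamma> P
        by (simp add: m_def in_Hom_coalg) (simp add: coalg_def in_Hom)
      have hom: "m \<in> Hom (coalg R F') a ?e \<longleftrightarrow> (\<exists>h. m = (a, h, ?e) \<and> h \<in> Arr R \<and> Dom R h = P \<and>
          Cod R h = omap Eq x \<and> amap Eq \<alpha> \<cdot>\<^bsub>R\<^esub> h = Fa h \<cdot>\<^bsub>R\<^esub> \<beta>)" for m
        using x P unfolding a in_Hom_coalg by (simp add: coalg_def in_Hom F'_def)
      show ?thesis
      proof (rule ex1I[of _ "(a, amap Eq k \<cdot>\<^bsub>R\<^esub> \<eta> P, ?e)"])
        show "(a, amap Eq k \<cdot>\<^bsub>R\<^esub> \<eta> P, ?e) \<in> Hom (coalg R F') a ?e"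
          unfolding hom using k P x iff[of k] by auto
        show "m = (a, amap Eq k \<cdot>\<^bsub>R\<^esub> \<eta> P, ?e)" if m': "m \<in> Hom (coalg R F') a ?e" for m
        proof -
          obtain h where h: "m = (a, h, ?e)" "h \<in> Arr R" "Dom R h = P" "Cod R h = omap Eq x"
            "amap Eq \<alpha> \<cdot>\<^bsub>R\<^esub> h = Fa h \<cdot>\<^bsub>R\<^esub> \<beta>" using m' unfolding hom by blast
          obtain k' where k': "k' \<in> Arr C" "Dom C k' = Q P" "Cod C k' = x" "amap Eq k' \<cdot>\<^bsub>R\<^esub> \<eta> P = h"
            using transpose[of P x h] h P x by auto
          then have "k' = k" using iff[of k'] h k_unique by auto
          then show ?thesis using k' h by simp
        qed
      qed
    qed
    moreover have "?e \<in> Obj (coalg R F')" using x by (auto simp: coalg_def in_Hom F'_def)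
    ultimately show ?thesis unfolding e terminal_def by blast
  qed
  show ?thesis using F' lift nat sound unfolding preserves_terminal_def by blast
qed

section \<open>Slices\<close>

lemma slice_Obj [simp]: "f \<in> Obj (slice C i) \<longleftrightarrow> f \<in> Arr C \<and> Cod C f = i"
  and slice_Arr [simp]: "(f, h, g) \<in> Arr (slice C i) \<longleftrightarrow> f \<in> Arr C \<and> Cod C f = i \<and> g \<in> Arr C \<and>
    Cod C g = i \<and> h \<in> Arr C \<and> Dom C h = Dom C f \<and> Cod C h = Dom C g \<and> g \<cdot>\<^bsub>C\<^esub> h = f"
  and slice_Dom [simp]: "Dom (slice C i) (f, h, g) = f"
  and slice_Cod [simp]: "Cod (slice C i) (f, h, g) = g"
  and slice_Ide [simp]: "Ide (slice C i) f = (f, Ide C (Dom C f), f)"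
  and slice_Cmp [simp]: "(f', h', g') \<cdot>\<^bsub>slice C i\<^esub> (f, h, g) = (f, h' \<cdot>\<^bsub>C\<^esub> h, g')"
  by (auto simp: slice_def in_Hom)

lemma slice_func_simps [simp]:
  "omap (slice_func F) f = amap F f"
  "amap (slice_func F) (f, h, g) = (amap F f, amap F h, amap F g)"
  by (simp_all add: slice_func_def)

lemma (in category) category_slice: "category (slice C i)"
proof
  fix a x y b z c w
  show "a \<in> Arr (slice C i) \<Longrightarrow> Dom (slice C i) a \<in> Obj (slice C i)"
    "a \<in> Arr (slice C i) \<Longrightarrow> Cod (slice C i) a \<in> Obj (slice C i)"
    by (cases a; simp)+
  show "x \<in> Obj (slice C i) \<Longrightarrow> Ide (slice C i) x \<in> Hom (slice C i) x x"
    by (simp add: in_Hom)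
  show "a \<in> Hom (slice C i) x y \<Longrightarrow> b \<in> Hom (slice C i) y z \<Longrightarrow>
      b \<cdot>\<^bsub>slice C i\<^esub> a \<in> Hom (slice C i) x z"
    by (cases a; cases b) (auto simp: in_Hom Cmp_Cmp[symmetric] simp del: Cmp_Cmp)
  show "a \<in> Hom (slice C i) x y \<Longrightarrow> a \<cdot>\<^bsub>slice C i\<^esub> Ide (slice C i) x = a"
    "a \<in> Hom (slice C i) x y \<Longrightarrow> Ide (slice C i) y \<cdot>\<^bsub>slice C i\<^esub> a = a"
    by (cases a; auto simp: in_Hom)+
  show "a \<in> Hom (slice C i) w x \<Longrightarrow> b \<in> Hom (slice C i) x y \<Longrightarrow> c \<in> Hom (slice C i) y z \<Longrightarrow>
    c \<cdot>\<^bsub>slice C i\<^esub> (b \<cdot>\<^bsub>slice C i\<^esub> a) = (c \<cdot>\<^bsub>slice C i\<^esub> b) \<cdot>\<^bsub>slice C i\<^esub> a"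
    by (cases a; cases b; cases c) (auto simp: in_Hom)
qed

lemma (in cat_functor) cat_functor_slice:
  "cat_functor (slice C i) (slice D (omap F i)) (slice_func F)"
proof (intro cat_functor.intro cat_functor_axioms.intro src.category_slice tgt.category_slice)
  fix a x y b z
  show "a \<in> Hom (slice C i) x y \<Longrightarrow> amap (slice_func F) a \<in>
      Hom (slice D (omap F i)) (omap (slice_func F) x) (omap (slice_func F) y)"
    by (cases a) (auto simp: in_Hom simp flip: amap_comp)
  show "a \<in> Hom (slice C i) x y \<Longrightarrow> b \<in> Hom (slice C i) y z \<Longrightarrow>
      amap (slice_func F) (b \<cdot>\<^bsub>slice C i\<^esub> a) =
      amap (slice_func F) b \<cdot>\<^bsub>slice D (omap F i)\<^esub> amap (slice_func F) a"
    by (cases a; cases b) (auto simp: in_Hom)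
qed auto

lemma slice_Arr_cases:
  assumes "a \<in> Arr (slice C i)"
  obtains f h g where "a = (f, h, g)" "f \<in> Arr C" "Cod C f = i" "g \<in> Arr C" "Cod C g = i" "h \<in> Arr C"
    "Dom C h = Dom C f" "Cod C h = Dom C g" "g \<cdot>\<^bsub>C\<^esub> h = f"
  using assms by (cases a) auto

text \<open>A factorisation found in \<open>C\<close> is an arrow of the slice without further work:
  its domain maps to \<open>i\<close> through \<open>g\<close> after \<open>k'\<close>, and
  \<open>h\<close> after the factor is \<open>k'\<close>.\<close>

lemma (in cat_functor) cartesian_slice:
  assumes h: "cartesian C D F h" and g: "g \<in> Arr C" "Dom C g = Cod C h" "Cod C g = i"
  shows "cartesian (slice C i) (slice D (omap F i)) (slice_func F) (g \<cdot>\<^bsub>C\<^esub> h, h, g)"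
proof -
  interpret S: cat_functor "slice C i" "slice D (omap F i)" "slice_func F" by (rule cat_functor_slice)
  have hA: "h \<in> Arr C" using h by (simp add: cartesian_def)
  show ?thesis
  proof (rule S.cartesianI)
    show "(g \<cdot>\<^bsub>C\<^esub> h, h, g) \<in> Arr (slice C i)" using hA g by simp
  next
    fix k b
    assume k: "k \<in> Arr (slice C i)" "Cod (slice C i) k = Cod (slice C i) (g \<cdot>\<^bsub>C\<^esub> h, h, g)"
      and b: "b \<in> Arr (slice D (omap F i))" "Dom (slice D (omap F i)) b = omap (slice_func F) (Dom (slice C i) k)"
      "Cod (slice D (omap F i)) b = omap (slice_func F) (Dom (slice C i) (g \<cdot>\<^bsub>C\<^esub> h, h, g))"
      and e: "amap (slice_func F) (g \<cdot>\<^bsub>C\<^esub> h, h, g) \<cdot>\<^bsub>slice D (omap F i)\<^esub> b = amap (slice_func F) k"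
    obtain f k' where k': "k = (f, k', g)" "f \<in> Arr C" "Cod C f = i" "k' \<in> Arr C" "Dom C k' = Dom C f"
      "Cod C k' = Dom C g" "g \<cdot>\<^bsub>C\<^esub> k' = f"
      using k g by (cases k) auto
    obtain b' where b': "b = (amap F f, b', amap F (g \<cdot>\<^bsub>C\<^esub> h))" "b' \<in> Arr D" "Dom D b' = omap F (Dom C f)"
      "Cod D b' = omap F (Dom C h)" "amap F (g \<cdot>\<^bsub>C\<^esub> h) \<cdot>\<^bsub>D\<^esub> b' = amap F f"
      using b k' hA g by (cases b) auto
    obtain l where l: "l \<in> Arr C" "Dom C l = Dom C k'" "Cod C l = Dom C h" "amap F l = b'" "h \<cdot>\<^bsub>C\<^esub> l = k'"
      using cartesian_factor[OF h, of k' b'] e b' k' g by auto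
    have "(f, l, g \<cdot>\<^bsub>C\<^esub> h) \<in> Arr (slice C i)" using l k' g hA by simp
    then show "\<exists>l. l \<in> Arr (slice C i) \<and> Dom (slice C i) l = Dom (slice C i) k \<and>
        Cod (slice C i) l = Dom (slice C i) (g \<cdot>\<^bsub>C\<^esub> h, h, g) \<and> amap (slice_func F) l = b \<and>
        (g \<cdot>\<^bsub>C\<^esub> h, h, g) \<cdot>\<^bsub>slice C i\<^esub> l = k"
      using k' b' l by (intro exI[of _ "(f, l, g \<cdot>\<^bsub>C\<^esub> h)"]) simp
  next
    fix l l'
    assume "l \<in> Arr (slice C i)" "l' \<in> Arr (slice C i)" "Dom (slice C i) l = Dom (slice C i) l'"
      "Cod (slice C i) l = Dom (slice C i) (g \<cdot>\<^bsub>C\<^esub> h, h, g)"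
      "Cod (slice C i) l' = Dom (slice C i) (g \<cdot>\<^bsub>C\<^esub> h, h, g)"
      "amap (slice_func F) l = amap (slice_func F) l'"
      "(g \<cdot>\<^bsub>C\<^esub> h, h, g) \<cdot>\<^bsub>slice C i\<^esub> l = (g \<cdot>\<^bsub>C\<^esub> h, h, g) \<cdot>\<^bsub>slice C i\<^esub> l'"
    moreover obtain a m b a' m' b' where "l = (a, m, b)" "l' = (a', m', b')" by (cases l; cases l')
    moreover from calculation have "m = m'"
      by - (rule cartesian_cancel[OF h], use hA g in auto)
    ultimately show "l = l'" by simp
  qed
qed

text \<open>Here the factor \<open>l\<close> must be shown to commute with the maps to
  \<open>i\<close>: \<open>f\<close> after \<open>l\<close> and \<open>g\<close> have the same base
  and agree after \<open>h\<close>, so opcartesianness of \<open>h\<close> identifies them.\<close>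

lemma (in cat_functor) opcartesian_slice:
  assumes h: "opcartesian C D F h" and g: "g \<in> Arr C" "Dom C g = Cod C h" "Cod C g = i"
  shows "opcartesian (slice C i) (slice D (omap F i)) (slice_func F) (g \<cdot>\<^bsub>C\<^esub> h, h, g)"
proof -
  interpret S: cat_functor "slice C i" "slice D (omap F i)" "slice_func F" by (rule cat_functor_slice)
  have hA: "h \<in> Arr C" using h by (simp add: opcartesian_def)
  show ?thesis
  proof (rule S.opcartesianI)
    show "(g \<cdot>\<^bsub>C\<^esub> h, h, g) \<in> Arr (slice C i)" using hA g by simp
  next
    fix k b
    assume k: "k \<in> Arr (slice C i)" "Dom (slice C i) k = Dom (slice C i) (g \<cdot>\<^bsub>C\<^esub> h, h, g)"
      and b: "b \<in> Arr (slice D (omap F i))"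
      "Dom (slice D (omap F i)) b = omap (slice_func F) (Cod (slice C i) (g \<cdot>\<^bsub>C\<^esub> h, h, g))"
      "Cod (slice D (omap F i)) b = omap (slice_func F) (Cod (slice C i) k)"
      and e: "b \<cdot>\<^bsub>slice D (omap F i)\<^esub> amap (slice_func F) (g \<cdot>\<^bsub>C\<^esub> h, h, g) = amap (slice_func F) k"
    obtain f k' where k': "k = (g \<cdot>\<^bsub>C\<^esub> h, k', f)" "f \<in> Arr C" "Cod C f = i" "k' \<in> Arr C" "Dom C k' = Dom C h"
      "Cod C k' = Dom C f" "f \<cdot>\<^bsub>C\<^esub> k' = g \<cdot>\<^bsub>C\<^esub> h"
      using k hA g by (cases k) auto
    obtain b' where b': "b = (amap F g, b', amap F f)" "b' \<in> Arr D" "Dom D b' = omap F (Dom C g)"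
      "Cod D b' = omap F (Dom C f)" "amap F f \<cdot>\<^bsub>D\<^esub> b' = amap F g"
      using b k' hA g by (cases b) auto
    obtain l where l: "l \<in> Arr C" "Dom C l = Cod C h" "Cod C l = Cod C k'" "amap F l = b'" "l \<cdot>\<^bsub>C\<^esub> h = k'"
      using opcartesian_factor[OF h, of k' b'] e b' k' g by auto
    have "f \<cdot>\<^bsub>C\<^esub> l = g"
      by (rule opcartesian_cancel[OF h]) (use l k' b' g hA in auto)
    then have "(g, l, f) \<in> Arr (slice C i)" using l k' g hA by simp
    then show "\<exists>l. l \<in> Arr (slice C i) \<and> Dom (slice C i) l = Cod (slice C i) (g \<cdot>\<^bsub>C\<^esub> h, h, g) \<and>
        Cod (slice C i) l = Cod (slice C i) k \<and> amap (slice_func F) l = b \<and>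
        l \<cdot>\<^bsub>slice C i\<^esub> (g \<cdot>\<^bsub>C\<^esub> h, h, g) = k"
      using k' b' l by (intro exI[of _ "(g, l, f)"]) simp
  next
    fix l l'
    assume "l \<in> Arr (slice C i)" "l' \<in> Arr (slice C i)" "Cod (slice C i) l = Cod (slice C i) l'"
      "Dom (slice C i) l = Cod (slice C i) (g \<cdot>\<^bsub>C\<^esub> h, h, g)"
      "Dom (slice C i) l' = Cod (slice C i) (g \<cdot>\<^bsub>C\<^esub> h, h, g)"
      "amap (slice_func F) l = amap (slice_func F) l'"
      "l \<cdot>\<^bsub>slice C i\<^esub> (g \<cdot>\<^bsub>C\<^esub> h, h, g) = l' \<cdot>\<^bsub>slice C i\<^esub> (g \<cdot>\<^bsub>C\<^esub> h, h, g)"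
    moreover obtain a m b a' m' b' where "l = (a, m, b)" "l' = (a', m', b')" by (cases l; cases l')
    moreover from calculation have "m = m'"
      by - (rule opcartesian_cancel[OF h], use hA g in auto)
    ultimately show "l = l'" by simp
  qed
qed

text \<open>The base is the slice over \<open>omap U t\<close>; for \<open>t = omap K I\<close> that
  object is \<open>I\<close>, which gives the functor \<open>U/I\<close>.\<close>

lemma fibration_slice:
  assumes "fibration E B U"
  shows "fibration (slice E t) (slice B (omap U t)) (slice_func U)"
proof -
  interpret U: cat_functor E B U using assms by (simp add: fibration_def)
  have "\<exists>h. cartesian (slice E t) (slice B (omap U t)) (slice_func U) h \<and> Cod (slice E t) h = w \<and>
      amap (slice_func U) h = a"
    if a: "a \<in> Arr (slice B (omap U t))" and w: "w \<in> Obj (slice E t)"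
      and e: "omap (slice_func U) w = Cod (slice B (omap U t)) a" for a w
  proof -
    obtain f u where u: "a = (f, u, amap U w)" "u \<in> Arr B" "Cod B u = omap U (Dom E w)" "amap U w \<cdot>\<^bsub>B\<^esub> u = f"
      using slice_Arr_cases[OF a] e w by (metis U.Dom_amap slice_Cod slice_Obj slice_func_simps(1))
    obtain h where h: "cartesian E B U h" "Cod E h = Dom E w" "amap U h = u"
      using assms u w unfolding fibration_def by (metis U.src.Dom_Obj slice_Obj)
    then have "h \<in> Arr E" by (simp add: cartesian_def)
    then show ?thesis
      using U.cartesian_slice[OF h(1), of w t] h u w by (intro exI[of _ "(w \<cdot>\<^bsub>E\<^esub> h, h, w)"]) auto
  qed
  then show ?thesis using U.cat_functor_slice unfolding fibration_def by blast
qed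

text \<open>Lift the middle entry of \<open>a\<close> to \<open>h\<close> in \<open>E\<close>; the
  structure map \<open>g\<close> of its codomain is then the factorisation of \<open>w\<close>
  through \<open>h\<close>. That \<open>h\<close> is opcartesian in \<open>E\<close> is recorded for
  the comparison in \<open>opcartesian_of_slice\<close>.\<close>

lemma opcart_lift_slice_ex:
  assumes "opfibration E B U" and a: "a \<in> Arr (slice B (omap U t))" and w: "w \<in> Obj (slice E t)"
    and e: "omap (slice_func U) w = Dom (slice B (omap U t)) a"
  shows "\<exists>h g. opcartesian E B U h \<and> opcartesian (slice E t) (slice B (omap U t)) (slice_func U) (w, h, g) \<and>
      (w, h, g) \<in> Arr (slice E t) \<and> amap (slice_func U) (w, h, g) = a"
proof -
  interpret U: cat_functor E B U using assms by (simp add: opfibration_def)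
  obtain u f where u: "a = (amap U w, u, f)" "u \<in> Arr B" "Dom B u = omap U (Dom E w)"
      "Cod B u = Dom B f" "f \<in> Arr B" "Cod B f = omap U t" "f \<cdot>\<^bsub>B\<^esub> u = amap U w"
  proof -
    obtain f' u f where a': "a = (f', u, f)" by (cases a)
    then have "f' = amap U w" using e by simp
    then show thesis using that[of u f] a a' w by simp
  qed
  obtain h where h: "opcartesian E B U h" "Dom E h = Dom E w" "amap U h = u"
    using assms u w unfolding opfibration_def by (metis U.src.Dom_Obj slice_Obj)
  then have hA: "h \<in> Arr E" by (simp add: opcartesian_def)
  then have "omap U (Cod E h) = Dom B f" using U.Cod_amap[OF hA] h u by simp
  then have "\<exists>g. g \<in> Arr E \<and> Dom E g = Cod E h \<and> Cod E g = Cod E w \<and> amap U g = f \<and> g \<cdot>\<^bsub>E\<^esub> h = w"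
    using h u w by (intro U.opcartesian_factor[OF h(1), of w f]) simp_all
  then obtain g where g: "g \<in> Arr E" "Dom E g = Cod E h" "Cod E g = Cod E w" "amap U g = f" "g \<cdot>\<^bsub>E\<^esub> h = w"
    by blast
  have "opcartesian (slice E t) (slice B (omap U t)) (slice_func U) (w, h, g)"
    using U.opcartesian_slice[OF h(1) g(1,2), of t] g w by simp
  moreover have "amap (slice_func U) (w, h, g) = a"
    unfolding u(1) slice_func_simps h(3) g(4) ..
  moreover have "(w, h, g) \<in> Arr (slice E t)" using g h hA w by simp
  ultimately show ?thesis using h(1) by blast
qed

lemma opfibration_slice:
  assumes "opfibration E B U"
  shows "opfibration (slice E t) (slice B (omap U t)) (slice_func U)"
proof -
  interpret U: cat_functor E B U using assms by (simp add: opfibration_def)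
  show ?thesis
    using U.cat_functor_slice opcart_lift_slice_ex[OF assms] unfolding opfibration_def
    by (metis slice_Dom)
qed

text \<open>This is not immediate from the universal property, since a factorisation problem in \<open>E\<close> need
  not live over the slice; one compares with an opcartesian lifting that comes from \<open>E\<close>.\<close>

lemma opcartesian_of_slice:
  assumes U: "opfibration E B U"
    and o: "opcartesian (slice E t) (slice B (omap U t)) (slice_func U) (w, h, g)"
  shows "opcartesian E B U h"
proof -
  interpret U: cat_functor E B U using U by (simp add: opfibration_def)
  interpret S: cat_functor "slice E t" "slice B (omap U t)" "slice_func U" by (rule U.cat_functor_slice)
  have A: "(w, h, g) \<in> Arr (slice E t)" using o by (simp add: opcartesian_def)
  then have "w \<in> Obj (slice E t)" by simp
  then obtain h' g' where h': "opcartesian E B U h'"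
    "opcartesian (slice E t) (slice B (omap U t)) (slice_func U) (w, h', g')"
    "(w, h', g') \<in> Arr (slice E t)" "amap (slice_func U) (w, h', g') = amap (slice_func U) (w, h, g)"
    using opcart_lift_slice_ex[OF U S.amap_Arr[OF A], of w] by auto
  obtain m n where mn: "m \<in> Arr (slice E t)" "Dom (slice E t) m = g'" "Cod (slice E t) m = g"
    "n \<in> Arr (slice E t)" "Dom (slice E t) n = g" "Cod (slice E t) n = g'"
    "m \<cdot>\<^bsub>slice E t\<^esub> (w, h', g') = (w, h, g)"
    "n \<cdot>\<^bsub>slice E t\<^esub> m = Ide (slice E t) g'" "m \<cdot>\<^bsub>slice E t\<^esub> n = Ide (slice E t) g"
    using S.opcartesian_comparison[OF h'(2) o _ h'(4)] unfolding slice_Dom slice_Cod by blast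
  obtain m' n' where mn': "m = (g', m', g)" "n = (g, n', g')"
    using mn by (cases m; cases n) auto
  \<comment> \<open>An isomorphism of the slice has an invertible middle entry, so \<open>h\<close>
    is an opcartesian arrow of \<open>E\<close> followed by an isomorphism.\<close>
  have "opcartesian E B U m'"
    by (rule U.opcartesian_iso[of m' n']) (use mn mn' in auto)
  then have "opcartesian E B U (m' \<cdot>\<^bsub>E\<^esub> h')"
    using h'(3) mn(1) by (intro U.opcartesian_Cmp[OF h'(1)]) (simp_all add: mn')
  then show ?thesis using mn mn' by simp
qed

section \<open>Products, relations and equality\<close>

locale category_with_products = category C for C :: "('o, 'm) cat" (structure) +
  fixes pr :: "('o, 'm) spans"
  assumes products: "binary_products C pr"
begin

lemma span: "x \<in> Obj C \<Longrightarrow> y \<in> Obj C \<Longrightarrow> product_span C x y (Leg1 pr x y) (Leg2 pr x y)"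
  using products by (simp add: binary_products_def)

lemma Leg_simps [simp]:
  assumes "x \<in> Obj C" "y \<in> Obj C"
  shows "Leg1 pr x y \<in> Arr C" "Leg2 pr x y \<in> Arr C" "Dom C (Leg1 pr x y) = prod_obj C pr x y"
    "Dom C (Leg2 pr x y) = prod_obj C pr x y" "Cod C (Leg1 pr x y) = x" "Cod C (Leg2 pr x y) = y"
    "prod_obj C pr x y \<in> Obj C"
  using span[OF assms] Dom_Obj[of "Leg1 pr x y"] by (auto simp: product_span_def prod_obj_def)

lemma product_ext:
  assumes xy: "x \<in> Obj C" "y \<in> Obj C" and h: "h \<in> Arr C" "h' \<in> Arr C" "Dom C h = Dom C h'"
    "Cod C h = prod_obj C pr x y" "Cod C h' = prod_obj C pr x y"
    and eq: "Leg1 pr x y \<cdot> h = Leg1 pr x y \<cdot> h'" "Leg2 pr x y \<cdot> h = Leg2 pr x y \<cdot> h'"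
  shows "h = h'"
proof -
  have "Leg1 pr x y \<cdot> h \<in> Hom C (Dom C h) x" "Leg2 pr x y \<cdot> h \<in> Hom C (Dom C h) y"
    using xy h by (auto simp: in_Hom)
  then have "\<exists>!k. k \<in> Hom C (Dom C h) (Dom C (Leg1 pr x y)) \<and> Leg1 pr x y \<cdot> k = Leg1 pr x y \<cdot> h \<and>
      Leg2 pr x y \<cdot> k = Leg2 pr x y \<cdot> h"
    using span[OF xy] unfolding product_span_def by blast
  moreover have "h \<in> Hom C (Dom C h) (Dom C (Leg1 pr x y))" "h' \<in> Hom C (Dom C h) (Dom C (Leg1 pr x y))"
    using xy h by (auto simp: in_Hom)
  ultimately show ?thesis using eq by metis
qed

lemma pairing_simps [simp]:
  assumes "u \<in> Arr C" "v \<in> Arr C" "Dom C u = Dom C v"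
  shows "pairing C pr u v \<in> Arr C" "Dom C (pairing C pr u v) = Dom C u"
    "Cod C (pairing C pr u v) = prod_obj C pr (Cod C u) (Cod C v)"
    "Cod C u = x \<Longrightarrow> Cod C v = y \<Longrightarrow> Leg1 pr x y \<cdot> pairing C pr u v = u"
    "Cod C u = x \<Longrightarrow> Cod C v = y \<Longrightarrow> Leg2 pr x y \<cdot> pairing C pr u v = v"
proof -
  let ?x = "Cod C u" and ?y = "Cod C v"
  have xy: "?x \<in> Obj C" "?y \<in> Obj C" using assms by auto
  have "u \<in> Hom C (Dom C u) ?x" "v \<in> Hom C (Dom C u) ?y" using assms by (auto simp: in_Hom)
  then have "\<exists>!k. k \<in> Hom C (Dom C u) (prod_obj C pr ?x ?y) \<and> Leg1 pr ?x ?y \<cdot> k = u \<and> Leg2 pr ?x ?y \<cdot> k = v"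
    using span[OF xy] unfolding product_span_def prod_obj_def by blast
  from theI'[OF this] have "pairing C pr u v \<in> Hom C (Dom C u) (prod_obj C pr ?x ?y) \<and>
      Leg1 pr ?x ?y \<cdot> pairing C pr u v = u \<and> Leg2 pr ?x ?y \<cdot> pairing C pr u v = v"
    unfolding pairing_def .
  then show "pairing C pr u v \<in> Arr C" "Dom C (pairing C pr u v) = Dom C u"
    "Cod C (pairing C pr u v) = prod_obj C pr (Cod C u) (Cod C v)"
    "Cod C u = x \<Longrightarrow> Cod C v = y \<Longrightarrow> Leg1 pr x y \<cdot> pairing C pr u v = u"
    "Cod C u = x \<Longrightarrow> Cod C v = y \<Longrightarrow> Leg2 pr x y \<cdot> pairing C pr u v = v"
    by (auto simp: in_Hom)
qed

lemma diagonal_simps [simp]: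
  assumes "x \<in> Obj C"
  shows "diagonal C pr x \<in> Arr C" "Dom C (diagonal C pr x) = x" "Cod C (diagonal C pr x) = prod_obj C pr x x"
    "Leg1 pr x x \<cdot> diagonal C pr x = Ide C x" "Leg2 pr x x \<cdot> diagonal C pr x = Ide C x"
  using assms by (auto simp: diagonal_def)

abbreviation sq :: "'m \<Rightarrow> 'm" where "sq \<equiv> amap (square_func C pr)"

lemma square_simps [simp]:
  "omap (square_func C pr) x = prod_obj C pr x x"
  "f \<in> Arr C \<Longrightarrow> sq f \<in> Arr C"
  "f \<in> Arr C \<Longrightarrow> Dom C (sq f) = prod_obj C pr (Dom C f) (Dom C f)"
  "f \<in> Arr C \<Longrightarrow> Cod C (sq f) = prod_obj C pr (Cod C f) (Cod C f)"
  "f \<in> Arr C \<Longrightarrow> Cod C f = y \<Longrightarrow> Leg1 pr y y \<cdot> sq f = f \<cdot> Leg1 pr (Dom C f) (Dom C f)"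
  "f \<in> Arr C \<Longrightarrow> Cod C f = y \<Longrightarrow> Leg2 pr y y \<cdot> sq f = f \<cdot> Leg2 pr (Dom C f) (Dom C f)"
  by (auto simp: square_func_def)

lemma Leg_sq_Cmp [simp]:
  assumes "f \<in> Arr C" "Cod C f = y" "u \<in> Arr C" "Cod C u = prod_obj C pr (Dom C f) (Dom C f)"
  shows "Leg1 pr y y \<cdot> (sq f \<cdot> u) = f \<cdot> (Leg1 pr (Dom C f) (Dom C f) \<cdot> u)"
    "Leg2 pr y y \<cdot> (sq f \<cdot> u) = f \<cdot> (Leg2 pr (Dom C f) (Dom C f) \<cdot> u)"
  using Cmp_eq_extend[OF square_simps(5)[OF assms(1,2)], of u]
    Cmp_eq_extend[OF square_simps(6)[OF assms(1,2)], of u] assms by auto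

lemma Leg_diagonal_Cmp [simp]:
  assumes "x \<in> Obj C" "u \<in> Arr C" "Cod C u = x"
  shows "Leg1 pr x x \<cdot> (diagonal C pr x \<cdot> u) = u" "Leg2 pr x x \<cdot> (diagonal C pr x \<cdot> u) = u"
  using Cmp_eq_extend[OF diagonal_simps(4)[OF assms(1)], of u]
    Cmp_eq_extend[OF diagonal_simps(5)[OF assms(1)], of u] assms by auto

lemma sq_Ide [simp]: "x \<in> Obj C \<Longrightarrow> sq (Ide C x) = Ide C (prod_obj C pr x x)"
  by (rule product_ext[of x x]) auto

lemma sq_Cmp [simp]:
  assumes "f \<in> Arr C" "g \<in> Arr C" "Cod C f = Dom C g"
  shows "sq (g \<cdot> f) = sq g \<cdot> sq f"
  by (rule product_ext[of "Cod C g" "Cod C g"]) (use assms in auto)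

lemma diagonal_natural:
  assumes "f \<in> Arr C"
  shows "sq f \<cdot> diagonal C pr (Dom C f) = diagonal C pr (Cod C f) \<cdot> f"
  by (rule product_ext[of "Cod C f" "Cod C f"]) (use assms in auto)

lemma cat_functor_square: "cat_functor C C (square_func C pr)"
  by unfold_locales (auto simp: in_Hom)

end

text \<open>A pair of slice arrows from \<open>w\<close> to \<open>f\<close> and \<open>g\<close>
  satisfies \<open>f \<cdot> u' = w = g \<cdot> v'\<close>, hence is a cone over the cospan of
  \<open>f\<close> and \<open>g\<close>; the mediating arrow commutes with the maps to
  \<open>i\<close> automatically.\<close>

lemma (in category) binary_products_slice:
  assumes pb: "pullbacks C pb"
  shows "binary_products (slice C i) (slice_products C pb)"
  unfolding binary_products_def
proof (intro ballI)
  fix f g assume "f \<in> Obj (slice C i)" "g \<in> Obj (slice C i)"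
  then have fg: "f \<in> Arr C" "Cod C f = i" "g \<in> Arr C" "Cod C g = i" by auto
  let ?t = "Leg1 pb f g" and ?s = "Leg2 pb f g"
  have "pullback_square C f ?t g ?s" using pb fg by (auto simp: pullbacks_def)
  then have t: "?t \<in> Arr C" "?s \<in> Arr C" "Cod C ?t = Dom C f" "Cod C ?s = Dom C g" "Dom C ?t = Dom C ?s"
    "f \<cdot> ?t = g \<cdot> ?s"
    and univ: "\<And>w u v. u \<in> Hom C w (Dom C f) \<Longrightarrow> v \<in> Hom C w (Dom C g) \<Longrightarrow> f \<cdot> u = g \<cdot> v \<Longrightarrow>
      \<exists>!h. h \<in> Hom C w (Dom C ?t) \<and> ?t \<cdot> h = u \<and> ?s \<cdot> h = v"
    unfolding pullback_square_def by blast+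
  let ?p = "(f \<cdot> ?t, ?t, f)" and ?q = "(f \<cdot> ?t, ?s, g)"
  have "\<exists>!h. h \<in> Hom (slice C i) w (f \<cdot> ?t) \<and> ?p \<cdot>\<^bsub>slice C i\<^esub> h = u \<and> ?q \<cdot>\<^bsub>slice C i\<^esub> h = v"
    if u: "u \<in> Hom (slice C i) w f" and v: "v \<in> Hom (slice C i) w g" for w u v
  proof -
    obtain u' v' where u': "u = (w, u', f)" "v = (w, v', g)" using u v by (cases u; cases v) (auto simp: in_Hom)
    have uv: "w \<in> Arr C" "Cod C w = i" "u' \<in> Arr C" "v' \<in> Arr C" "Dom C u' = Dom C w" "Dom C v' = Dom C w"
      "Cod C u' = Dom C f" "Cod C v' = Dom C g" "f \<cdot> u' = w" "g \<cdot> v' = w"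
      using u v unfolding u' by (simp_all add: in_Hom)
    have "u' \<in> Hom C (Dom C w) (Dom C f)" "v' \<in> Hom C (Dom C w) (Dom C g)" "f \<cdot> u' = g \<cdot> v'"
      using uv by (simp_all add: in_Hom)
    then obtain h where h: "h \<in> Hom C (Dom C w) (Dom C ?t)" "?t \<cdot> h = u'" "?s \<cdot> h = v'"
      and h_unique: "\<And>k. k \<in> Hom C (Dom C w) (Dom C ?t) \<Longrightarrow> ?t \<cdot> k = u' \<Longrightarrow> ?s \<cdot> k = v' \<Longrightarrow> k = h"
      using univ[of u' "Dom C w" v'] by blast
    show ?thesis
    proof (rule ex1I[of _ "(w, h, f \<cdot> ?t)"])
      show "(w, h, f \<cdot> ?t) \<in> Hom (slice C i) w (f \<cdot> ?t) \<and> ?p \<cdot>\<^bsub>slice C i\<^esub> (w, h, f \<cdot> ?t) = u \<and>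
          ?q \<cdot>\<^bsub>slice C i\<^esub> (w, h, f \<cdot> ?t) = v"
        using h uv fg t(1-5) unfolding u' by (simp add: in_Hom)
      show "k = (w, h, f \<cdot> ?t)" if k: "k \<in> Hom (slice C i) w (f \<cdot> ?t) \<and> ?p \<cdot>\<^bsub>slice C i\<^esub> k = u \<and>
          ?q \<cdot>\<^bsub>slice C i\<^esub> k = v" for k
      proof -
        obtain a k' b where k': "k = (a, k', b)" by (cases k)
        then show ?thesis using k h_unique[of k'] fg t(1-5) unfolding u' by (simp add: in_Hom)
      qed
    qed
  qed
  then show "product_span (slice C i) f g (Leg1 (slice_products C pb) f g) (Leg2 (slice_products C pb) f g)"
    using fg t(1-5) t(6)[symmetric] unfolding product_span_def by (simp add: slice_products_def)
qed

section \<open>The category of relations and its projection to the base\<close>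

lemma pullback_cat_simps [simp]:
  "(x, P) \<in> Obj (pullback_cat D A V G) \<longleftrightarrow> x \<in> Obj A \<and> P \<in> Obj D \<and> omap V P = omap G x"
  "(f, h) \<in> Arr (pullback_cat D A V G) \<longleftrightarrow> f \<in> Arr A \<and> h \<in> Arr D \<and> amap V h = amap G f"
  "Dom (pullback_cat D A V G) (f, h) = (Dom A f, Dom D h)"
  "Cod (pullback_cat D A V G) (f, h) = (Cod A f, Cod D h)"
  "Ide (pullback_cat D A V G) (x, P) = (Ide A x, Ide D P)"
  "(g, k) \<cdot>\<^bsub>pullback_cat D A V G\<^esub> (f, h) = (g \<cdot>\<^bsub>A\<^esub> f, k \<cdot>\<^bsub>D\<^esub> h)"
  by (simp_all add: pullback_cat_def)

lemma category_pullback_cat: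
  assumes "cat_functor D C V" "cat_functor A C G"
  shows "category (pullback_cat D A V G)"
proof -
  interpret V: cat_functor D C V by (rule assms)
  interpret G: cat_functor A C G by (rule assms)
  show ?thesis
  proof
    let ?R = "pullback_cat D A V G"
    fix a b c x y z w
    show "a \<in> Arr ?R \<Longrightarrow> Dom ?R a \<in> Obj ?R" by (cases a) (auto dest: arg_cong[of _ _ "Dom C"])
    show "a \<in> Arr ?R \<Longrightarrow> Cod ?R a \<in> Obj ?R" by (cases a) (auto dest: arg_cong[of _ _ "Cod C"])
    show "x \<in> Obj ?R \<Longrightarrow> Ide ?R x \<in> Hom ?R x x" by (cases x) (simp add: in_Hom)
    show "a \<in> Hom ?R x y \<Longrightarrow> b \<in> Hom ?R y z \<Longrightarrow> b \<cdot>\<^bsub>?R\<^esub> a \<in> Hom ?R x z"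
      by (cases a; cases b) (auto simp: in_Hom)
    show "a \<in> Hom ?R x y \<Longrightarrow> a \<cdot>\<^bsub>?R\<^esub> Ide ?R x = a" "a \<in> Hom ?R x y \<Longrightarrow> Ide ?R y \<cdot>\<^bsub>?R\<^esub> a = a"
      by (cases a; auto simp: in_Hom)+
    show "a \<in> Hom ?R w x \<Longrightarrow> b \<in> Hom ?R x y \<Longrightarrow> c \<in> Hom ?R y z \<Longrightarrow>
        c \<cdot>\<^bsub>?R\<^esub> (b \<cdot>\<^bsub>?R\<^esub> a) = (c \<cdot>\<^bsub>?R\<^esub> b) \<cdot>\<^bsub>?R\<^esub> a"
      by (cases a; cases b; cases c) (auto simp: in_Hom)
  qed
qed

locale relations = V: cat_functor D C V + C: category_with_products C pr
  for D :: "('do, 'dm) cat" and C :: "('co, 'cm) cat" and V and pr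
begin

abbreviation Rel :: "('co \<times> 'do, 'cm \<times> 'dm) cat" where "Rel \<equiv> Rel_cat D C V pr"

lemma Rel_simps [simp]:
  "(x, P) \<in> Obj Rel \<longleftrightarrow> x \<in> Obj C \<and> P \<in> Obj D \<and> omap V P = prod_obj C pr x x"
  "(f, h) \<in> Arr Rel \<longleftrightarrow> f \<in> Arr C \<and> h \<in> Arr D \<and> amap V h = C.sq f"
  "Dom Rel (f, h) = (Dom C f, Dom D h)"
  "Cod Rel (f, h) = (Cod C f, Cod D h)"
  "Ide Rel (x, P) = (Ide C x, Ide D P)"
  "(g, k) \<cdot>\<^bsub>Rel\<^esub> (f, h) = (g \<cdot>\<^bsub>C\<^esub> f, k \<cdot>\<^bsub>D\<^esub> h)"
  by (simp_all add: Rel_cat_def)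

lemma category_Rel: "category Rel"
  unfolding Rel_cat_def using V.cat_functor_axioms C.cat_functor_square by (rule category_pullback_cat)

lemma Rel_func_simps [simp]: "omap Rel_func (x, P) = x" "amap Rel_func (f, h) = f"
  by (simp_all add: Rel_func_def)

lemma cat_functor_Rel_func: "cat_functor Rel C Rel_func"
proof (intro cat_functor.intro cat_functor_axioms.intro category_Rel V.tgt.category_axioms)
  fix a b x y z
  show "x \<in> Obj Rel \<Longrightarrow> omap Rel_func x \<in> Obj C" by (cases x) simp
  show "a \<in> Hom Rel x y \<Longrightarrow> amap Rel_func a \<in> Hom C (omap Rel_func x) (omap Rel_func y)"
    by (cases a) (auto simp: in_Hom)
  show "x \<in> Obj Rel \<Longrightarrow> amap Rel_func (Ide Rel x) = Ide C (omap Rel_func x)" by (cases x) simp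
  show "a \<in> Hom Rel x y \<Longrightarrow> b \<in> Hom Rel y z \<Longrightarrow>
      amap Rel_func (b \<cdot>\<^bsub>Rel\<^esub> a) = amap Rel_func b \<cdot>\<^bsub>C\<^esub> amap Rel_func a"
    by (cases a; cases b) auto
qed

text \<open>Change of base: a cartesian lifting of \<open>f\<close> is \<open>f\<close> paired with
  a cartesian lifting of \<open>f \<times> f\<close> along \<open>V\<close>.\<close>

lemma fibration_Rel_func:
  assumes "fibration D C V"
  shows "fibration Rel C Rel_func"
proof -
  interpret p: cat_functor Rel C Rel_func by (rule cat_functor_Rel_func)
  have "\<exists>h. cartesian Rel C Rel_func h \<and> Cod Rel h = R \<and> amap Rel_func h = f"
    if f: "f \<in> Arr C" and R: "R \<in> Obj Rel" and e: "omap Rel_func R = Cod C f" for f R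
  proof -
    obtain P where P: "R = (Cod C f, P)" "P \<in> Obj D" "omap V P = prod_obj C pr (Cod C f) (Cod C f)"
      using R e by (cases R) auto
    obtain c where c: "cartesian D C V c" "Cod D c = P" "amap V c = C.sq f"
      using assms P f unfolding fibration_def by (metis C.square_simps(2,4))
    have cA: "c \<in> Arr D" using c(1) by (simp add: cartesian_def)
    have o: "omap V (Dom D c) = prod_obj C pr (Dom C f) (Dom C f)"
      using V.Dom_amap[OF cA] c(3) f by simp
    have "cartesian Rel C Rel_func (f, c)"
    proof (rule p.cartesianI)
      show "(f, c) \<in> Arr Rel" using f c cA by simp
    next
      fix k g
      assume k: "k \<in> Arr Rel" "Cod Rel k = Cod Rel (f, c)" and g: "g \<in> Arr C"
        "Dom C g = omap Rel_func (Dom Rel k)" "Cod C g = omap Rel_func (Dom Rel (f, c))"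
        "amap Rel_func (f, c) \<cdot>\<^bsub>C\<^esub> g = amap Rel_func k"
      obtain k' where k': "k = (f \<cdot>\<^bsub>C\<^esub> g, k')" using g(4) by (cases k) simp
      have kA: "k' \<in> Arr D" "amap V k' = C.sq f \<cdot>\<^bsub>C\<^esub> C.sq g" "Cod D k' = Cod D c"
        using k g f unfolding k' by auto
      have "omap V (Dom D k') = prod_obj C pr (Dom C g) (Dom C g)"
        using V.Dom_amap[OF kA(1)] kA(2) g f by simp
      then obtain l where l: "l \<in> Arr D" "Dom D l = Dom D k'" "Cod D l = Dom D c" "amap V l = C.sq g"
        "c \<cdot>\<^bsub>D\<^esub> l = k'"
        using V.cartesian_factor[OF c(1), of k' "C.sq g"] kA g f c o by auto
      then show "\<exists>l. l \<in> Arr Rel \<and> Dom Rel l = Dom Rel k \<and> Cod Rel l = Dom Rel (f, c) \<and>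
          amap Rel_func l = g \<and> (f, c) \<cdot>\<^bsub>Rel\<^esub> l = k"
        using g f k' by (intro exI[of _ "(g, l)"]) simp
    next
      fix l l'
      assume "l \<in> Arr Rel" "l' \<in> Arr Rel" "Dom Rel l = Dom Rel l'" "Cod Rel l = Dom Rel (f, c)"
        "Cod Rel l' = Dom Rel (f, c)" "amap Rel_func l = amap Rel_func l'"
        "(f, c) \<cdot>\<^bsub>Rel\<^esub> l = (f, c) \<cdot>\<^bsub>Rel\<^esub> l'"
      moreover obtain g m g' m' where "l = (g, m)" "l' = (g', m')" by (cases l; cases l')
      moreover from calculation have "m = m'"
        by - (rule V.cartesian_cancel[OF c(1)], auto)
      ultimately show "l = l'" by simp
    qed
    then show ?thesis using P c by (intro exI[of _ "(f, c)"]) simp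
  qed
  then show ?thesis using p.cat_functor_axioms unfolding fibration_def by blast
qed

end

section \<open>The equality functor of an opfibration with a section \<open>K\<close>\<close>

locale equality = relations D C V pr + K: cat_functor C D K
  for D :: "('do, 'dm) cat" and C :: "('co, 'cm) cat" and V and pr and K +
  assumes opfib: "opfibration D C V"
    and V_K: "func_eq C (V \<circ>\<^sub>F K) id_func"
begin

lemma V_K_simps [simp]: "x \<in> Obj C \<Longrightarrow> omap V (omap K x) = x" "f \<in> Arr C \<Longrightarrow> amap V (amap K f) = f"
  using V_K by (auto simp: func_eq_def comp_func_def id_func_def)

text \<open>The reflexivity map from \<open>K x\<close> to the equality object. Together with
  \<open>eqo\<close> and \<open>eqa\<close> it isolates the \<open>D\<close>-components of
  \<open>Eq_func\<close>; the components in \<open>C\<close> are the given object and arrow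
  themselves.\<close>

definition refl :: "'co \<Rightarrow> 'dm" where
  "refl x = opcart_lift D C V (diagonal C pr x) (omap K x)"

definition eqo :: "'co \<Rightarrow> 'do" where "eqo x = Cod D (refl x)"

lemma refl:
  assumes "x \<in> Obj C"
  shows refl_opcartesian: "opcartesian D C V (refl x)"
    and refl_simps [simp]: "refl x \<in> Arr D" "Dom D (refl x) = omap K x" "Cod D (refl x) = eqo x"
      "amap V (refl x) = diagonal C pr x" "eqo x \<in> Obj D" "omap V (eqo x) = prod_obj C pr x x"
proof -
  have "diagonal C pr x \<in> Arr C" "omap K x \<in> Obj D" "omap V (omap K x) = Dom C (diagonal C pr x)"
    using assms by simp_all
  note l = opcart_lift[OF opfib this, folded refl_def]
  show "opcartesian D C V (refl x)" "refl x \<in> Arr D" "Dom D (refl x) = omap K x"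
    "Cod D (refl x) = eqo x" "amap V (refl x) = diagonal C pr x" "eqo x \<in> Obj D"
    "omap V (eqo x) = prod_obj C pr x x"
    using l assms by (simp_all add: eqo_def)
qed

definition eqa :: "'cm \<Rightarrow> 'dm" where "eqa f = snd (amap (Eq_func D C V pr K) f)"

lemma Eq_func_simps: "omap (Eq_func D C V pr K) x = (x, eqo x)" "amap (Eq_func D C V pr K) f = (f, eqa f)"
  by (simp_all add: Eq_func_def eqa_def eqo_def refl_def opreindex_def)

text \<open>Naturality of the diagonal makes the base condition hold, so opcartesianness of
  \<open>refl\<close> yields the unique arrow that the definite description in
  \<open>Eq_func\<close> asks for.\<close>

lemma eqa:
  assumes f: "f \<in> Arr C"
  shows eqa_simps [simp]: "eqa f \<in> Arr D" "Dom D (eqa f) = eqo (Dom C f)" "Cod D (eqa f) = eqo (Cod C f)"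
      "amap V (eqa f) = C.sq f"
    and eqa_refl: "eqa f \<cdot>\<^bsub>D\<^esub> refl (Dom C f) = refl (Cod C f) \<cdot>\<^bsub>D\<^esub> amap K f"
proof -
  have "\<exists>!h. h \<in> Hom D (eqo (Dom C f)) (eqo (Cod C f)) \<and> amap V h = C.sq f \<and>
      h \<cdot>\<^bsub>D\<^esub> refl (Dom C f) = refl (Cod C f) \<cdot>\<^bsub>D\<^esub> amap K f"
  proof (rule ex_ex1I)
    show "\<exists>h. h \<in> Hom D (eqo (Dom C f)) (eqo (Cod C f)) \<and> amap V h = C.sq f \<and>
      h \<cdot>\<^bsub>D\<^esub> refl (Dom C f) = refl (Cod C f) \<cdot>\<^bsub>D\<^esub> amap K f"
      using V.opcartesian_factor[OF refl_opcartesian[of "Dom C f"], of "refl (Cod C f) \<cdot>\<^bsub>D\<^esub> amap K f" "C.sq f"]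
        f C.diagonal_natural[OF f] by (auto simp: in_Hom)
    show "h = h'" if "h \<in> Hom D (eqo (Dom C f)) (eqo (Cod C f)) \<and> amap V h = C.sq f \<and>
        h \<cdot>\<^bsub>D\<^esub> refl (Dom C f) = refl (Cod C f) \<cdot>\<^bsub>D\<^esub> amap K f"
      "h' \<in> Hom D (eqo (Dom C f)) (eqo (Cod C f)) \<and> amap V h' = C.sq f \<and>
        h' \<cdot>\<^bsub>D\<^esub> refl (Dom C f) = refl (Cod C f) \<cdot>\<^bsub>D\<^esub> amap K f" for h h'
      by (rule V.opcartesian_cancel[OF refl_opcartesian[of "Dom C f"]]) (use that f in \<open>auto simp: in_Hom\<close>)
  qed
  from theI'[OF this] have "eqa f \<in> Hom D (eqo (Dom C f)) (eqo (Cod C f)) \<and> amap V (eqa f) = C.sq f \<and>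
      eqa f \<cdot>\<^bsub>D\<^esub> refl (Dom C f) = refl (Cod C f) \<cdot>\<^bsub>D\<^esub> amap K f"
    by (simp add: eqa_def Eq_func_def eqo_def refl_def opreindex_def)
  then show "eqa f \<in> Arr D" "Dom D (eqa f) = eqo (Dom C f)" "Cod D (eqa f) = eqo (Cod C f)"
      "amap V (eqa f) = C.sq f" "eqa f \<cdot>\<^bsub>D\<^esub> refl (Dom C f) = refl (Cod C f) \<cdot>\<^bsub>D\<^esub> amap K f"
    by (auto simp: in_Hom)
qed

lemma eqa_Ide: "x \<in> Obj C \<Longrightarrow> eqa (Ide C x) = Ide D (eqo x)"
  by (rule V.opcartesian_cancel[OF refl_opcartesian[of x]]) (use eqa_refl[of "Ide C x"] in auto)

lemma eqa_Cmp:
  assumes fg: "f \<in> Arr C" "g \<in> Arr C" "Cod C f = Dom C g"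
  shows "eqa (g \<cdot>\<^bsub>C\<^esub> f) = eqa g \<cdot>\<^bsub>D\<^esub> eqa f"
proof (rule V.opcartesian_cancel[OF refl_opcartesian[of "Dom C f"]])
  have "eqa g \<cdot>\<^bsub>D\<^esub> (eqa f \<cdot>\<^bsub>D\<^esub> refl (Dom C f)) = eqa g \<cdot>\<^bsub>D\<^esub> (refl (Dom C g) \<cdot>\<^bsub>D\<^esub> amap K f)"
    using fg by (simp add: eqa_refl)
  also have "\<dots> = refl (Cod C g) \<cdot>\<^bsub>D\<^esub> (amap K g \<cdot>\<^bsub>D\<^esub> amap K f)"
    using fg V.src.Cmp_eq_extend[OF eqa_refl[OF fg(2)], of "amap K f"] by simp
  finally show "eqa (g \<cdot>\<^bsub>C\<^esub> f) \<cdot>\<^bsub>D\<^esub> refl (Dom C f) = (eqa g \<cdot>\<^bsub>D\<^esub> eqa f) \<cdot>\<^bsub>D\<^esub> refl (Dom C f)"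
    using fg eqa_refl[of "g \<cdot>\<^bsub>C\<^esub> f"] by simp
qed (use fg in auto)

lemma cat_functor_Eq: "cat_functor C Rel (Eq_func D C V pr K)"
  by (intro cat_functor.intro cat_functor_axioms.intro category_Rel V.tgt.category_axioms)
    (auto simp: Eq_func_simps in_Hom eqa_Ide eqa_Cmp)

lemma Rel_func_Eq: "func_eq C (Rel_func \<circ>\<^sub>F Eq_func D C V pr K) id_func"
  by (auto simp: func_eq_def comp_func_def id_func_def Eq_func_simps)

end

section \<open>Beck-Chevalley, truth and quotients\<close>

text \<open>The Beck-Chevalley condition in a form independent of the chosen liftings.\<close>

lemma beck_chevalley_cartesian:
  assumes bif: "bifibration E B U" and bc: "beck_chevalley E B U" and sq: "pullback_square B f t g s"
    and c: "cartesian E B U c" "amap U c = t"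
    and o: "opcartesian E B U o1" "Dom E o1 = Cod E c" "amap U o1 = f"
    and o': "opcartesian E B U o2" "Dom E o2 = Dom E c" "amap U o2 = s"
    and n: "n \<in> Arr E" "Dom E n = Cod E o2" "Cod E n = Cod E o1" "amap U n = g"
      "n \<cdot>\<^bsub>E\<^esub> o2 = o1 \<cdot>\<^bsub>E\<^esub> c"
  shows "cartesian E B U n"
proof -
  have fib: "fibration E B U" and opfib: "opfibration E B U" using bif by (simp_all add: bifibration_def)
  interpret U: cat_functor E B U using fib by (simp add: fibration_def)
  have b: "f \<in> Arr B" "t \<in> Arr B" "g \<in> Arr B" "s \<in> Arr B" "Cod B f = Cod B g" "Cod B t = Dom B f"
    "Cod B s = Dom B g" "Dom B t = Dom B s" "f \<cdot>\<^bsub>B\<^esub> t = g \<cdot>\<^bsub>B\<^esub> s"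
    using sq by (simp_all add: pullback_square_def)
  have A: "c \<in> Arr E" "o1 \<in> Arr E" "o2 \<in> Arr E" using c o o' by (simp_all add: cartesian_def opcartesian_def)
  let ?P = "Cod E c"
  have P: "?P \<in> Obj E" "omap U ?P = Dom B f" using A(1) U.Cod_amap[OF A(1)] c(2) b by simp_all
  let ?O = "opcart_lift E B U f ?P" and ?C = "cart_lift E B U t ?P"
  note O = opcart_lift[OF opfib b(1) P]
  have Pt: "omap U ?P = Cod B t" using P b by simp
  note C = cart_lift[OF fib b(2) P(1) Pt]
  have "Dom E ?C \<in> Obj E" "omap U (Dom E ?C) = Dom B s" using C b by simp_all
  note O' = opcart_lift[OF opfib b(4) this]
  let ?O' = "opcart_lift E B U s (Dom E ?C)"
  have "Cod E ?O \<in> Obj E" "omap U (Cod E ?O) = Cod B g" using O b by simp_all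
  note G = cart_lift[OF fib b(3) this]
  let ?G = "cart_lift E B U g (Cod E ?O)"
  let ?m = "bc_map E B U f t g s ?P"
  \<comment> \<open>This makes the description in \<open>bc_map\<close> meaningful: the composite
    over \<open>f \<cdot> t\<close> factors through the opcartesian \<open>?O'\<close>, and the
    result through the cartesian \<open>?G\<close>; cancelling at both ends gives
    uniqueness.\<close>
  have "\<exists>!m. m \<in> Hom (fibre E B U (Dom B g)) (opreindex E B U s (reindex E B U t ?P))
        (reindex E B U g (opreindex E B U f ?P)) \<and>
        cart_lift E B U g (opreindex E B U f ?P) \<cdot>\<^bsub>E\<^esub> (m \<cdot>\<^bsub>E\<^esub> opcart_lift E B U s (reindex E B U t ?P)) =
        opcart_lift E B U f ?P \<cdot>\<^bsub>E\<^esub> cart_lift E B U t ?P" (is "\<exists>!m. ?Q m")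
  proof (rule ex_ex1I)
    obtain l where l: "l \<in> Arr E" "Dom E l = Cod E ?O'" "Cod E l = Cod E ?O" "amap U l = g"
      "l \<cdot>\<^bsub>E\<^esub> ?O' = ?O \<cdot>\<^bsub>E\<^esub> ?C"
      using U.opcartesian_factor[OF O'(1), of "?O \<cdot>\<^bsub>E\<^esub> ?C" g] O C O' b by auto
    obtain m where "m \<in> Arr E" "Dom E m = Dom E l" "Cod E m = Dom E ?G" "amap U m = Ide B (Dom B g)"
      "?G \<cdot>\<^bsub>E\<^esub> m = l"
      using U.cartesian_factor[OF G(1), of l "Ide B (Dom B g)"] l G O' b by auto
    then have "?Q m" using l G O' b U.src.Cmp_Cmp[of ?O' m ?G]
      by (simp add: in_Hom fibre_def opreindex_def reindex_def)
    then show "\<exists>m. ?Q m" by blast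
  next
    fix m m' assume "?Q m" "?Q m'"
    then have m: "m \<in> Arr E" "m' \<in> Arr E" "Dom E m = Cod E ?O'" "Dom E m' = Cod E ?O'"
      "Cod E m = Dom E ?G" "Cod E m' = Dom E ?G" "amap U m = Ide B (Dom B g)" "amap U m' = Ide B (Dom B g)"
      "?G \<cdot>\<^bsub>E\<^esub> (m \<cdot>\<^bsub>E\<^esub> ?O') = ?O \<cdot>\<^bsub>E\<^esub> ?C" "?G \<cdot>\<^bsub>E\<^esub> (m' \<cdot>\<^bsub>E\<^esub> ?O') = ?O \<cdot>\<^bsub>E\<^esub> ?C"
      by (simp_all add: in_Hom fibre_def opreindex_def reindex_def)
    have "m \<cdot>\<^bsub>E\<^esub> ?O' = m' \<cdot>\<^bsub>E\<^esub> ?O'"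
      by (rule U.cartesian_cancel[OF G(1)]) (use m O' in simp_all)
    then show "m = m'"
      by (intro U.opcartesian_cancel[OF O'(1), of m m']) (use m in simp_all)
  qed
  from theI'[OF this] have "?m \<in> Hom (fibre E B U (Dom B g)) (Cod E ?O') (Dom E ?G)"
    and meq: "?G \<cdot>\<^bsub>E\<^esub> (?m \<cdot>\<^bsub>E\<^esub> ?O') = ?O \<cdot>\<^bsub>E\<^esub> ?C"
    unfolding bc_map_def reindex_def opreindex_def by auto
  then have m: "?m \<in> Arr E" "Dom E ?m = Cod E ?O'" "Cod E ?m = Dom E ?G" "amap U ?m = Ide B (Dom B g)"
    by (simp_all add: in_Hom fibre_def)
  have "iso (fibre E B U (Dom B g)) ?m"
    using bc sq P unfolding beck_chevalley_def by (simp add: fibre_def)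
  then obtain m' where m': "m' \<in> Arr E" "Dom E m' = Cod E ?m" "Cod E m' = Dom E ?m"
    "m' \<cdot>\<^bsub>E\<^esub> ?m = Ide E (Dom E ?m)" "?m \<cdot>\<^bsub>E\<^esub> m' = Ide E (Cod E ?m)"
    unfolding iso_def by (auto simp: fibre_def in_Hom)
  have m_cart: "cartesian E B U ?m" by (rule U.cartesian_iso[OF m(1) m'])
  \<comment> \<open>The isomorphisms \<open>a\<close>, \<open>r\<close> and \<open>d\<close> relate
    the given liftings \<open>o1\<close>, \<open>c\<close> and \<open>o2\<close> to the chosen
    ones.\<close>
  obtain a a' where a: "a \<in> Arr E" "Dom E a = Cod E ?O" "Cod E a = Cod E o1"
    "a' \<in> Arr E" "Dom E a' = Cod E o1" "Cod E a' = Cod E ?O" "a \<cdot>\<^bsub>E\<^esub> ?O = o1"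
    "a' \<cdot>\<^bsub>E\<^esub> a = Ide E (Cod E ?O)" "a \<cdot>\<^bsub>E\<^esub> a' = Ide E (Cod E o1)" "amap U a = Ide B (omap U (Cod E ?O))"
    using U.opcartesian_comparison[OF O(1) o(1)] O o by auto
  obtain r r' where r: "r \<in> Arr E" "Dom E r = Dom E c" "Cod E r = Dom E ?C" "r' \<in> Arr E"
    "Dom E r' = Dom E ?C" "Cod E r' = Dom E c" "?C \<cdot>\<^bsub>E\<^esub> r = c" "r' \<cdot>\<^bsub>E\<^esub> r = Ide E (Dom E c)"
    "r \<cdot>\<^bsub>E\<^esub> r' = Ide E (Dom E ?C)" "amap U r = Ide B (omap U (Dom E ?C))"
    using U.cartesian_comparison[OF C(1) c(1)] C c by auto
  \<comment> \<open>\<open>o2\<close> starts at the domain of \<open>c\<close>, not at the chosen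
    reindexing, so it can be compared with \<open>?O'\<close> only after \<open>?O'\<close> has been
    precomposed with \<open>r\<close>.\<close>
  have "opcartesian E B U r" by (rule U.opcartesian_iso[of r r']) (use r in simp_all)
  then have Or: "opcartesian E B U (?O' \<cdot>\<^bsub>E\<^esub> r)"
    using O'(1) by (rule U.opcartesian_Cmp) (use O' r in simp_all)
  have "amap U (?O' \<cdot>\<^bsub>E\<^esub> r) = s" using O' r C b by simp
  then obtain d d' where d: "d \<in> Arr E" "Dom E d = Cod E o2" "Cod E d = Cod E ?O'"
    "d' \<in> Arr E" "Dom E d' = Cod E ?O'" "Cod E d' = Cod E o2" "d \<cdot>\<^bsub>E\<^esub> o2 = ?O' \<cdot>\<^bsub>E\<^esub> r"
    "d' \<cdot>\<^bsub>E\<^esub> d = Ide E (Cod E o2)" "d \<cdot>\<^bsub>E\<^esub> d' = Ide E (Cod E ?O')" "amap U d = Ide B (omap U (Cod E o2))"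
    using U.opcartesian_comparison[OF o'(1) Or] O' o' r by auto
  have d_cart: "cartesian E B U d" by (rule U.cartesian_iso[of d d']) (use d in simp_all)
  have a_cart: "cartesian E B U a" by (rule U.cartesian_iso[of a a']) (use a in simp_all)
  have o2_cod: "omap U (Cod E o2) = Dom B g" using U.Cod_amap[OF A(3)] o' b by simp
  \<comment> \<open>This composite agrees with \<open>n\<close> after the opcartesian
    \<open>o2\<close>, so it is \<open>n\<close>; its factors are the cartesian \<open>?G\<close>
    and three isomorphisms, of which \<open>?m\<close> is one by Beck-Chevalley.\<close>
  let ?n = "a \<cdot>\<^bsub>E\<^esub> (?G \<cdot>\<^bsub>E\<^esub> (?m \<cdot>\<^bsub>E\<^esub> d))"
  have n': "?n \<in> Arr E" "Dom E ?n = Cod E o2" "Cod E ?n = Cod E o1" "amap U ?n = g"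
    using a G m d o2_cod b O by simp_all
  have "?n \<cdot>\<^bsub>E\<^esub> o2 = a \<cdot>\<^bsub>E\<^esub> (?G \<cdot>\<^bsub>E\<^esub> (?m \<cdot>\<^bsub>E\<^esub> (?O' \<cdot>\<^bsub>E\<^esub> r)))"
    using a(1-3) G m d A by simp
  also have "\<dots> = a \<cdot>\<^bsub>E\<^esub> ((?G \<cdot>\<^bsub>E\<^esub> (?m \<cdot>\<^bsub>E\<^esub> ?O')) \<cdot>\<^bsub>E\<^esub> r)"
    using a(1-3) G m O' r(1-3) by simp
  also have "\<dots> = (a \<cdot>\<^bsub>E\<^esub> ?O) \<cdot>\<^bsub>E\<^esub> (?C \<cdot>\<^bsub>E\<^esub> r)"
    unfolding meq using a(1-3) O C r(1-3) by simp
  also have "\<dots> = n \<cdot>\<^bsub>E\<^esub> o2" using a r n by simp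
  finally have "?n = n"
    using n n' by (intro U.opcartesian_cancel[OF o'(1), of ?n n]) simp_all
  moreover have "cartesian E B U ?n"
    by (intro U.cartesian_Cmp d_cart m_cart G(1) a_cart) (use a G m d in simp_all)
  ultimately show ?thesis by simp
qed

text \<open>Both arrows factor through the cartesian lifting of their common base, and the factors
  are vertical arrows into a reindexed truth object, which is terminal in its fibre.\<close>

lemma truth_unique:
  assumes K: "truth_functor E B U K" and fib: "fibration E B U"
    and uv: "u \<in> Arr E" "v \<in> Arr E" "Dom E u = Dom E v" "Cod E u = omap K y" "Cod E v = omap K y"
      "y \<in> Obj B" "amap U u = amap U v"
  shows "u = v"
proof -
  interpret U: cat_functor E B U using fib by (simp add: fibration_def)
  interpret K: cat_functor B E K using K by (simp add: truth_functor_def)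
  have [simp]: "omap U (omap K y) = y" using K uv
    by (auto simp: truth_functor_def func_eq_def comp_func_def id_func_def)
  let ?b = "amap U u"
  have b: "?b \<in> Arr B" "Cod B ?b = y" using uv by simp_all
  let ?C = "cart_lift E B U ?b (omap K y)"
  have "omap K y \<in> Obj E" "omap U (omap K y) = Cod B ?b" using uv by simp_all
  note C = cart_lift[OF fib b(1) this]
  have trm: "terminal (fibre E B U (Dom B ?b)) (Dom E ?C)"
    using K b unfolding truth_functor_def reindex_def by metis
  have "\<exists>l. l \<in> Arr E \<and> Dom E l = Dom E w \<and> Cod E l = Dom E ?C \<and> amap U l = Ide B (Dom B ?b) \<and> ?C \<cdot>\<^bsub>E\<^esub> l = w"
    if "w = u \<or> w = v" for w
    by (rule U.cartesian_factor[OF C(1)]) (use C uv that in auto)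
  then obtain u' v' where u': "u' \<in> Arr E" "Dom E u' = Dom E u" "Cod E u' = Dom E ?C"
      "amap U u' = Ide B (Dom B ?b)" "?C \<cdot>\<^bsub>E\<^esub> u' = u"
    and v': "v' \<in> Arr E" "Dom E v' = Dom E u" "Cod E v' = Dom E ?C"
      "amap U v' = Ide B (Dom B ?b)" "?C \<cdot>\<^bsub>E\<^esub> v' = v"
    using uv(3) by metis
  have "Dom E u \<in> Obj (fibre E B U (Dom B ?b))" using uv by (simp add: fibre_def)
  then have "\<exists>!h. h \<in> Hom (fibre E B U (Dom B ?b)) (Dom E u) (Dom E ?C)"
    using trm unfolding terminal_def by blast
  moreover have "u' \<in> Hom (fibre E B U (Dom B ?b)) (Dom E u) (Dom E ?C)"
    "v' \<in> Hom (fibre E B U (Dom B ?b)) (Dom E u) (Dom E ?C)"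
    using u' v' C uv by (simp_all add: in_Hom fibre_def)
  ultimately have "u' = v'" by blast
  then show ?thesis using u' v' by simp
qed

lemma left_adjoint_universal_arrow:
  assumes adj: "has_left_adjoint C D G" and G: "cat_functor C D G" and d: "d \<in> Obj D"
  shows "\<exists>q \<eta>. q \<in> Obj C \<and> \<eta> \<in> Hom D d (omap G q) \<and>
    (\<forall>x\<in>Obj C. \<forall>h\<in>Hom D d (omap G x). \<exists>!k. k \<in> Hom C q x \<and> amap G k \<cdot>\<^bsub>D\<^esub> \<eta> = h)"
proof -
  interpret G: cat_functor C D G by (rule G)
  obtain L \<eta> \<epsilon> where L: "cat_functor D C L" and \<eta>: "nat_trans D D id_func (G \<circ>\<^sub>F L) \<eta>"
    and \<epsilon>: "nat_trans C C (L \<circ>\<^sub>F G) id_func \<epsilon>"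
    and t1: "\<forall>d\<in>Obj D. \<epsilon> (omap L d) \<cdot>\<^bsub>C\<^esub> amap L (\<eta> d) = Ide C (omap L d)"
    and t2: "\<forall>c\<in>Obj C. amap G (\<epsilon> c) \<cdot>\<^bsub>D\<^esub> \<eta> (omap G c) = Ide D (omap G c)"
    using adj unfolding has_left_adjoint_def by blast
  interpret L: cat_functor D C L by (rule L)
  have \<eta>s [simp]: "y \<in> Obj D \<Longrightarrow> \<eta> y \<in> Arr D" "y \<in> Obj D \<Longrightarrow> Dom D (\<eta> y) = y"
    "y \<in> Obj D \<Longrightarrow> Cod D (\<eta> y) = omap G (omap L y)"
    and \<eta>n: "u \<in> Arr D \<Longrightarrow> amap G (amap L u) \<cdot>\<^bsub>D\<^esub> \<eta> (Dom D u) = \<eta> (Cod D u) \<cdot>\<^bsub>D\<^esub> u" for y u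
    using \<eta> by (auto simp: nat_trans_def comp_func_def id_func_def in_Hom)
  have \<epsilon>s [simp]: "x \<in> Obj C \<Longrightarrow> \<epsilon> x \<in> Arr C" "x \<in> Obj C \<Longrightarrow> Dom C (\<epsilon> x) = omap L (omap G x)"
    "x \<in> Obj C \<Longrightarrow> Cod C (\<epsilon> x) = x"
    and \<epsilon>n: "u \<in> Arr C \<Longrightarrow> u \<cdot>\<^bsub>C\<^esub> \<epsilon> (Dom C u) = \<epsilon> (Cod C u) \<cdot>\<^bsub>C\<^esub> amap L (amap G u)" for x u
    using \<epsilon> by (auto simp: nat_trans_def comp_func_def id_func_def in_Hom)
  have "\<exists>!k. k \<in> Hom C (omap L d) x \<and> amap G k \<cdot>\<^bsub>D\<^esub> \<eta> d = h"
    if x: "x \<in> Obj C" and h: "h \<in> Hom D d (omap G x)" for x h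
  proof (rule ex1I[of _ "\<epsilon> x \<cdot>\<^bsub>C\<^esub> amap L h"])
    have h: "h \<in> Arr D" "Dom D h = d" "Cod D h = omap G x" using h by (auto simp: in_Hom)
    have "amap G (\<epsilon> x) \<cdot>\<^bsub>D\<^esub> (\<eta> (omap G x) \<cdot>\<^bsub>D\<^esub> h) = h"
      using G.tgt.Cmp_eq_extend[OF t2[rule_format, OF x], of h] x h by simp
    then show "\<epsilon> x \<cdot>\<^bsub>C\<^esub> amap L h \<in> Hom C (omap L d) x \<and> amap G (\<epsilon> x \<cdot>\<^bsub>C\<^esub> amap L h) \<cdot>\<^bsub>D\<^esub> \<eta> d = h"
      using x h d \<eta>n[of h] by (auto simp: in_Hom)
    fix k assume k: "k \<in> Hom C (omap L d) x \<and> amap G k \<cdot>\<^bsub>D\<^esub> \<eta> d = h"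
    then have k': "k \<in> Arr C" "Dom C k = omap L d" "Cod C k = x" "h = amap G k \<cdot>\<^bsub>D\<^esub> \<eta> d" by (auto simp: in_Hom)
    have "\<epsilon> x \<cdot>\<^bsub>C\<^esub> amap L h = \<epsilon> x \<cdot>\<^bsub>C\<^esub> (amap L (amap G k) \<cdot>\<^bsub>C\<^esub> amap L (\<eta> d))"
      using k' d by simp
    also have "\<dots> = k \<cdot>\<^bsub>C\<^esub> (\<epsilon> (omap L d) \<cdot>\<^bsub>C\<^esub> amap L (\<eta> d))"
      using G.src.Cmp_eq_extend[OF \<epsilon>n[OF k'(1), symmetric], of "amap L (\<eta> d)"] k' d x by simp
    finally show "k = \<epsilon> x \<cdot>\<^bsub>C\<^esub> amap L h" using t1 k' d by simp
  qed
  then show ?thesis using d by (intro exI[of _ "omap L d"] exI[of _ "\<eta> d"]) (auto simp: in_Hom)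
qed

text \<open>The quotient of the opreindexing of \<open>P\<close> along \<open>j\<close>, described
  without mentioning the opreindexing: arrows out of it over \<open>sq h\<close> are arrows out of
  \<open>P\<close> over \<open>sq h \<cdot> j\<close>. It is applied with \<open>j\<close> the
  inclusion of a kernel pair.\<close>

lemma (in equality) left_adjoint_universal_arrow_opreindex:
  assumes adj: "has_left_adjoint C Rel (Eq_func D C V pr K)"
    and x: "x \<in> Obj C" and j: "j \<in> Arr C" "Cod C j = prod_obj C pr x x"
    and P: "P \<in> Obj D" "omap V P = Dom C j"
  shows "\<exists>q \<rho> \<tau>. \<rho> \<in> Arr C \<and> Dom C \<rho> = x \<and> Cod C \<rho> = q \<and> \<tau> \<in> Arr D \<and> Dom D \<tau> = P \<and>
    Cod D \<tau> = eqo q \<and> amap V \<tau> = C.sq \<rho> \<cdot>\<^bsub>C\<^esub> j \<and>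
    (\<forall>h z. h \<in> Arr C \<longrightarrow> Dom C h = x \<longrightarrow> z \<in> Arr D \<longrightarrow> Dom D z = P \<longrightarrow> Cod D z = eqo (Cod C h) \<longrightarrow>
      amap V z = C.sq h \<cdot>\<^bsub>C\<^esub> j \<longrightarrow>
      (\<exists>!k. k \<in> Hom C q (Cod C h) \<and> k \<cdot>\<^bsub>C\<^esub> \<rho> = h \<and> eqa k \<cdot>\<^bsub>D\<^esub> \<tau> = z))"
proof -
  let ?\<sigma> = "opcart_lift D C V j P"
  note \<sigma> = opcart_lift[OF opfib j(1) P]
  have "(x, Cod D ?\<sigma>) \<in> Obj Rel" using \<sigma> j x by simp
  from left_adjoint_universal_arrow[OF adj cat_functor_Eq this]
  obtain q \<eta> where q: "q \<in> Obj C" and \<eta>: "\<eta> \<in> Hom Rel (x, Cod D ?\<sigma>) (q, eqo q)"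
    and univ: "\<And>y h. y \<in> Obj C \<Longrightarrow> h \<in> Hom Rel (x, Cod D ?\<sigma>) (y, eqo y) \<Longrightarrow>
      \<exists>!k. k \<in> Hom C q y \<and> (k, eqa k) \<cdot>\<^bsub>Rel\<^esub> \<eta> = h"
    unfolding Eq_func_simps by blast
  obtain \<rho> t where \<eta>_def: "\<eta> = (\<rho>, t)" by (cases \<eta>)
  have \<rho>: "\<rho> \<in> Arr C" "Dom C \<rho> = x" "Cod C \<rho> = q"
    and t: "t \<in> Arr D" "Dom D t = Cod D ?\<sigma>" "Cod D t = eqo q" "amap V t = C.sq \<rho>"
    using \<eta> unfolding \<eta>_def by (simp_all add: in_Hom)
  have "\<exists>!k. k \<in> Hom C q (Cod C h) \<and> k \<cdot>\<^bsub>C\<^esub> \<rho> = h \<and> eqa k \<cdot>\<^bsub>D\<^esub> (t \<cdot>\<^bsub>D\<^esub> ?\<sigma>) = z"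
    if h: "h \<in> Arr C" "Dom C h = x" and z: "z \<in> Arr D" "Dom D z = P" "Cod D z = eqo (Cod C h)"
      "amap V z = C.sq h \<cdot>\<^bsub>C\<^esub> j" for h z
  proof -
    obtain z' where z': "z' \<in> Arr D" "Dom D z' = Cod D ?\<sigma>" "Cod D z' = eqo (Cod C h)" "amap V z' = C.sq h"
      "z' \<cdot>\<^bsub>D\<^esub> ?\<sigma> = z"
      using V.opcartesian_factor[OF \<sigma>(1), of z "C.sq h"] \<sigma> h z j by auto
    have "(h, z') \<in> Hom Rel (x, Cod D ?\<sigma>) (Cod C h, eqo (Cod C h))"
      using h z' by (simp add: in_Hom)
    from univ[OF _ this] have ex1: "\<exists>!k. k \<in> Hom C q (Cod C h) \<and> k \<cdot>\<^bsub>C\<^esub> \<rho> = h \<and> eqa k \<cdot>\<^bsub>D\<^esub> t = z'"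
      using h by (simp add: \<eta>_def)
    \<comment> \<open>Opcartesianness of \<open>?\<sigma>\<close> allows the equation to be tested
      after \<open>?\<sigma>\<close>; the bases agree because
      \<open>k \<cdot> \<rho> = h\<close>.\<close>
    have "eqa k \<cdot>\<^bsub>D\<^esub> (t \<cdot>\<^bsub>D\<^esub> ?\<sigma>) = z \<longleftrightarrow> eqa k \<cdot>\<^bsub>D\<^esub> t = z'"
      if k: "k \<in> Hom C q (Cod C h)" "k \<cdot>\<^bsub>C\<^esub> \<rho> = h" for k
    proof
      have k': "k \<in> Arr C" "Dom C k = q" "Cod C k = Cod C h" using k by (simp_all add: in_Hom)
      show "eqa k \<cdot>\<^bsub>D\<^esub> t = z'" if e: "eqa k \<cdot>\<^bsub>D\<^esub> (t \<cdot>\<^bsub>D\<^esub> ?\<sigma>) = z"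
      proof (rule V.opcartesian_cancel[OF \<sigma>(1)])
        have "C.sq k \<cdot>\<^bsub>C\<^esub> C.sq \<rho> = C.sq h" using k k' \<rho> by (simp flip: C.sq_Cmp)
        then show "amap V (eqa k \<cdot>\<^bsub>D\<^esub> t) = amap V z'" using k' t z' \<rho> by simp
      qed (use k' t z' \<sigma> e in simp_all)
      show "eqa k \<cdot>\<^bsub>D\<^esub> (t \<cdot>\<^bsub>D\<^esub> ?\<sigma>) = z" if e: "eqa k \<cdot>\<^bsub>D\<^esub> t = z'"
        using V.src.Cmp_eq_extend[OF e, of ?\<sigma>] k' t \<sigma> z' by simp
    qed
    then show ?thesis using ex1 by (metis (no_types, lifting))
  qed
  then show ?thesis
    using \<rho> t \<sigma> by (intro exI[of _ q] exI[of _ \<rho>] exI[of _ "t \<cdot>\<^bsub>D\<^esub> ?\<sigma>"]) simp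
qed

section \<open>Equality in a slice\<close>

locale indexed_equality =
  fixes E :: "('eo, 'em) cat" and B :: "('bo, 'bm) cat"
    and U :: "('eo, 'em, 'bo, 'bm) func" and K :: "('bo, 'bm, 'eo, 'em) func"
    and pr :: "('bo, 'bm) spans" and pb :: "('bm, 'bm) spans" and I :: 'bo
  assumes bif: "bifibration E B U"
    and bc: "beck_chevalley E B U"
    and prods: "binary_products B pr"
    and pbs: "pullbacks B pb"
    and truth: "truth_functor E B U K"
    and adj: "has_left_adjoint B (Rel_cat E B U pr) (Eq_func E B U pr K)"
    and I_Obj [simp]: "I \<in> Obj B"
begin

lemma fib: "fibration E B U" and opfib: "opfibration E B U"
  using bif by (simp_all add: bifibration_def)

lemma U_functor: "cat_functor E B U" using fib by (simp add: fibration_def)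

lemma K_functor: "cat_functor B E K" and U_K: "func_eq B (U \<circ>\<^sub>F K) id_func"
  using truth by (simp_all add: truth_functor_def)

sublocale T: equality E B U pr K
proof -
  interpret U: cat_functor E B U by (rule U_functor)
  interpret K: cat_functor B E K by (rule K_functor)
  show "equality E B U pr K" by unfold_locales (rule prods opfib U_K)+
qed

abbreviation EI :: "('em, 'em \<times> 'em \<times> 'em) cat" where "EI \<equiv> slice E (omap K I)"
abbreviation BI :: "('bm, 'bm \<times> 'bm \<times> 'bm) cat" where "BI \<equiv> slice B I"

lemma slice_U_functor: "cat_functor EI BI (slice_func U)"
  using T.V.cat_functor_slice[of "omap K I"] by simp

lemma slice_fib: "fibration EI BI (slice_func U)"
  using fibration_slice[OF fib, of "omap K I"] by simp

lemma slice_opfib: "opfibration EI BI (slice_func U)"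
  using opfibration_slice[OF opfib, of "omap K I"] by simp

text \<open>The theory of equality is instantiated twice: names with \<open>T\<close> refer to
  \<open>U\<close>, names with \<open>S\<close> to \<open>U/I\<close>, whose objects are arrows of
  \<open>E\<close> and \<open>B\<close>.\<close>

sublocale S: equality EI BI "slice_func U" "slice_products B pb" "slice_func K"
proof -
  interpret U: cat_functor EI BI "slice_func U" by (rule slice_U_functor)
  interpret K: cat_functor BI EI "slice_func K" by (rule T.K.cat_functor_slice)
  have "func_eq BI (slice_func U \<circ>\<^sub>F slice_func K) id_func"
    by (auto simp: func_eq_def comp_func_def id_func_def elim!: slice_Arr_cases)
  then show "equality EI BI (slice_func U) (slice_products B pb) (slice_func K)"
    by unfold_locales (rule T.V.tgt.binary_products_slice[OF pbs] slice_opfib | assumption)+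
qed

section \<open>Kernel pairs and their inclusion into the product\<close>

abbreviation p1 :: "'bm \<Rightarrow> 'bm" where "p1 f \<equiv> Leg1 pb f f"
abbreviation p2 :: "'bm \<Rightarrow> 'bm" where "p2 f \<equiv> Leg2 pb f f"

lemma p_simps [simp]:
  assumes "f \<in> Arr B"
  shows "p1 f \<in> Arr B" "p2 f \<in> Arr B" "Cod B (p1 f) = Dom B f" "Cod B (p2 f) = Dom B f"
    "Dom B (p2 f) = Dom B (p1 f)"
  using pbs assms by (auto simp: pullbacks_def pullback_square_def)

lemma p_commute: "f \<in> Arr B \<Longrightarrow> f \<cdot>\<^bsub>B\<^esub> p2 f = f \<cdot>\<^bsub>B\<^esub> p1 f"
  using pbs by (auto simp: pullbacks_def pullback_square_def)

lemma pullback_ext: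
  assumes f: "f \<in> Arr B" and h: "h \<in> Arr B" "h' \<in> Arr B" "Dom B h = Dom B h'"
    "Cod B h = Dom B (p1 f)" "Cod B h' = Dom B (p1 f)"
    and eq: "p1 f \<cdot>\<^bsub>B\<^esub> h = p1 f \<cdot>\<^bsub>B\<^esub> h'" "p2 f \<cdot>\<^bsub>B\<^esub> h = p2 f \<cdot>\<^bsub>B\<^esub> h'"
  shows "h = h'"
proof -
  have "pullback_square B f (p1 f) f (p2 f)" using pbs f by (auto simp: pullbacks_def)
  moreover have "p1 f \<cdot>\<^bsub>B\<^esub> h \<in> Hom B (Dom B h) (Dom B f)" "p2 f \<cdot>\<^bsub>B\<^esub> h \<in> Hom B (Dom B h) (Dom B f)"
    using f h by (simp_all add: in_Hom)
  moreover have "f \<cdot>\<^bsub>B\<^esub> (p1 f \<cdot>\<^bsub>B\<^esub> h) = f \<cdot>\<^bsub>B\<^esub> (p2 f \<cdot>\<^bsub>B\<^esub> h)"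
    using T.V.tgt.Cmp_eq_extend[OF p_commute[OF f], of h] f h by simp
  ultimately have "\<exists>!k. k \<in> Hom B (Dom B h) (Dom B (p1 f)) \<and> p1 f \<cdot>\<^bsub>B\<^esub> k = p1 f \<cdot>\<^bsub>B\<^esub> h \<and>
      p2 f \<cdot>\<^bsub>B\<^esub> k = p2 f \<cdot>\<^bsub>B\<^esub> h"
    unfolding pullback_square_def by blast
  moreover have "h \<in> Hom B (Dom B h) (Dom B (p1 f))" "h' \<in> Hom B (Dom B h) (Dom B (p1 f))"
    using h by (simp_all add: in_Hom)
  ultimately show ?thesis using eq by metis
qed

lemma slice_products_simps:
  "Leg1 (slice_products B pb) f f = (f \<cdot>\<^bsub>B\<^esub> p1 f, p1 f, f)"
  "Leg2 (slice_products B pb) f f = (f \<cdot>\<^bsub>B\<^esub> p1 f, p2 f, f)"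
  "prod_obj BI (slice_products B pb) f f = f \<cdot>\<^bsub>B\<^esub> p1 f"
  by (simp_all add: slice_products_def prod_obj_def)

text \<open>The outer entries of a slice arrow only repeat its ends. The middle one is the arrow of
  \<open>B\<close> that matters, here from \<open>Dom B f\<close> into the kernel pair of
  \<open>f\<close>; \<open>sqI\<close>, \<open>er\<close> and \<open>ea\<close> are extracted in the
  same way.\<close>

definition dg :: "'bm \<Rightarrow> 'bm" where "dg f = fst (snd (diagonal BI (slice_products B pb) f))"

lemma dg:
  assumes f: "f \<in> Arr B" "Cod B f = I"
  shows "diagonal BI (slice_products B pb) f = (f, dg f, f \<cdot>\<^bsub>B\<^esub> p1 f)"
    and "dg f \<in> Arr B" "Dom B (dg f) = Dom B f" "Cod B (dg f) = Dom B (p1 f)"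
      "p1 f \<cdot>\<^bsub>B\<^esub> dg f = Ide B (Dom B f)" "p2 f \<cdot>\<^bsub>B\<^esub> dg f = Ide B (Dom B f)"
proof -
  have f': "f \<in> Obj BI" using f by simp
  obtain a d b where d: "diagonal BI (slice_products B pb) f = (a, d, b)"
    by (cases "diagonal BI (slice_products B pb) f")
  note D = S.C.diagonal_simps[OF f', unfolded d slice_products_simps]
  have ab: "a = f" "b = f \<cdot>\<^bsub>B\<^esub> p1 f" using D(2,3) by simp_all
  then show "diagonal BI (slice_products B pb) f = (f, dg f, f \<cdot>\<^bsub>B\<^esub> p1 f)"
    using d by (simp add: dg_def)
  show "dg f \<in> Arr B" "Dom B (dg f) = Dom B f" "Cod B (dg f) = Dom B (p1 f)"
      "p1 f \<cdot>\<^bsub>B\<^esub> dg f = Ide B (Dom B f)" "p2 f \<cdot>\<^bsub>B\<^esub> dg f = Ide B (Dom B f)"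
    using D(1,4,5) ab f by (simp_all add: dg_def d)
qed

definition sqI :: "'bm \<times> 'bm \<times> 'bm \<Rightarrow> 'bm" where "sqI a = fst (snd (S.C.sq a))"

lemma sqI:
  assumes a: "(f, h, g) \<in> Arr BI"
  shows "S.C.sq (f, h, g) = (f \<cdot>\<^bsub>B\<^esub> p1 f, sqI (f, h, g), g \<cdot>\<^bsub>B\<^esub> p1 g)"
    and "sqI (f, h, g) \<in> Arr B" "Dom B (sqI (f, h, g)) = Dom B (p1 f)" "Cod B (sqI (f, h, g)) = Dom B (p1 g)"
      "p1 g \<cdot>\<^bsub>B\<^esub> sqI (f, h, g) = h \<cdot>\<^bsub>B\<^esub> p1 f" "p2 g \<cdot>\<^bsub>B\<^esub> sqI (f, h, g) = h \<cdot>\<^bsub>B\<^esub> p2 f"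
proof -
  have a': "f \<in> Arr B" "g \<in> Arr B" using a by simp_all
  obtain x d y where d: "S.C.sq (f, h, g) = (x, d, y)" by (cases "S.C.sq (f, h, g)")
  have D: "(x, d, y) \<in> Arr BI" "x = f \<cdot>\<^bsub>B\<^esub> p1 f" "y = g \<cdot>\<^bsub>B\<^esub> p1 g"
    "p1 g \<cdot>\<^bsub>B\<^esub> d = h \<cdot>\<^bsub>B\<^esub> p1 f" "p2 g \<cdot>\<^bsub>B\<^esub> d = h \<cdot>\<^bsub>B\<^esub> p2 f"
    using S.C.square_simps(2-4)[OF a] S.C.square_simps(5,6)[OF a slice_Cod]
    unfolding d slice_products_simps slice_Dom slice_Cod slice_Cmp by simp_all
  then show "S.C.sq (f, h, g) = (f \<cdot>\<^bsub>B\<^esub> p1 f, sqI (f, h, g), g \<cdot>\<^bsub>B\<^esub> p1 g)"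
    using d by (simp add: sqI_def)
  show "sqI (f, h, g) \<in> Arr B" "Dom B (sqI (f, h, g)) = Dom B (p1 f)" "Cod B (sqI (f, h, g)) = Dom B (p1 g)"
      "p1 g \<cdot>\<^bsub>B\<^esub> sqI (f, h, g) = h \<cdot>\<^bsub>B\<^esub> p1 f" "p2 g \<cdot>\<^bsub>B\<^esub> sqI (f, h, g) = h \<cdot>\<^bsub>B\<^esub> p2 f"
    using D a' by (simp_all add: sqI_def d)
qed

definition incl :: "'bm \<Rightarrow> 'bm" where "incl f = pairing B pr (p1 f) (p2 f)"

lemma incl_simps [simp]:
  assumes "f \<in> Arr B"
  shows "incl f \<in> Arr B" "Dom B (incl f) = Dom B (p1 f)"
    "Cod B (incl f) = prod_obj B pr (Dom B f) (Dom B f)"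
    "Dom B f = x \<Longrightarrow> Leg1 pr x x \<cdot>\<^bsub>B\<^esub> incl f = p1 f" "Dom B f = x \<Longrightarrow> Leg2 pr x x \<cdot>\<^bsub>B\<^esub> incl f = p2 f"
  using assms by (simp_all add: incl_def)

lemma Leg_incl_Cmp [simp]:
  assumes "f \<in> Arr B" "Dom B f = x" "u \<in> Arr B" "Cod B u = Dom B (p1 f)"
  shows "Leg1 pr x x \<cdot>\<^bsub>B\<^esub> (incl f \<cdot>\<^bsub>B\<^esub> u) = p1 f \<cdot>\<^bsub>B\<^esub> u" "Leg2 pr x x \<cdot>\<^bsub>B\<^esub> (incl f \<cdot>\<^bsub>B\<^esub> u) = p2 f \<cdot>\<^bsub>B\<^esub> u"
  using T.V.tgt.Cmp_eq_extend[OF incl_simps(4)[OF assms(1,2)], of u]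
    T.V.tgt.Cmp_eq_extend[OF incl_simps(5)[OF assms(1,2)], of u] assms by auto

lemma incl_dg:
  assumes f: "f \<in> Arr B" "Cod B f = I"
  shows "incl f \<cdot>\<^bsub>B\<^esub> dg f = diagonal B pr (Dom B f)"
  by (rule T.C.product_ext[of "Dom B f" "Dom B f"]) (use f dg[OF f] in simp_all)

lemma incl_sqI:
  assumes a: "(f, h, g) \<in> Arr BI"
  shows "incl g \<cdot>\<^bsub>B\<^esub> sqI (f, h, g) = T.C.sq h \<cdot>\<^bsub>B\<^esub> incl f"
proof -
  have a': "f \<in> Arr B" "g \<in> Arr B" "h \<in> Arr B" "Dom B h = Dom B f" "Cod B h = Dom B g" using a by simp_all
  show ?thesis
    by (rule T.C.product_ext[of "Dom B g" "Dom B g"]) (use a' sqI[OF a] in simp_all)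
qed

text \<open>Two related elements have the same index: both components are
  \<open>f \<cdot> p1 f\<close>, because \<open>f\<close> coequalises \<open>p1 f\<close> and
  \<open>p2 f\<close>. This is what allows a relation over the kernel pair to be mapped to the
  equality object of \<open>I\<close>.\<close>

lemma diagonal_incl:
  assumes f: "f \<in> Arr B" "Cod B f = I"
  shows "T.C.sq f \<cdot>\<^bsub>B\<^esub> incl f = diagonal B pr I \<cdot>\<^bsub>B\<^esub> (f \<cdot>\<^bsub>B\<^esub> p1 f)"
  by (rule T.C.product_ext[of I I]) (use f p_commute[OF f(1)] in simp_all)

text \<open>The equality object of \<open>f\<close> in the slice is the arrow \<open>S.eqo f\<close> of \<open>E\<close> into \<open>K I\<close>;
  \<open>er f\<close> is the underlying arrow in \<open>E\<close> of its reflexivity map.\<close>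

definition er :: "'bm \<Rightarrow> 'em" where "er f = fst (snd (S.refl f))"

lemma er:
  assumes f: "f \<in> Arr B" "Cod B f = I"
  shows "S.refl f = (amap K f, er f, S.eqo f)" "er f \<in> Arr E" "Dom E (er f) = omap K (Dom B f)"
    "Cod E (er f) = Dom E (S.eqo f)" "S.eqo f \<in> Arr E" "Cod E (S.eqo f) = omap K I"
    "amap U (er f) = dg f" "amap U (S.eqo f) = f \<cdot>\<^bsub>B\<^esub> p1 f" "opcartesian E B U (er f)"
    "omap U (Dom E (S.eqo f)) = Dom B (p1 f)"
proof -
  have f': "f \<in> Obj BI" using f by simp
  obtain a d b where d: "S.refl f = (a, d, b)" by (cases "S.refl f")
  note D = S.refl[OF f', unfolded d]
  have ab: "a = amap K f" "b = S.eqo f" using D(3,4) by simp_all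
  then show r: "S.refl f = (amap K f, er f, S.eqo f)" using d by (simp add: er_def)
  then have d': "d = er f" using d by simp
  have *: "(amap K f, er f, S.eqo f) \<in> Arr EI" using D(2) unfolding ab d' .
  then show A: "er f \<in> Arr E" "Dom E (er f) = omap K (Dom B f)"
    "Cod E (er f) = Dom E (S.eqo f)" "S.eqo f \<in> Arr E" "Cod E (S.eqo f) = omap K I" using f by simp_all
  show "amap U (er f) = dg f" "amap U (S.eqo f) = f \<cdot>\<^bsub>B\<^esub> p1 f"
    using D(5) unfolding dg(1)[OF f] ab d' by simp_all
  \<comment> \<open>From here on the slice equality can be handled inside \<open>E\<close>, where
    Beck-Chevalley is available.\<close>
  show "opcartesian E B U (er f)"
    using opcartesian_of_slice[OF opfib, of "omap K I" "amap K f" "er f" "S.eqo f"] D(1) unfolding ab d' by simp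
  show "omap U (Dom E (S.eqo f)) = Dom B (p1 f)"
    using T.V.Dom_amap[OF A(4)] \<open>amap U (S.eqo f) = f \<cdot>\<^bsub>B\<^esub> p1 f\<close> f by simp
qed

definition ea :: "'bm \<times> 'bm \<times> 'bm \<Rightarrow> 'em" where "ea a = fst (snd (S.eqa a))"

lemma ea:
  assumes a: "(f, h, g) \<in> Arr BI"
  shows "S.eqa (f, h, g) = (S.eqo f, ea (f, h, g), S.eqo g)" "ea (f, h, g) \<in> Arr E"
    "Dom E (ea (f, h, g)) = Dom E (S.eqo f)" "Cod E (ea (f, h, g)) = Dom E (S.eqo g)"
    "amap U (ea (f, h, g)) = sqI (f, h, g)" "ea (f, h, g) \<cdot>\<^bsub>E\<^esub> er f = er g \<cdot>\<^bsub>E\<^esub> amap K h"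
proof -
  have f: "f \<in> Arr B" "Cod B f = I" and g: "g \<in> Arr B" "Cod B g = I" using a by simp_all
  obtain x d y where d: "S.eqa (f, h, g) = (x, d, y)" by (cases "S.eqa (f, h, g)")
  note D = S.eqa[OF a, unfolded d slice_Dom slice_Cod]
  have ab: "x = S.eqo f" "y = S.eqo g" using D(2,3) by simp_all
  then show r: "S.eqa (f, h, g) = (S.eqo f, ea (f, h, g), S.eqo g)" using d by (simp add: ea_def)
  then have d': "d = ea (f, h, g)" using d by simp
  show "ea (f, h, g) \<in> Arr E"
    "Dom E (ea (f, h, g)) = Dom E (S.eqo f)" "Cod E (ea (f, h, g)) = Dom E (S.eqo g)"
    using D(1) unfolding ab d' by simp_all
  show "amap U (ea (f, h, g)) = sqI (f, h, g)"
    using D(4) unfolding ab d' sqI(1)[OF a] by simp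
  show "ea (f, h, g) \<cdot>\<^bsub>E\<^esub> er f = er g \<cdot>\<^bsub>E\<^esub> amap K h"
    using D(5) unfolding ab d' er(1)[OF f] er(1)[OF g] by simp
qed

text \<open>If \<open>incl f\<close> after \<open>v\<close> is the diagonal after \<open>u\<close>,
  comparing legs shows that both components of \<open>v\<close> are \<open>u\<close>, so
  \<open>v\<close> factors through \<open>dg f\<close>.\<close>

lemma pullback_square_diagonal_incl:
  assumes f: "f \<in> Arr B" "Cod B f = I"
  shows "pullback_square B (diagonal B pr (Dom B f)) (Ide B (Dom B f)) (incl f) (dg f)"
proof -
  have dg_u: "v = dg f \<cdot>\<^bsub>B\<^esub> u"
    if uv: "u \<in> Hom B w (Dom B f)" "v \<in> Hom B w (Dom B (p1 f))"
      "diagonal B pr (Dom B f) \<cdot>\<^bsub>B\<^esub> u = incl f \<cdot>\<^bsub>B\<^esub> v" for u v w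
  proof (rule pullback_ext[OF f(1)])
    have "p1 f \<cdot>\<^bsub>B\<^esub> (dg f \<cdot>\<^bsub>B\<^esub> u) = u" "p2 f \<cdot>\<^bsub>B\<^esub> (dg f \<cdot>\<^bsub>B\<^esub> u) = u"
      using T.V.tgt.Cmp_eq_extend[OF dg(5)[OF f], of u] T.V.tgt.Cmp_eq_extend[OF dg(6)[OF f], of u] uv f dg[OF f]
      by (simp_all add: in_Hom)
    moreover have "p1 f \<cdot>\<^bsub>B\<^esub> v = u" "p2 f \<cdot>\<^bsub>B\<^esub> v = u"
      using arg_cong[OF uv(3), of "\<lambda>k. Leg1 pr (Dom B f) (Dom B f) \<cdot>\<^bsub>B\<^esub> k"]
        arg_cong[OF uv(3), of "\<lambda>k. Leg2 pr (Dom B f) (Dom B f) \<cdot>\<^bsub>B\<^esub> k"] uv(1,2) f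
      by (simp_all add: in_Hom)
    ultimately show "p1 f \<cdot>\<^bsub>B\<^esub> v = p1 f \<cdot>\<^bsub>B\<^esub> (dg f \<cdot>\<^bsub>B\<^esub> u)" "p2 f \<cdot>\<^bsub>B\<^esub> v = p2 f \<cdot>\<^bsub>B\<^esub> (dg f \<cdot>\<^bsub>B\<^esub> u)"
      by simp_all
  qed (use uv f dg[OF f] in \<open>simp_all add: in_Hom\<close>)
  have "\<exists>!h. h \<in> Hom B w (Dom B f) \<and> Ide B (Dom B f) \<cdot>\<^bsub>B\<^esub> h = u \<and> dg f \<cdot>\<^bsub>B\<^esub> h = v"
    if uv: "u \<in> Hom B w (Dom B f)" "v \<in> Hom B w (Dom B (p1 f))"
      "diagonal B pr (Dom B f) \<cdot>\<^bsub>B\<^esub> u = incl f \<cdot>\<^bsub>B\<^esub> v" for u v w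
  proof (rule ex1I[of _ u])
    show "u \<in> Hom B w (Dom B f) \<and> Ide B (Dom B f) \<cdot>\<^bsub>B\<^esub> u = u \<and> dg f \<cdot>\<^bsub>B\<^esub> u = v"
      using uv(1) dg_u[OF uv] by (simp add: in_Hom)
  qed (auto simp: in_Hom)
  then show ?thesis
    using f dg[OF f] incl_dg[OF f] by (simp add: pullback_square_def)
qed

text \<open>A projection retracts the diagonal, which is therefore monic; this square expresses
  it.\<close>

lemma pullback_square_diagonal:
  assumes x: "x \<in> Obj B"
  shows "pullback_square B (diagonal B pr x) (Ide B x) (diagonal B pr x) (Ide B x)"
proof -
  have "u = v"
    if "u \<in> Hom B w x" "v \<in> Hom B w x" "diagonal B pr x \<cdot>\<^bsub>B\<^esub> u = diagonal B pr x \<cdot>\<^bsub>B\<^esub> v" for u v w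
    using arg_cong[OF that(3), of "\<lambda>k. Leg1 pr x x \<cdot>\<^bsub>B\<^esub> k"] that(1,2) x by (simp add: in_Hom)
  then have "\<exists>!h. h \<in> Hom B w x \<and> Ide B x \<cdot>\<^bsub>B\<^esub> h = u \<and> Ide B x \<cdot>\<^bsub>B\<^esub> h = v"
    if "u \<in> Hom B w x" "v \<in> Hom B w x" "diagonal B pr x \<cdot>\<^bsub>B\<^esub> u = diagonal B pr x \<cdot>\<^bsub>B\<^esub> v" for u v w
    using that by (intro ex1I[of _ u]) (auto simp: in_Hom)
  then show ?thesis using x by (simp add: pullback_square_def)
qed

text \<open>In the square of the diagonal with itself both liftings over \<open>Ide B x\<close> may
  be taken to be the identity of \<open>K x\<close>, so the comparison arrow that Beck-Chevalley
  makes cartesian is \<open>refl x\<close> itself.\<close>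

lemma refl_cartesian:
  assumes x: "x \<in> Obj B"
  shows "cartesian E B U (T.refl x)"
  by (rule beck_chevalley_cartesian[OF bif bc pullback_square_diagonal[OF x] T.V.cartesian_Ide[of "omap K x"] _
        T.refl_opcartesian[OF x] _ _ T.V.opcartesian_Ide[of "omap K x"]])
    (use x in simp_all)

text \<open>Both arrows factor over \<open>u\<close> through the cartesian \<open>T.refl x\<close>,
  which leaves two arrows into a truth object with the same base.\<close>

lemma unique_into_eqo:
  assumes x: "x \<in> Obj B" and z: "z \<in> Arr E" "z' \<in> Arr E" "Dom E z = Dom E z'" "Cod E z = T.eqo x"
    "Cod E z' = T.eqo x" "amap U z = diagonal B pr x \<cdot>\<^bsub>B\<^esub> u" "amap U z' = diagonal B pr x \<cdot>\<^bsub>B\<^esub> u"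
    and u: "u \<in> Arr B" "Cod B u = x"
  shows "z = z'"
proof -
  have du: "Dom B u = omap U (Dom E z)" using T.V.Dom_amap[OF z(1)] z u x by simp
  have "\<exists>l. l \<in> Arr E \<and> Dom E l = Dom E y \<and> Cod E l = Dom E (T.refl x) \<and> amap U l = u \<and> T.refl x \<cdot>\<^bsub>E\<^esub> l = y"
    if "y = z \<or> y = z'" for y
    by (rule T.V.cartesian_factor[OF refl_cartesian[OF x]]) (use that z u x du in auto)
  then obtain l l' where l: "l \<in> Arr E" "Dom E l = Dom E z" "Cod E l = omap K x" "amap U l = u"
      "T.refl x \<cdot>\<^bsub>E\<^esub> l = z"
    and l': "l' \<in> Arr E" "Dom E l' = Dom E z" "Cod E l' = omap K x" "amap U l' = u" "T.refl x \<cdot>\<^bsub>E\<^esub> l' = z'"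
    using z(3) T.refl_simps(2)[OF x] by metis
  have "l = l'" by (rule truth_unique[OF truth fib _ _ _ _ _ x]) (use l l' in simp_all)
  then show ?thesis using l l' by simp
qed

text \<open>The arrow comes from opcartesianness of \<open>er f\<close>, since \<open>incl f\<close>
  after \<open>dg f\<close> is the diagonal. Beck-Chevalley with the identity of
  \<open>K (Dom B f)\<close> as the lifting on the identity side makes it cartesian: it exhibits the
  slice equality as a reindexing of the one of \<open>U\<close>.\<close>

lemma comparison_ex:
  assumes f: "f \<in> Arr B" "Cod B f = I"
  shows "\<exists>c. c \<in> Arr E \<and> Dom E c = Dom E (S.eqo f) \<and> Cod E c = T.eqo (Dom B f) \<and> amap U c = incl f \<and>
    c \<cdot>\<^bsub>E\<^esub> er f = T.refl (Dom B f) \<and> cartesian E B U c"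
proof -
  have x: "Dom B f \<in> Obj B" using f by simp
  obtain c where c: "c \<in> Arr E" "Dom E c = Cod E (er f)" "Cod E c = T.eqo (Dom B f)" "amap U c = incl f"
    "c \<cdot>\<^bsub>E\<^esub> er f = T.refl (Dom B f)"
    using T.V.opcartesian_factor[OF er(9)[OF f], of "T.refl (Dom B f)" "incl f"] f er(2-)[OF f] incl_dg[OF f]
    by auto
  have "cartesian E B U c"
    by (rule beck_chevalley_cartesian[OF bif bc pullback_square_diagonal_incl[OF f]
          T.V.cartesian_Ide[of "omap K (Dom B f)"] _ T.refl_opcartesian[OF x] _ _ er(9)[OF f]])
      (use c f er(2-)[OF f] in simp_all)
  then show ?thesis using c er(4)[OF f] by auto
qed

definition cmpr :: "'bm \<Rightarrow> 'em" where
  "cmpr f = (SOME c. c \<in> Arr E \<and> Dom E c = Dom E (S.eqo f) \<and> Cod E c = T.eqo (Dom B f) \<and> amap U c = incl f \<and>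
    c \<cdot>\<^bsub>E\<^esub> er f = T.refl (Dom B f) \<and> cartesian E B U c)"

lemma cmpr:
  assumes f: "f \<in> Arr B" "Cod B f = I"
  shows "cmpr f \<in> Arr E" "Dom E (cmpr f) = Dom E (S.eqo f)" "Cod E (cmpr f) = T.eqo (Dom B f)"
    "amap U (cmpr f) = incl f" "cmpr f \<cdot>\<^bsub>E\<^esub> er f = T.refl (Dom B f)" "cartesian E B U (cmpr f)"
  using someI_ex[OF comparison_ex[OF f]] unfolding cmpr_def by blast+

text \<open>Both sides have the same base by \<open>incl_sqI\<close>, and after the opcartesian
  \<open>er f\<close> both become reflexivity after \<open>K h\<close>.\<close>

lemma cmpr_natural:
  assumes a: "(f, h, g) \<in> Arr BI"
  shows "cmpr g \<cdot>\<^bsub>E\<^esub> ea (f, h, g) = T.eqa h \<cdot>\<^bsub>E\<^esub> cmpr f"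
proof -
  have f: "f \<in> Arr B" "Cod B f = I" and g: "g \<in> Arr B" "Cod B g = I"
    and h: "h \<in> Arr B" "Dom B h = Dom B f" "Cod B h = Dom B g" using a by simp_all
  show ?thesis
  proof (rule T.V.opcartesian_cancel[OF er(9)[OF f]])
    have "(cmpr g \<cdot>\<^bsub>E\<^esub> ea (f, h, g)) \<cdot>\<^bsub>E\<^esub> er f = cmpr g \<cdot>\<^bsub>E\<^esub> (er g \<cdot>\<^bsub>E\<^esub> amap K h)"
      using cmpr[OF g] ea[OF a] er(2-)[OF f] by simp
    also have "\<dots> = T.refl (Dom B g) \<cdot>\<^bsub>E\<^esub> amap K h"
      using T.V.src.Cmp_eq_extend[OF cmpr(5)[OF g], of "amap K h"] cmpr[OF g] er(2-)[OF g] h g by simp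
    also have "\<dots> = T.eqa h \<cdot>\<^bsub>E\<^esub> T.refl (Dom B f)" using T.eqa_refl[OF h(1)] h by simp
    also have "\<dots> = (T.eqa h \<cdot>\<^bsub>E\<^esub> cmpr f) \<cdot>\<^bsub>E\<^esub> er f"
      using cmpr[OF f] er(2-)[OF f] h by simp
    finally show "(cmpr g \<cdot>\<^bsub>E\<^esub> ea (f, h, g)) \<cdot>\<^bsub>E\<^esub> er f = (T.eqa h \<cdot>\<^bsub>E\<^esub> cmpr f) \<cdot>\<^bsub>E\<^esub> er f" .
    show "amap U (cmpr g \<cdot>\<^bsub>E\<^esub> ea (f, h, g)) = amap U (T.eqa h \<cdot>\<^bsub>E\<^esub> cmpr f)"
      using cmpr[OF f] cmpr[OF g] ea[OF a] h incl_sqI[OF a] by simp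
  qed (use cmpr[OF f] cmpr[OF g] ea[OF a] er(2-)[OF f] h in simp_all)
qed

text \<open>Precomposing with the opcartesian \<open>er f\<close> and postcomposing with the
  cartesian \<open>cmpr g\<close> loses nothing, and leaves an arrow from a truth object into
  \<open>T.eqo (Dom B g)\<close> whose base is the diagonal after \<open>h\<close>; there is only
  one such arrow.\<close>

lemma unique_between_equalities:
  assumes a: "(f, h, g) \<in> Arr BI"
    and z: "z \<in> Arr E" "Dom E z = Dom E (S.eqo f)" "Cod E z = Dom E (S.eqo g)" "amap U z = sqI (f, h, g)"
  shows "z = ea (f, h, g)"
proof -
  have f: "f \<in> Arr B" "Cod B f = I" and g: "g \<in> Arr B" "Cod B g = I"
    and h: "h \<in> Arr B" "Dom B h = Dom B f" "Cod B h = Dom B g" using a by simp_all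
  have x: "Dom B g \<in> Obj B" using g by simp
  have base: "incl g \<cdot>\<^bsub>B\<^esub> (sqI (f, h, g) \<cdot>\<^bsub>B\<^esub> dg f) = diagonal B pr (Dom B g) \<cdot>\<^bsub>B\<^esub> h"
  proof -
    have "incl g \<cdot>\<^bsub>B\<^esub> (sqI (f, h, g) \<cdot>\<^bsub>B\<^esub> dg f) = T.C.sq h \<cdot>\<^bsub>B\<^esub> (incl f \<cdot>\<^bsub>B\<^esub> dg f)"
      using T.V.tgt.Cmp_eq_extend[OF incl_sqI[OF a], of "dg f"] sqI[OF a] dg[OF f] f g h by simp
    also have "\<dots> = diagonal B pr (Dom B g) \<cdot>\<^bsub>B\<^esub> h"
      using T.C.diagonal_natural[OF h(1)] h by (simp add: incl_dg[OF f])
    finally show ?thesis .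
  qed
  have "cmpr g \<cdot>\<^bsub>E\<^esub> (z \<cdot>\<^bsub>E\<^esub> er f) = cmpr g \<cdot>\<^bsub>E\<^esub> (ea (f, h, g) \<cdot>\<^bsub>E\<^esub> er f)"
    by (rule unique_into_eqo[OF x, where u = h])
      (use cmpr[OF g] z ea(2-5)[OF a] er(2-)[OF f] h base in simp_all)
  then have "z \<cdot>\<^bsub>E\<^esub> er f = ea (f, h, g) \<cdot>\<^bsub>E\<^esub> er f"
    by (intro T.V.cartesian_cancel[OF cmpr(6)[OF g], of "z \<cdot>\<^bsub>E\<^esub> er f" "ea (f, h, g) \<cdot>\<^bsub>E\<^esub> er f"])
      (use cmpr[OF g] z ea(2-5)[OF a] er(2-)[OF f] in simp_all)
  then show ?thesis
    by (intro T.V.opcartesian_cancel[OF er(9)[OF f], of z "ea (f, h, g)"])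
      (use z ea(2-5)[OF a] er(2-)[OF f] in simp_all)
qed

text \<open>An arrow of relations carries its base arrow \<open>(f, h, g)\<close>, so fullness is
  uniqueness of the component above it.\<close>

lemma Eq_full:
  assumes f: "f \<in> Obj BI" and g: "g \<in> Obj BI" and m: "m \<in> Hom S.Rel (f, S.eqo f) (g, S.eqo g)"
  shows "(amap Rel_func m, S.eqa (amap Rel_func m)) = m"
proof -
  obtain x h y u z v where m_def: "m = ((x, h, y), (u, z, v))" by (cases m) auto
  have xy: "x = f" "y = g" "u = S.eqo f" "v = S.eqo g" and a: "(f, h, g) \<in> Arr BI"
    and z: "(S.eqo f, z, S.eqo g) \<in> Arr EI" "amap (slice_func U) (S.eqo f, z, S.eqo g) = S.C.sq (f, h, g)"
    using m unfolding m_def by (auto simp: in_Hom simp del: slice_Arr slice_func_simps)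
  have "z = ea (f, h, g)"
    using z unfolding sqI(1)[OF a] by (intro unique_between_equalities[OF a]) simp_all
  then show ?thesis by (simp add: m_def xy ea(1)[OF a])
qed

lemma slice_universal_arrow:
  assumes R: "R \<in> Obj S.Rel"
  shows "\<exists>q \<eta>. q \<in> Obj BI \<and> \<eta> \<in> Hom S.Rel R (q, S.eqo q) \<and>
    (\<forall>g\<in>Obj BI. \<forall>m\<in>Hom S.Rel R (g, S.eqo g). \<exists>!k. k \<in> Hom BI q g \<and> (k, S.eqa k) \<cdot>\<^bsub>S.Rel\<^esub> \<eta> = m)"
proof -
  obtain f w where R_def: "R = (f, w)" by (cases R)
  have f: "f \<in> Arr B" "Cod B f = I" and w: "w \<in> Arr E" "Cod E w = omap K I" "amap U w = f \<cdot>\<^bsub>B\<^esub> p1 f"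
    using R unfolding R_def by (simp_all add: slice_products_simps)
  let ?P = "Dom E w"
  have P: "?P \<in> Obj E" "omap U ?P = Dom B (incl f)"
    using w f T.V.Dom_amap[OF w(1)] by simp_all
  from T.left_adjoint_universal_arrow_opreindex[OF adj _ _ _ P, of "Dom B f"] f
  obtain c0 \<rho> \<tau> where \<rho>: "\<rho> \<in> Arr B" "Dom B \<rho> = Dom B f" "Cod B \<rho> = c0"
    and \<tau>: "\<tau> \<in> Arr E" "Dom E \<tau> = ?P" "Cod E \<tau> = T.eqo c0" "amap U \<tau> = T.C.sq \<rho> \<cdot>\<^bsub>B\<^esub> incl f"
    and univ: "\<And>h z. h \<in> Arr B \<Longrightarrow> Dom B h = Dom B f \<Longrightarrow> z \<in> Arr E \<Longrightarrow> Dom E z = ?P \<Longrightarrow>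
      Cod E z = T.eqo (Cod B h) \<Longrightarrow> amap U z = T.C.sq h \<cdot>\<^bsub>B\<^esub> incl f \<Longrightarrow>
      \<exists>!k. k \<in> Hom B c0 (Cod B h) \<and> k \<cdot>\<^bsub>B\<^esub> \<rho> = h \<and> T.eqa k \<cdot>\<^bsub>E\<^esub> \<tau> = z"
    by (auto simp: f)
  \<comment> \<open>The quotient \<open>c0\<close> acquires its map to \<open>I\<close> by
    transposing reflexivity of \<open>I\<close> after \<open>w\<close>; the required base
    \<open>sq f \<cdot> incl f\<close> is provided by \<open>diagonal_incl\<close>.\<close>
  have "\<exists>!k. k \<in> Hom B c0 I \<and> k \<cdot>\<^bsub>B\<^esub> \<rho> = f \<and> T.eqa k \<cdot>\<^bsub>E\<^esub> \<tau> = T.refl I \<cdot>\<^bsub>E\<^esub> w"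
    using univ[of f "T.refl I \<cdot>\<^bsub>E\<^esub> w"] f w diagonal_incl[OF f] by simp
  then obtain q where q_Hom: "q \<in> Hom B c0 I" and q\<rho>: "q \<cdot>\<^bsub>B\<^esub> \<rho> = f"
    and q_unique: "\<And>k. k \<in> Hom B c0 I \<Longrightarrow> k \<cdot>\<^bsub>B\<^esub> \<rho> = f \<Longrightarrow> T.eqa k \<cdot>\<^bsub>E\<^esub> \<tau> = T.refl I \<cdot>\<^bsub>E\<^esub> w \<Longrightarrow> k = q"
    by blast
  from q_Hom have q: "q \<in> Arr B" "Dom B q = c0" "Cod B q = I" by (simp_all add: in_Hom)
  have a: "(f, \<rho>, q) \<in> Arr BI" using f \<rho> q q\<rho> by simp
  \<comment> \<open>\<open>\<tau>\<close> lies over \<open>sq \<rho> \<cdot> incl f\<close>, which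
    is also \<open>incl q \<cdot> sqI (f, \<rho>, q)\<close>; the cartesian \<open>cmpr q\<close>
    therefore lifts it to an arrow into the slice equality of \<open>q\<close>.\<close>
  have "\<exists>x. x \<in> Arr E \<and> Dom E x = Dom E \<tau> \<and> Cod E x = Dom E (cmpr q) \<and> amap U x = sqI (f, \<rho>, q) \<and>
      cmpr q \<cdot>\<^bsub>E\<^esub> x = \<tau>"
    by (rule T.V.cartesian_factor[OF cmpr(6)[OF q(1,3)]])
      (use cmpr[OF q(1,3)] \<tau> q P f sqI[OF a] er[OF q(1,3)] incl_sqI[OF a] in simp_all)
  then obtain x where x: "x \<in> Arr E" "Dom E x = ?P" "Cod E x = Dom E (S.eqo q)" "amap U x = sqI (f, \<rho>, q)"
      "cmpr q \<cdot>\<^bsub>E\<^esub> x = \<tau>"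
    using \<tau> cmpr[OF q(1,3)] by auto
  \<comment> \<open>For \<open>x\<close> to be a slice arrow a triangle over \<open>K I\<close> must
    commute, and arrows into \<open>K I\<close> are determined by their bases.\<close>
  have sx: "S.eqo q \<cdot>\<^bsub>E\<^esub> x = w"
  proof (rule truth_unique[OF truth fib _ _ _ _ _ I_Obj])
    have "q \<cdot>\<^bsub>B\<^esub> (\<rho> \<cdot>\<^bsub>B\<^esub> p1 f) = f \<cdot>\<^bsub>B\<^esub> p1 f"
      using T.V.tgt.Cmp_eq_extend[OF q\<rho>, of "p1 f"] f q \<rho> by simp
    then show "amap U (S.eqo q \<cdot>\<^bsub>E\<^esub> x) = amap U w"
      using x er(2-)[OF q(1,3)] w q sqI[OF a] by simp
  qed (use x er(2-)[OF q(1,3)] w in simp_all)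
  let ?\<eta> = "((f, \<rho>, q), (w, x, S.eqo q))"
  have "amap (slice_func U) (w, x, S.eqo q) = S.C.sq (f, \<rho>, q)"
    using w x er[OF q(1,3)] by (simp add: sqI(1)[OF a])
  then have \<eta>: "?\<eta> \<in> Hom S.Rel R (q, S.eqo q)"
    using a w x er(2-)[OF q(1,3)] sx by (simp add: in_Hom R_def)
  have ex1: "\<exists>!k. k \<in> Hom BI q g \<and> (k, S.eqa k) \<cdot>\<^bsub>S.Rel\<^esub> ?\<eta> = m"
    if g': "g \<in> Obj BI" and m: "m \<in> Hom S.Rel R (g, S.eqo g)" for g m
  proof -
    have g: "g \<in> Arr B" "Cod B g = I" using g' by simp_all
    obtain m1 h m2 m3 z m4 where m_def: "m = ((m1, h, m2), (m3, z, m4))" by (cases m) auto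
    have m_def': "m = ((f, h, g), (w, z, S.eqo g))" and b: "(f, h, g) \<in> Arr BI"
      and z: "(w, z, S.eqo g) \<in> Arr EI" "amap (slice_func U) (w, z, S.eqo g) = S.C.sq (f, h, g)"
      using m unfolding m_def R_def by (auto simp: in_Hom simp del: slice_Arr slice_func_simps)
    have h: "h \<in> Arr B" "Dom B h = Dom B f" "Cod B h = Dom B g" "g \<cdot>\<^bsub>B\<^esub> h = f" using b by simp_all
    have z: "z \<in> Arr E" "Dom E z = ?P" "Cod E z = Dom E (S.eqo g)" "amap U z = sqI (f, h, g)"
      using z unfolding sqI(1)[OF b] by simp_all
    \<comment> \<open>Composing with \<open>cmpr g\<close> moves \<open>z\<close> into an equality
      object of \<open>U\<close>, over \<open>sq h \<cdot> incl f\<close>, where the universality of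
      \<open>\<tau>\<close> applies.\<close>
    have "\<exists>!k. k \<in> Hom B c0 (Cod B h) \<and> k \<cdot>\<^bsub>B\<^esub> \<rho> = h \<and> T.eqa k \<cdot>\<^bsub>E\<^esub> \<tau> = cmpr g \<cdot>\<^bsub>E\<^esub> z"
      by (rule univ) (use h z cmpr[OF g] incl_sqI[OF b] in simp_all)
    then obtain k where k': "k \<in> Hom B c0 (Cod B h)" and k\<rho>: "k \<cdot>\<^bsub>B\<^esub> \<rho> = h"
      and k\<tau>: "T.eqa k \<cdot>\<^bsub>E\<^esub> \<tau> = cmpr g \<cdot>\<^bsub>E\<^esub> z"
      and k_unique: "\<And>k'. k' \<in> Hom B c0 (Cod B h) \<Longrightarrow> k' \<cdot>\<^bsub>B\<^esub> \<rho> = h \<Longrightarrow>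
        T.eqa k' \<cdot>\<^bsub>E\<^esub> \<tau> = cmpr g \<cdot>\<^bsub>E\<^esub> z \<Longrightarrow> k' = k"
      by blast
    have k: "k \<in> Arr B" "Dom B k = c0" "Cod B k = Dom B g" using k' h(3) by (simp_all add: in_Hom)
    have gk\<rho>: "(g \<cdot>\<^bsub>B\<^esub> k) \<cdot>\<^bsub>B\<^esub> \<rho> = f" using k \<rho> g k\<rho> h by simp
    \<comment> \<open>So far \<open>k\<close> is only an arrow of \<open>B\<close>. That it lies
      over \<open>I\<close> follows from the uniqueness of \<open>q\<close> once
      \<open>g \<cdot> k\<close> is seen to have the same transpose; both arrows lie over the
      diagonal of \<open>I\<close> after \<open>f \<cdot> p1 f\<close>, hence coincide.\<close>
    have "T.eqa (g \<cdot>\<^bsub>B\<^esub> k) \<cdot>\<^bsub>E\<^esub> \<tau> = T.refl I \<cdot>\<^bsub>E\<^esub> w"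
    proof (rule unique_into_eqo[OF I_Obj, where u = "f \<cdot>\<^bsub>B\<^esub> p1 f"])
      have "T.C.sq (g \<cdot>\<^bsub>B\<^esub> k) \<cdot>\<^bsub>B\<^esub> (T.C.sq \<rho> \<cdot>\<^bsub>B\<^esub> incl f) = T.C.sq f \<cdot>\<^bsub>B\<^esub> incl f"
        using T.V.tgt.Cmp_eq_extend[OF T.C.sq_Cmp[of \<rho> "g \<cdot>\<^bsub>B\<^esub> k", symmetric], of "incl f"] gk\<rho> k \<rho> g f
        by (simp del: T.C.sq_Cmp T.V.tgt.Cmp_Cmp)
      then show "amap U (T.eqa (g \<cdot>\<^bsub>B\<^esub> k) \<cdot>\<^bsub>E\<^esub> \<tau>) = diagonal B pr I \<cdot>\<^bsub>B\<^esub> (f \<cdot>\<^bsub>B\<^esub> p1 f)"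
        using \<tau> k g diagonal_incl[OF f] by (simp del: T.C.sq_Cmp)
    qed (use \<tau> k g w f in simp_all)
    then have gk: "g \<cdot>\<^bsub>B\<^esub> k = q"
      using k g by (intro q_unique gk\<rho>) (simp_all add: in_Hom)
    have d: "(q, k, g) \<in> Arr BI" using q k g gk by simp
    have sq_k: "sqI (q, l, g) \<cdot>\<^bsub>B\<^esub> sqI (f, \<rho>, q) = sqI (f, h, g)"
      if l: "(q, l, g) \<in> Arr BI" "l \<cdot>\<^bsub>B\<^esub> \<rho> = h" for l
      using S.C.sq_Cmp[OF a l(1)] l(2) by (simp add: sqI(1)[OF a] sqI(1)[OF l(1)] sqI(1)[OF b])
    \<comment> \<open>Equations in the slice and in \<open>E\<close> are interchangeable:
      \<open>cmpr g\<close> is cartesian, the bases agree by \<open>sq_k\<close>, and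
      \<open>cmpr_natural\<close> replaces \<open>ea\<close> by \<open>T.eqa\<close>.\<close>
    have transpose: "ea (q, l, g) \<cdot>\<^bsub>E\<^esub> x = z \<longleftrightarrow> T.eqa l \<cdot>\<^bsub>E\<^esub> \<tau> = cmpr g \<cdot>\<^bsub>E\<^esub> z"
      if l: "(q, l, g) \<in> Arr BI" "l \<cdot>\<^bsub>B\<^esub> \<rho> = h" for l
    proof -
      have l': "l \<in> Arr B" "Dom B l = c0" using l(1) q by simp_all
      have e: "cmpr g \<cdot>\<^bsub>E\<^esub> (ea (q, l, g) \<cdot>\<^bsub>E\<^esub> x) = T.eqa l \<cdot>\<^bsub>E\<^esub> \<tau>"
        using T.V.src.Cmp_eq_extend[OF cmpr_natural[OF l(1)], of x] ea(2-5)[OF l(1)] cmpr[OF g]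
          cmpr[OF q(1,3)] x l' q by simp
      have "ea (q, l, g) \<cdot>\<^bsub>E\<^esub> x = z" if "cmpr g \<cdot>\<^bsub>E\<^esub> (ea (q, l, g) \<cdot>\<^bsub>E\<^esub> x) = cmpr g \<cdot>\<^bsub>E\<^esub> z"
        by (rule T.V.cartesian_cancel[OF cmpr(6)[OF g]])
          (use that ea(2-5)[OF l(1)] cmpr[OF g] x z sq_k[OF l] in simp_all)
      then show ?thesis using e by auto
    qed
    show ?thesis
    proof (rule ex1I[of _ "(q, k, g)"])
      show "(q, k, g) \<in> Hom BI q g \<and> ((q, k, g), S.eqa (q, k, g)) \<cdot>\<^bsub>S.Rel\<^esub> ?\<eta> = m"
        using d transpose[OF d k\<rho>] k\<tau> k\<rho> by (simp add: in_Hom m_def' ea(1)[OF d])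
      show "l = (q, k, g)" if l: "l \<in> Hom BI q g \<and> (l, S.eqa l) \<cdot>\<^bsub>S.Rel\<^esub> ?\<eta> = m" for l
      proof -
        obtain l' where l': "l = (q, l', g)" using l by (cases l) (auto simp: in_Hom)
        have lA: "(q, l', g) \<in> Arr BI" using l by (simp add: in_Hom l')
        have "l' \<cdot>\<^bsub>B\<^esub> \<rho> = h" "ea (q, l', g) \<cdot>\<^bsub>E\<^esub> x = z"
          using l unfolding l' m_def' ea(1)[OF lA] by simp_all
        then have "l' = k" using transpose[OF lA] lA q h by (intro k_unique) (simp_all add: in_Hom)
        then show ?thesis using l' by simp
      qed
    qed
  qed
  have "q \<in> Obj BI" using q by simp
  then show ?thesis using \<eta> ex1 by blast
qed

end

theorem theorem5p3:
  fixes E :: "('eo, 'em) cat" and B :: "('bo, 'bm) cat"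
    and U :: "('eo, 'em, 'bo, 'bm) func" and K :: "('bo, 'bm, 'eo, 'em) func"
    and pr :: "('bo, 'bm) spans" and pb :: "('bm, 'bm) spans"
    and I :: 'bo and F :: "('bm, 'bm \<times> 'bm \<times> 'bm, 'bm, 'bm \<times> 'bm \<times> 'bm) func"
    and \<nu>F :: 'bm and \<zeta> :: "'bm \<times> 'bm \<times> 'bm"
  assumes "bifibration E B U"
    and "beck_chevalley E B U"
    and "binary_products B pr"
    and "pullbacks B pb"
    and "truth_functor E B U K"
    and "has_left_adjoint B (Rel_cat E B U pr) (Eq_func E B U pr K)"
    and "I \<in> Obj B"
    and "cat_functor (slice B I) (slice B I) F"
    and "terminal (coalg (slice B I) F) (\<nu>F, \<zeta>)"
  shows "\<exists>F' \<phi>.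
    eq_preserving_lifting (slice E (omap K I)) (slice B I) (slice_func U) (slice_products B pb)
      (slice_func K) F F' \<phi> \<and>
    sound_coinduction (slice E (omap K I)) (slice B I) (slice_func U) (slice_products B pb)
      (slice_func K) F F' \<phi>"
proof -
  interpret indexed_equality E B U K pr pb I by unfold_locales (rule assms)+
  have "\<exists>F' \<phi>. cat_functor S.Rel S.Rel F' \<and> func_eq S.Rel (Rel_func \<circ>\<^sub>F F') (F \<circ>\<^sub>F Rel_func) \<and>
      nat_iso BI S.Rel (Eq_func EI BI (slice_func U) (slice_products B pb) (slice_func K) \<circ>\<^sub>F F)
        (F' \<circ>\<^sub>F Eq_func EI BI (slice_func U) (slice_products B pb) (slice_func K)) \<phi> \<and>
      preserves_terminal (coalg BI F) (coalg S.Rel F')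
        (coalg_func S.Rel (Eq_func EI BI (slice_func U) (slice_products B pb) (slice_func K)) \<phi>)"
    by (rule coinduction_lifting_of_universal_arrows[OF S.fibration_Rel_func[OF slice_fib] S.cat_functor_Eq
          S.Rel_func_Eq])
      (use Eq_full slice_universal_arrow assms(8) in \<open>simp_all only: S.Eq_func_simps\<close>)
  then show ?thesis unfolding eq_preserving_lifting_def sound_coinduction_def by blast
qed

end
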